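(* (Pietsch Factorization Theorem) Let $1\leq p<\infty$, and let $T:E\to L$ be an operator from a locally convex space $E$ to a Banach space $L$. Then the following assertions are equivalent: (i) $T$ is $U$-$p$-summing for some $U\in\mathcal{N}_0^c(E)$; (ii) there exist $U\in\mathcal{N}_0^c(E)$, a regular probability measure $\mu$ on the compact space $K:=\big(U^\circ,\sigma(E',E){\restriction}_{U^\circ}\big)$, an operator $I_U:E\to C(K)$, a closed subspace $H_p$ of $L_p(\mu)$ with $J_p(I_U(E))\subseteq H_p$, and an operator $\hat T:H_p\to L$ such that $T=\hat T\circ J_p^E\circ I_E$, where $I_E:E\to I_U(E)$ is the co-restriction of $I_U$ to its image and $J_p^E:I_U(E)\to H_p$ is the restriction of $J_p$; (iii) there exist $U\in\mathcal{N}_0^c(E)$, a regular probability measure $\mu$ on the compact space $K:=\big(U^\circ,\sigma(E',E){\restriction}_{U^\circ}\big)$, an operator $I_U:E\to C(K)$, and an operator $\tilde T:L_p(\mu)\to\ell_\infty(B_{L'})$ such that $i_L\circ T=\tilde T\circ J_p\circ I_U$; (iv) there exist $U\in\mathcal{N}_0^c(E)$, a regular probability measure $\mu$ on the compact space $K:=\big(U^\circ,\sigma(E',E){\restriction}_{U^\circ}\big)$, an operator $I_U^\infty:E\to L_\infty(\mu)$, and an operator $\tilde T:L_p(\mu)\to\ell_\infty(B_{L'})$ such that $i_L\circ T=\tilde T\circ J_p^\infty\circ I_U^\infty$.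
   Context: All locally convex spaces are Hausdorff, over $\mathbb{F}\in\{\mathbb{R},\mathbb{C}\}$. An operator is a continuous linear map. $\mathcal{N}_0^c(E)$ is the family of all closed absolutely convex neighborhoods of zero in $E$; $U^\circ=\{\chi\in E':|\langle\chi,x\rangle|\le1\ \forall x\in U\}$; $\sigma(E',E)$ is the weak$^\ast$ topology. For a regular probability measure $\mu$ on a compact space $K$, $J_p:C(K)\to L_p(\mu)$ and $J_p^\infty:L_\infty(\mu)\to L_p(\mu)$ denote the canonical (identity) maps. $B_{L'}$ is the closed unit ball of the Banach dual of $L$, and $i_L:L\to\ell_\infty(B_{L'})$, $i_L(y)=(\langle\chi,y\rangle)_{\chi\in B_{L'}}$, is the canonical isometric embedding. For an absolutely convex closed subset $U$ of $E$, an operator $T:E\to L$ into a Banach space is $U$-$p$-summing if there is a constant $C>0$ such that for every $n\in\omega$ and all $x_0,\dots,x_n\in U$, $$\Big(\sum_{i=0}^n\|T(x_i)\|^p\Big)^{1/p}\leq C\cdot\sup\Big\{\Big(\sum_{i=0}^n|\langle\chi,x_i\rangle|^p\Big)^{1/p}:\chi\in U^\circ\Big\}.$$ *)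

theory Defs
  imports "HOL-Probability.Probability"
begin

section \<open>The scalar field\<close>

text \<open>Up to isometric isomorphism, the members of this class are exactly the real and the complex
  numbers, so that a type variable of this class is a scalar field that is either of the two.
  The superclass \<^class>\<open>euclidean_space\<close> adds no restriction: the inner product is determined by
  the norm.\<close>

class rc_field = real_normed_field + euclidean_space +
  assumes real_or_complex:
    "(\<exists>\<phi>::'a \<Rightarrow> real. bij \<phi> \<and> (\<forall>x y. \<phi> (x + y) = \<phi> x + \<phi> y) \<and>
        (\<forall>x y. \<phi> (x * y) = \<phi> x * \<phi> y) \<and> (\<forall>x. norm (\<phi> x) = norm x)) \<or>
     (\<exists>\<phi>::'a \<Rightarrow> complex. bij \<phi> \<and> (\<forall>x y. \<phi> (x + y) = \<phi> x + \<phi> y) \<and>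
        (\<forall>x y. \<phi> (x * y) = \<phi> x * \<phi> y) \<and> (\<forall>x. norm (\<phi> x) = norm x))"

instance real :: rc_field
  by standard (rule disjI1, rule exI[of _ "\<lambda>x. x"], simp add: bij_def)

instance complex :: rc_field
  by standard (rule disjI2, rule exI[of _ "\<lambda>x. x"], simp add: bij_def)


section \<open>Topological vector spaces and operators\<close>

text \<open>Function spaces such as \<open>L\<^sub>p(\<mu>)\<close> depend on the terms \<open>U\<close> and \<open>\<mu>\<close>, hence cannot be types;
  they are given by explicit carriers.  The spaces \<open>E\<close> and \<open>L\<close> are types, together with
  a multiplication by scalars.\<close>

record ('f, 'v) tvs =
  Vcarrier :: "'v set"
  Vadd :: "'v \<Rightarrow> 'v \<Rightarrow> 'v"
  Vscale :: "'f \<Rightarrow> 'v \<Rightarrow> 'v"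
  Vtop :: "'v topology"

definition type_tvs ::
    "('f::rc_field \<Rightarrow> 'v \<Rightarrow> 'v::{topological_space, ab_group_add}) \<Rightarrow> ('f, 'v) tvs" where
  "type_tvs smul = \<lparr>Vcarrier = UNIV, Vadd = (+), Vscale = smul, Vtop = euclidean\<rparr>"

text \<open>The locale \<^locale>\<open>Metric_space\<close> requires distances to be nonnegative and symmetric also outside
  the carrier, hence the value \<open>0\<close> there.\<close>

definition norm_dist ::
    "'v set \<Rightarrow> ('v \<Rightarrow> 'v \<Rightarrow> 'v) \<Rightarrow> ('f::rc_field \<Rightarrow> 'v \<Rightarrow> 'v) \<Rightarrow> ('v \<Rightarrow> real) \<Rightarrow> 'v \<Rightarrow> 'v \<Rightarrow> real" where
  "norm_dist S add smul nrm x y =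
     (if x \<in> S \<and> y \<in> S then nrm (add x (smul (- 1) y)) else 0)"

definition normed_tvs ::
    "'v set \<Rightarrow> ('v \<Rightarrow> 'v \<Rightarrow> 'v) \<Rightarrow> ('f::rc_field \<Rightarrow> 'v \<Rightarrow> 'v) \<Rightarrow> ('v \<Rightarrow> real) \<Rightarrow> ('f, 'v) tvs" where
  "normed_tvs S add smul nrm =
     \<lparr>Vcarrier = S, Vadd = add, Vscale = smul,
      Vtop = Metric_space.mtopology S (norm_dist S add smul nrm)\<rparr>"

definition sub_tvs :: "('f, 'v) tvs \<Rightarrow> 'v set \<Rightarrow> ('f, 'v) tvs" where
  "sub_tvs X H = X\<lparr>Vcarrier := H, Vtop := subtopology (Vtop X) H\<rparr>"

definition closed_subspace :: "('f, 'v) tvs \<Rightarrow> 'v set \<Rightarrow> bool" where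
  "closed_subspace X H \<longleftrightarrow> H \<subseteq> Vcarrier X \<and> H \<noteq> {} \<and>
     (\<forall>x\<in>H. \<forall>y\<in>H. Vadd X x y \<in> H) \<and> (\<forall>a. \<forall>x\<in>H. Vscale X a x \<in> H) \<and> closedin (Vtop X) H"

definition is_operator :: "('f, 'v) tvs \<Rightarrow> ('f, 'w) tvs \<Rightarrow> ('v \<Rightarrow> 'w) \<Rightarrow> bool" where
  "is_operator X Y T \<longleftrightarrow> T \<in> Vcarrier X \<rightarrow> Vcarrier Y \<and>
     (\<forall>x\<in>Vcarrier X. \<forall>y\<in>Vcarrier X. T (Vadd X x y) = Vadd Y (T x) (T y)) \<and>
     (\<forall>a. \<forall>x\<in>Vcarrier X. T (Vscale X a x) = Vscale Y a (T x)) \<and>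
     continuous_map (Vtop X) (Vtop Y) T"

definition absolutely_convex ::
    "('f::rc_field \<Rightarrow> 'v \<Rightarrow> 'v::ab_group_add) \<Rightarrow> 'v set \<Rightarrow> bool" where
  "absolutely_convex smul U \<longleftrightarrow>
     (\<forall>x\<in>U. \<forall>y\<in>U. \<forall>a b. norm a + norm b \<le> 1 \<longrightarrow> smul a x + smul b y \<in> U)"

locale locally_convex_space = vector_space smul
  for smul :: "'f::rc_field \<Rightarrow> 'e \<Rightarrow> 'e::{topological_ab_group_add, t2_space}" +
  assumes continuous_scale: "continuous_on UNIV (\<lambda>(a, x). smul a x)"
    and locally_convex:
      "\<And>W. open W \<Longrightarrow> 0 \<in> W \<Longrightarrow> \<exists>V. absolutely_convex smul V \<and> 0 \<in> interior V \<and> V \<subseteq> W"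

locale banach_space_over = vector_space smul
  for smul :: "'f::rc_field \<Rightarrow> 'l \<Rightarrow> 'l::banach" +
  assumes norm_scale: "norm (smul a y) = norm a * norm y"
    and scale_of_real: "smul (of_real r) y = r *\<^sub>R y"

definition closed_ac_nhds0 ::
    "('f::rc_field \<Rightarrow> 'e \<Rightarrow> 'e::{topological_space, ab_group_add}) \<Rightarrow> 'e set set" where
  "closed_ac_nhds0 smul = {U. closed U \<and> absolutely_convex smul U \<and> 0 \<in> interior U}"


section \<open>Duality\<close>

definition top_dual ::
    "('f::rc_field \<Rightarrow> 'e \<Rightarrow> 'e::{topological_space, ab_group_add}) \<Rightarrow> ('e \<Rightarrow> 'f) set" where
  "top_dual smul = {\<xi>. is_operator (type_tvs smul) (type_tvs (*)) \<xi>}"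

definition polar ::
    "('f::rc_field \<Rightarrow> 'e \<Rightarrow> 'e::{topological_space, ab_group_add}) \<Rightarrow> 'e set \<Rightarrow> ('e \<Rightarrow> 'f) set" where
  "polar smul U = {\<xi> \<in> top_dual smul. \<forall>x\<in>U. norm (\<xi> x) \<le> 1}"

text \<open>The topology of the function type \<open>'e \<Rightarrow> 'f\<close> is that of pointwise convergence.\<close>

definition weak_star ::
    "('f::rc_field \<Rightarrow> 'e \<Rightarrow> 'e::{topological_space, ab_group_add}) \<Rightarrow> ('e \<Rightarrow> 'f) topology" where
  "weak_star smul = top_of_set (top_dual smul)"

definition polar_space ::
    "('f::rc_field \<Rightarrow> 'e \<Rightarrow> 'e::{topological_space, ab_group_add}) \<Rightarrow> 'e set \<Rightarrow> ('e \<Rightarrow> 'f) topology" where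
  "polar_space smul U = subtopology (weak_star smul) (polar smul U)"

definition dual_ball :: "('f::rc_field \<Rightarrow> 'l \<Rightarrow> 'l::banach) \<Rightarrow> ('l \<Rightarrow> 'f) set" where
  "dual_ball smul = {\<xi> \<in> top_dual smul. onorm \<xi> \<le> 1}"


section \<open>The function spaces\<close>

text \<open>Functions on a set are represented by functions that are \<^const>\<open>undefined\<close> outside it.\<close>

definition C_space :: "'k topology \<Rightarrow> ('f::rc_field, 'k \<Rightarrow> 'f) tvs" where
  "C_space K = normed_tvs {f \<in> extensional (topspace K). continuous_map K euclidean f}
     (\<lambda>f g. \<lambda>k\<in>topspace K. f k + g k) (\<lambda>a f. \<lambda>k\<in>topspace K. a * f k)
     (\<lambda>f. SUP k\<in>topspace K. norm (f k))"

definition linf_space :: "'s set \<Rightarrow> ('f::rc_field, 's \<Rightarrow> 'f) tvs" where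
  "linf_space S = normed_tvs {f \<in> extensional S. bounded (f ` S)}
     (\<lambda>f g. \<lambda>s\<in>S. f s + g s) (\<lambda>a f. \<lambda>s\<in>S. a * f s)
     (\<lambda>f. SUP s\<in>S. norm (f s))"

definition canonical_embedding ::
    "('f::rc_field \<Rightarrow> 'l \<Rightarrow> 'l::banach) \<Rightarrow> 'l \<Rightarrow> (('l \<Rightarrow> 'f) \<Rightarrow> 'f)" where
  "canonical_embedding smul y = (\<lambda>\<xi>\<in>dual_ball smul. \<xi> y)"

definition regular_prob_measure :: "'k topology \<Rightarrow> 'k measure \<Rightarrow> bool" where
  "regular_prob_measure K M \<longleftrightarrow> prob_space M \<and>
     space M = topspace K \<and> sets M = sigma_sets (topspace K) {W. openin K W} \<and>
     (\<forall>A\<in>sets M.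
        emeasure M A = (SUP C\<in>{C. compactin K C \<and> C \<subseteq> A}. emeasure M C) \<and>
        emeasure M A = (INF W\<in>{W. openin K W \<and> A \<subseteq> W}. emeasure M W))"

text \<open>The elements of \<open>L\<^sub>p(\<mu>)\<close> and \<open>L\<^sub>\<infinity>(\<mu>)\<close> are classes of measurable functions modulo equality
  almost everywhere.  Norms of classes are computed on a representative.\<close>

definition ae_class :: "'k measure \<Rightarrow> ('k \<Rightarrow> 'f::rc_field) \<Rightarrow> ('k \<Rightarrow> 'f) set" where
  "ae_class M f = {g \<in> borel_measurable M. AE k in M. g k = f k}"

definition class_add :: "'k measure \<Rightarrow> ('k \<Rightarrow> 'f::rc_field) set \<Rightarrow> ('k \<Rightarrow> 'f) set \<Rightarrow> ('k \<Rightarrow> 'f) set" where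
  "class_add M A B = {h \<in> borel_measurable M. \<exists>f\<in>A. \<exists>g\<in>B. AE k in M. h k = f k + g k}"

definition class_scale :: "'k measure \<Rightarrow> 'f::rc_field \<Rightarrow> ('k \<Rightarrow> 'f) set \<Rightarrow> ('k \<Rightarrow> 'f) set" where
  "class_scale M a A = {h \<in> borel_measurable M. \<exists>f\<in>A. AE k in M. h k = a * f k}"

definition class_rep :: "('k \<Rightarrow> 'f) set \<Rightarrow> 'k \<Rightarrow> 'f" where
  "class_rep A = (SOME f. f \<in> A)"

definition Lp_space :: "real \<Rightarrow> 'k measure \<Rightarrow> ('f::rc_field, ('k \<Rightarrow> 'f) set) tvs" where
  "Lp_space p M = normed_tvs
     {ae_class M f | f. f \<in> borel_measurable M \<and> integrable M (\<lambda>k. norm (f k) powr p)}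
     (class_add M) (class_scale M)
     (\<lambda>A. (\<integral>k. norm (class_rep A k) powr p \<partial>M) powr (1 / p))"

definition Linf_space :: "'k measure \<Rightarrow> ('f::rc_field, ('k \<Rightarrow> 'f) set) tvs" where
  "Linf_space M = normed_tvs
     {ae_class M f | f. f \<in> borel_measurable M \<and> (\<exists>c. AE k in M. norm (f k) \<le> c)}
     (class_add M) (class_scale M)
     (\<lambda>A. real_of_ereal (esssup M (\<lambda>k. ereal (norm (class_rep A k)))))"

text \<open>The canonical maps \<open>C(K) \<rightarrow> L\<^sub>p(\<mu>)\<close> and \<open>L\<^sub>\<infinity>(\<mu>) \<rightarrow> L\<^sub>p(\<mu>)\<close>; neither depends on \<open>p\<close> as a function.\<close>

definition J :: "'k measure \<Rightarrow> ('k \<Rightarrow> 'f::rc_field) \<Rightarrow> ('k \<Rightarrow> 'f) set" where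
  "J M f = ae_class M f"

definition Jinf :: "('k \<Rightarrow> 'f::rc_field) set \<Rightarrow> ('k \<Rightarrow> 'f) set" where
  "Jinf A = A"


section \<open>Summing operators\<close>

definition p_summing_wrt ::
    "('f::rc_field \<Rightarrow> 'e \<Rightarrow> 'e::{topological_space, ab_group_add}) \<Rightarrow> 'e set \<Rightarrow> real \<Rightarrow>
     ('e \<Rightarrow> 'l::real_normed_vector) \<Rightarrow> bool" where
  "p_summing_wrt smul U p T \<longleftrightarrow> (\<exists>C>0. \<forall>n. \<forall>x::nat \<Rightarrow> 'e. (\<forall>i\<le>n. x i \<in> U) \<longrightarrow>
     (\<Sum>i\<le>n. norm (T (x i)) powr p) powr (1 / p) \<le>
       C * (SUP \<xi>\<in>polar smul U. (\<Sum>i\<le>n. norm (\<xi> (x i)) powr p) powr (1 / p)))"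

end

theory Submission
  imports Defs "HOL-Library.Function_Algebras"
begin

text \<open>The cycle of implications rests on the single inequality
\<open>\<parallel>T x\<parallel> \<le> C (\<integral> |\<langle>\<xi>, x\<rangle>|\<^sup>p d\<mu>(\<xi>))\<^sup>1\<^sup>/\<^sup>p\<close> for all \<open>x \<in> E\<close>, where \<open>\<mu>\<close> is a regular probability
measure on the polar \<open>U\<^sup>\<circ>\<close>.

From (i) to the inequality (\<open>pietsch_domination\<close>): put
\<open>\<phi>\<^sub>x(\<xi>) = C\<^sup>p |\<langle>\<xi>, x\<rangle>|\<^sup>p - \<parallel>T x\<parallel>\<^sup>p\<close>.  Being \<open>U\<close>-\<open>p\<close>-summing says that no finite sum of functions
\<open>\<phi>\<^sub>x\<close> is uniformly negative on \<open>U\<^sup>\<circ>\<close>.  These sums form a convex cone on which the sublinear functional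
\<open>sup\<close> is nonnegative, so the Hahn-Banach theorem in its sandwich form gives a linear functional
\<open>\<Lambda> \<le> sup\<close> on the bounded functions on \<open>U\<^sup>\<circ>\<close> that is nonnegative on the cone; it is positive and
normalised.  Its values on indicator functions are a finitely additive probability on all subsets of
\<open>U\<^sup>\<circ>\<close>.  Since \<open>U\<^sup>\<circ>\<close> is weak* compact, \<open>regular_measure_dominating_charge\<close> replaces it by a regular
Borel probability measure that is at least as large on every closed set; slicing a continuous function
\<open>f \<ge> 0\<close> into its closed superlevel sets then gives \<open>\<Lambda> f \<le> \<integral> f d\<mu>\<close>, which for
\<open>f = |\<langle>\<sqdot>, x\<rangle>|\<^sup>p\<close> is the inequality.

From the inequality to (iii): for each \<open>\<xi>\<close> in the dual ball of \<open>L\<close> the functional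
\<open>\<langle>\<sqdot>, x\<rangle> \<mapsto> \<xi> (T x)\<close> is bounded by \<open>C\<close> times the \<open>L\<^sub>p\<close> norm, hence extends to \<open>L\<^sub>p(\<mu>)\<close> with the same
bound; the extensions are the coordinates of the operator into \<open>\<ell>\<^sub>\<infinity>\<close>.  For (ii) the space \<open>H\<^sub>p\<close> is the
preimage of the image of \<open>L\<close> under this operator.  It is closed because \<open>L\<close>, being complete and
isometrically embedded, is closed in \<open>\<ell>\<^sub>\<infinity>\<close>.  For (iv) one composes with the inclusion of \<open>C(K)\<close> in
\<open>L\<^sub>\<infinity>(\<mu>)\<close>.

From (ii), (iii) or (iv) back to (i) (\<open>p_summing_if_dominated_through_Linf\<close>): each factorization
yields \<open>\<parallel>T x\<parallel> \<le> C \<parallel>A x\<parallel>\<^sub>p\<close> with an operator \<open>A : E \<rightarrow> L\<^sub>\<infinity>(\<mu>)\<close>.  Let \<open>U\<close> be the set where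
\<open>\<parallel>A x\<parallel>\<^sub>\<infinity> \<le> 1\<close>.  The averages of \<open>A x\<close> over sets of positive measure are functionals in \<open>U\<^sup>\<circ>\<close>, and over a
set where finitely many functions \<open>A x\<^sub>i\<close> are nearly constant they nearly return the values of these
functions.  Hence \<open>\<Sum>\<^sub>i |A x\<^sub>i|\<^sup>p\<close> is bounded almost everywhere by the supremum over \<open>U\<^sup>\<circ>\<close> in the
definition of \<open>p\<close>-summability.\<close>

section \<open>The Hahn-Banach theorem in sandwich form\<close>

text \<open>The sandwich theorem is applied to bounded functions on a polar, to \<open>p\<close>-integrable functions and to
Banach spaces.  The first two are subspaces of function types and depend on terms, so the ambient
structure is an abelian group with an explicit scalar multiplication and a subspace \<open>V\<close>.\<close>

locale real_subspace = vector_space rs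
  for rs :: "real \<Rightarrow> 'v \<Rightarrow> 'v::ab_group_add" +
  fixes V :: "'v set"
  assumes V: "subspace V"
begin

definition sublinear :: "('v \<Rightarrow> real) \<Rightarrow> bool" where
  "sublinear q \<longleftrightarrow> (\<forall>x\<in>V. \<forall>y\<in>V. q (x + y) \<le> q x + q y) \<and> (\<forall>t>0. \<forall>x\<in>V. q (rs t x) = t * q x)"

lemma V_add: "x \<in> V \<Longrightarrow> y \<in> V \<Longrightarrow> x + y \<in> V"
  and V_scale: "x \<in> V \<Longrightarrow> rs t x \<in> V"
  and V_zero: "0 \<in> V"
  and V_neg: "x \<in> V \<Longrightarrow> - x \<in> V"
  using V by (auto simp: subspace_add subspace_scale subspace_0 subspace_neg)

lemma sublinear_zero:
  assumes "sublinear q"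
  shows "q 0 = 0"
proof -
  have "q (rs 2 0) = 2 * q 0"
    using assms V_zero unfolding sublinear_def by (auto dest!: conjunct2 spec[of _ "2::real"])
  then show ?thesis by simp
qed

lemma sublinear_neg:
  assumes q: "sublinear q" and x: "x \<in> V"
  shows "- q (- x) \<le> q x"
proof -
  have "q (x + - x) \<le> q x + q (- x)"
    using q x V_neg[OF x] unfolding sublinear_def by blast
  then show ?thesis using sublinear_zero[OF q] by simp
qed

definition superlinear_on :: "'v set \<Rightarrow> ('v \<Rightarrow> real) \<Rightarrow> bool" where
  "superlinear_on S f \<longleftrightarrow> S \<subseteq> V \<and> 0 \<in> S \<and>
     (\<forall>x\<in>S. \<forall>y\<in>S. x + y \<in> S \<and> f x + f y \<le> f (x + y)) \<and>
     (\<forall>t>0. \<forall>x\<in>S. rs t x \<in> S \<and> f (rs t x) = t * f x)"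

text \<open>The functional \<open>x \<mapsto> inf {q (x + s) - f s | s \<in> S}\<close>: among all functionals below \<open>q\<close> it is the natural
candidate that is forced to satisfy \<open>m (- s) \<le> - f s\<close>, so that every linear functional below it
dominates \<open>f\<close> on \<open>S\<close>.\<close>

lemma inf_convolution:
  assumes q: "sublinear q" and S: "superlinear_on S f" and fq: "\<And>s. s \<in> S \<Longrightarrow> f s \<le> q s"
  obtains m where "sublinear m" "\<And>x. x \<in> V \<Longrightarrow> m x \<le> q x"
    "\<And>x s. x \<in> V \<Longrightarrow> s \<in> S \<Longrightarrow> m x \<le> q (x + s) - f s"
proof -
  define m where "m x = (INF s\<in>S. q (x + s) - f s)" for x
  have SV: "s \<in> V" if "s \<in> S" for s using S that by (auto simp: superlinear_on_def)
  have S0: "0 \<in> S" using S by (simp add: superlinear_on_def)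
  have f0: "f 0 = 0"
  proof -
    have "f (rs 2 0) = 2 * f 0"
      using S S0 unfolding superlinear_on_def by (auto dest!: conjunct2 spec[of _ "2::real"])
    then show ?thesis by simp
  qed
  have qadd: "q (x + y) \<le> q x + q y" if "x \<in> V" "y \<in> V" for x y
    using q that by (auto simp: sublinear_def)
  have qsc: "q (rs t x) = t * q x" if "x \<in> V" "t > 0" for t x
    using q that by (auto simp: sublinear_def)
  \<comment> \<open>The infimum is over a set bounded below: this is where \<open>f \<le> q\<close> enters.\<close>
  have low: "- q (- x) \<le> q (x + s) - f s" if "x \<in> V" "s \<in> S" for x s
  proof -
    have "q s \<le> q (x + s) + q (- x)"
      using qadd[of "x + s" "- x"] that SV V_neg V_add by simp
    then show ?thesis using fq[OF that(2)] by simp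
  qed
  have bdd: "bdd_below ((\<lambda>s. q (x + s) - f s) ` S)" if "x \<in> V" for x
    using low[OF that] by (auto intro!: bdd_belowI2)
  have le: "m x \<le> q (x + s) - f s" if "x \<in> V" "s \<in> S" for x s
    unfolding m_def by (rule cINF_lower[OF bdd[OF that(1)] that(2)])
  have gr: "c \<le> m x" if "\<And>s. s \<in> S \<Longrightarrow> c \<le> q (x + s) - f s" for c x
    unfolding m_def using S0 that by (intro cINF_greatest) auto
  have add: "m (x + y) \<le> m x + m y" if x: "x \<in> V" and y: "y \<in> V" for x y
  proof -
    have *: "m (x + y) \<le> (q (x + s) - f s) + (q (y + s') - f s')" if s: "s \<in> S" "s' \<in> S" for s s'
    proof -
      have "m (x + y) \<le> q ((x + y) + (s + s')) - f (s + s')"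
        using S s x y by (intro le V_add) (auto simp: superlinear_on_def)
      also have "(x + y) + (s + s') = (x + s) + (y + s')" by (simp add: algebra_simps)
      also have "q \<dots> \<le> q (x + s) + q (y + s')"
        using s x y SV by (intro qadd V_add) auto
      finally have "m (x + y) \<le> q (x + s) + q (y + s') - f (s + s')" by simp
      moreover have "f s + f s' \<le> f (s + s')" using S s by (simp add: superlinear_on_def)
      ultimately show ?thesis by simp
    qed
    have "m (x + y) - (q (x + s) - f s) \<le> m y" if "s \<in> S" for s
      using *[OF that] by (intro gr) (simp add: diff_le_eq add.commute)
    then have "m (x + y) - m y \<le> m x"
      by (intro gr) (simp add: algebra_simps)
    then show ?thesis by simp
  qed
  have sc1: "m (rs t x) \<le> t * m x" if x: "x \<in> V" and t: "t > 0" for t x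
  proof -
    have "m (rs t x) / t \<le> m x"
    proof (rule gr)
      fix s assume s: "s \<in> S"
      have "m (rs t x) \<le> q (rs t x + rs t s) - f (rs t s)"
        using S s x t by (intro le V_scale) (auto simp: superlinear_on_def)
      also have "\<dots> = t * (q (x + s) - f s)"
        using S s x t SV
        by (simp add: scale_right_distrib[symmetric] qsc V_add right_diff_distrib superlinear_on_def)
      finally show "m (rs t x) / t \<le> q (x + s) - f s" using t by (simp add: field_simps)
    qed
    then show ?thesis using t by (simp add: field_simps)
  qed
  have "m (rs t x) = t * m x" if x: "x \<in> V" and t: "t > 0" for t x
  proof (rule antisym)
    have "m (rs (1/t) (rs t x)) \<le> (1/t) * m (rs t x)"
      using x t by (intro sc1 V_scale) auto
    then show "t * m x \<le> m (rs t x)" using t by (simp add: field_simps)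
  qed (rule sc1[OF x t])
  then have "sublinear m" using add by (auto simp: sublinear_def)
  moreover have "m x \<le> q x" if "x \<in> V" for x
    using le[OF that S0] f0 by simp
  ultimately show ?thesis using le that by blast
qed

definition linear_on_V :: "('v \<Rightarrow> real) \<Rightarrow> bool" where
  "linear_on_V L \<longleftrightarrow> (\<forall>x\<in>V. \<forall>y\<in>V. L (x + y) = L x + L y) \<and> (\<forall>t. \<forall>x\<in>V. L (rs t x) = t * L x)"

text \<open>Subadditivity can only fail to be additivity in one direction, and the inf-convolution of \<open>m\<close> with
its own restriction to a ray \<open>{t y | t \<ge> 0}\<close> is a sublinear functional below \<open>m\<close>.  Minimality identifies
the two, which gives the missing inequality \<open>m x + m y \<le> m (x + y)\<close>.\<close>

lemma minimal_sublinear_linear: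
  assumes m: "sublinear m"
    and minimal: "\<And>m'. sublinear m' \<Longrightarrow> (\<And>x. x \<in> V \<Longrightarrow> m' x \<le> m x) \<Longrightarrow> (\<And>x. x \<in> V \<Longrightarrow> m' x = m x)"
  shows "linear_on_V m"
proof -
  have m0: "m 0 = 0" using sublinear_zero[OF m] .
  have msc: "m (rs t x) = t * m x" if "x \<in> V" "t \<ge> 0" for t x
    using m that m0 by (cases "t = 0") (auto simp: sublinear_def)
  have add: "m (x + y) = m x + m y" if x: "x \<in> V" and y: "y \<in> V" for x y
  proof -
    define S where "S = (\<lambda>t. rs t y) ` {0..}"
    have "superlinear_on S m"
      unfolding superlinear_on_def
    proof (intro conjI ballI allI impI)
      show "S \<subseteq> V" using y V_scale by (auto simp: S_def)
      show "0 \<in> S" unfolding S_def by (rule image_eqI[of _ _ 0]) auto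
    next
      fix a b assume "a \<in> S" "b \<in> S"
      then obtain s t where st: "a = rs s y" "b = rs t y" "s \<ge> 0" "t \<ge> 0" by (auto simp: S_def)
      have ab: "a + b = rs (s + t) y" by (simp add: st scale_left_distrib)
      show "a + b \<in> S" using ab st by (auto simp: S_def)
      show "m a + m b \<le> m (a + b)" unfolding ab using st y by (simp add: msc distrib_right)
    next
      fix t :: real and a assume t: "t > 0" and "a \<in> S"
      then obtain s where s: "a = rs s y" "s \<ge> 0" by (auto simp: S_def)
      show "rs t a \<in> S" using t s by (auto simp: S_def)
      show "m (rs t a) = t * m a" using s y t by (intro msc V_scale) (auto intro: V_scale)
    qed
    then obtain m' where m': "sublinear m'" "\<And>x. x \<in> V \<Longrightarrow> m' x \<le> m x"
      "\<And>x s. x \<in> V \<Longrightarrow> s \<in> S \<Longrightarrow> m' x \<le> m (x + s) - m s"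
      using inf_convolution[OF m, of S m] by auto
    have "y \<in> S" unfolding S_def by (rule image_eqI[of _ _ 1]) auto
    then have "m x \<le> m (x + y) - m y"
      using m'(3)[OF x] minimal[OF m'(1,2) x] by auto
    moreover have "m (x + y) \<le> m x + m y" using m x y by (auto simp: sublinear_def)
    ultimately show ?thesis by simp
  qed
  have "m (rs t x) = t * m x" if x: "x \<in> V" for t x
  proof (cases "t \<ge> 0")
    case False
    have "m (rs t x) + m (rs (- t) x) = 0"
      using add[OF V_scale[OF x] V_scale[OF x], of t "- t"] m0 by (simp add: scale_left_distrib[symmetric] del: scale_minus_left)
    then show ?thesis using msc[OF x, of "- t"] False by simp
  qed (simp add: msc x)
  then show ?thesis using add by (auto simp: linear_on_V_def)
qed

text \<open>The infimum of a chain of sublinear functionals below \<open>q\<close> is again sublinear, being bounded below by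
\<open>- q (- x)\<close>; so Zorn's lemma gives a minimal one.  Values outside \<open>V\<close> are fixed to \<open>0\<close>, since
otherwise minimality would be impossible there.\<close>

lemma exists_linear_below:
  assumes q: "sublinear q"
  obtains L where "linear_on_V L" "\<And>x. x \<in> V \<Longrightarrow> L x \<le> q x"
proof -
  define A where "A = {m. sublinear m \<and> (\<forall>x\<in>V. m x \<le> q x) \<and> (\<forall>x. x \<notin> V \<longrightarrow> m x = 0)}"
  \<comment> \<open>Pointwise order reversed, so that the maximal element of Zorn's lemma is minimal.\<close>
  define P where "P a b \<longleftrightarrow> (\<forall>x. b x \<le> a x)" for a b :: "'v \<Rightarrow> real"
  have po: "partial_order_on A (relation_of P A)"
    proof (rule partial_order_on_relation_ofI)
    show "P a a" for a by (simp add: P_def)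
    show "P a c" if "P a b" "P b c" for a b c using that unfolding P_def by (meson order_trans)
    show "a = b" if "P a b" "P b a" for a b using that unfolding P_def by (intro ext antisym) auto
  qed
  have ch: "\<exists>u\<in>A. \<forall>a\<in>C. P a u" if C: "C \<in> Chains (relation_of P A)" for C
  proof (cases "C = {}")
    case True
    have "(\<lambda>x. if x \<in> V then q x else 0) \<in> A"
      using q by (auto simp: A_def sublinear_def V_add V_scale)
    then show ?thesis using True by auto
  next
    case False
    have CA: "C \<subseteq> A" and tot: "\<And>a b. a \<in> C \<Longrightarrow> b \<in> C \<Longrightarrow> P a b \<or> P b a"
      using C by (auto simp: Chains_def relation_of_def)
    have CQ: "sublinear a" "\<And>x. x \<in> V \<Longrightarrow> a x \<le> q x" "\<And>x. x \<notin> V \<Longrightarrow> a x = 0" if "a \<in> C" for a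
      using CA that by (auto simp: A_def)
    define u where "u x = (INF a\<in>C. a x)" for x
    have low: "- q (- x) \<le> a x" if "x \<in> V" "a \<in> C" for x a
      using sublinear_neg[OF CQ(1)[OF that(2)] that(1)] CQ(2)[OF that(2) V_neg[OF that(1)]] by simp
    have bdd: "bdd_below ((\<lambda>a. a x) ` C)" for x
    proof (cases "x \<in> V")
      case True
      then show ?thesis using low by (auto intro!: bdd_belowI2)
    next
      case False
      then show ?thesis by (intro bdd_belowI2[of _ 0]) (use CQ(3)[OF _ False] in force)
    qed
    have le: "u x \<le> a x" if "a \<in> C" for x a
      unfolding u_def by (rule cINF_lower[OF bdd that])
    have gr: "c \<le> u x" if "\<And>a. a \<in> C \<Longrightarrow> c \<le> a x" for c x
      unfolding u_def using False that by (intro cINF_greatest) auto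
    have "u (x + y) \<le> u x + u y" if x: "x \<in> V" and y: "y \<in> V" for x y
    proof -
      have *: "u (x + y) \<le> a x + b y" if ab: "a \<in> C" "b \<in> C" for a b
      proof -
        obtain c where c: "c \<in> C" "c x \<le> a x" "c y \<le> b y"
          using tot[OF ab] ab by (auto simp: P_def)
        have "u (x + y) \<le> c (x + y)" by (rule le[OF c(1)])
        also have "\<dots> \<le> c x + c y" using CQ(1)[OF c(1)] x y by (auto simp: sublinear_def)
        finally show ?thesis using c by simp
      qed
      have "u (x + y) - a x \<le> u y" if "a \<in> C" for a
        using *[OF that] by (intro gr) (simp add: diff_le_eq add.commute)
      then have "u (x + y) - u y \<le> u x"
        by (intro gr) (simp add: algebra_simps)
      then show ?thesis by simp
    qed
    moreover have "u (rs t x) = t * u x" if x: "x \<in> V" and t: "t > 0" for t x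
    proof (rule antisym)
      have "u (rs t x) / t \<le> u x"
      proof (rule gr)
        fix a assume a: "a \<in> C"
        have "u (rs t x) \<le> t * a x"
          using le[OF a, of "rs t x"] CQ(1)[OF a] x t by (auto simp: sublinear_def)
        then show "u (rs t x) / t \<le> a x" using t by (simp add: field_simps)
      qed
      then show "u (rs t x) \<le> t * u x" using t by (simp add: field_simps)
      show "t * u x \<le> u (rs t x)"
      proof (rule gr)
        fix a assume a: "a \<in> C"
        show "t * u x \<le> a (rs t x)"
          using le[OF a, of x] CQ(1)[OF a] x t by (auto simp: sublinear_def)
      qed
    qed
    ultimately have "sublinear u" by (auto simp: sublinear_def)
    moreover have "u x \<le> q x" if "x \<in> V" for x
    proof -
      obtain a where a: "a \<in> C" using False by auto
      show ?thesis using le[OF a, of x] CQ(2)[OF a that] by simp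
    qed
    moreover have "u x = 0" if "x \<notin> V" for x
      proof -
      have "(\<lambda>a. a x) ` C = {0}" using False CQ(3)[OF _ that] by force
      then show ?thesis by (simp add: u_def)
    qed
    ultimately show ?thesis using le by (auto simp: A_def P_def)
  qed
  obtain m where m: "m \<in> A" and min: "\<And>a. a \<in> A \<Longrightarrow> P m a \<Longrightarrow> a = m"
    using predicate_Zorn[OF po ch] by blast
  have "linear_on_V m"
  proof (rule minimal_sublinear_linear)
    show "sublinear m" using m by (simp add: A_def)
  next
    fix m' x assume m': "sublinear m'" "\<And>x. x \<in> V \<Longrightarrow> m' x \<le> m x" and x: "x \<in> V"
    let ?m = "\<lambda>x. if x \<in> V then m' x else 0"
    have m'q: "m' x \<le> q x" if "x \<in> V" for x
      using order_trans[OF m'(2)[OF that]] m that by (simp add: A_def)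
    have "sublinear ?m" using m'(1) by (simp add: sublinear_def V_add V_scale)
    then have "?m \<in> A" using m'q by (simp add: A_def)
    moreover have "P m ?m" using m' m by (auto simp: P_def A_def)
    ultimately have "?m = m" by (rule min)
    from fun_cong[OF this, of x] show "m' x = m x" using x by simp
  qed
  then show ?thesis using that m by (auto simp: A_def)
qed

text \<open>This form of the Hahn-Banach theorem contains both uses made of it: for a subspace \<open>S\<close> and linear \<open>f\<close>
the conclusion \<open>f \<le> L\<close> on \<open>S = - S\<close> is an extension theorem, and for a cone with \<open>f = 0\<close> it is a
separation theorem.\<close>

theorem sandwich:
  assumes q: "sublinear q" and S: "superlinear_on S f" and fq: "\<And>s. s \<in> S \<Longrightarrow> f s \<le> q s"
  obtains L where "linear_on_V L" "\<And>x. x \<in> V \<Longrightarrow> L x \<le> q x" "\<And>s. s \<in> S \<Longrightarrow> f s \<le> L s"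
proof -
  obtain m where m: "sublinear m" "\<And>x. x \<in> V \<Longrightarrow> m x \<le> q x"
    "\<And>x s. x \<in> V \<Longrightarrow> s \<in> S \<Longrightarrow> m x \<le> q (x + s) - f s"
    using inf_convolution[OF assms] by blast
  obtain L where L: "linear_on_V L" "\<And>x. x \<in> V \<Longrightarrow> L x \<le> m x"
    using exists_linear_below[OF m(1)] by blast
  have "f s \<le> L s" if s: "s \<in> S" for s
  proof -
    have sV: "s \<in> V" using s S by (auto simp: superlinear_on_def)
    have "L (- s) \<le> - f s"
      using L(2)[OF V_neg[OF sV]] m(3)[OF V_neg[OF sV] s] sublinear_zero[OF q] by simp
    moreover have "L (- s) = - L s"
    proof -
      have "L (rs (- 1) s) = - 1 * L s" using L(1) sV unfolding linear_on_V_def by blast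
      then show ?thesis by simp
    qed
    ultimately show ?thesis by simp
  qed
  moreover have "L x \<le> q x" if "x \<in> V" for x using L(2) m(2) that by force
  ultimately show ?thesis using L(1) that by blast
qed

end



section \<open>Seminorm-preserving extension over real or complex scalars\<close>

text \<open>The norms of \<open>\<phi> r\<close> and of \<open>\<phi> r + 1\<close> are known, and these two distances (to \<open>0\<close> and to \<open>- 1\<close>)
determine a point of the real axis in the plane.\<close>

lemma isometric_ring_hom_of_real:
  fixes \<phi> :: "'f::real_normed_field \<Rightarrow> complex"
  assumes add: "\<And>x y. \<phi> (x + y) = \<phi> x + \<phi> y" and mult: "\<And>x y. \<phi> (x * y) = \<phi> x * \<phi> y"
    and norm: "\<And>x. norm (\<phi> x) = norm x"
  shows "\<phi> (of_real r) = of_real r"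
proof -
  have one: "\<phi> 1 = 1"
    using mult[of 1 1] norm[of 1] by auto
  define z where "z = \<phi> (of_real r)"
  have 1: "norm z ^ 2 = r ^ 2" using norm[of "of_real r"] by (simp add: z_def)
  have "norm (z + 1) = \<bar>r + 1\<bar>"
    using norm[of "of_real r + 1"] add[of "of_real r" 1] one
    by (metis z_def norm_of_real of_real_1 of_real_add)
  then have 2: "norm (z + 1) ^ 2 = (r + 1) ^ 2" by simp
  have "Re z = r" using 1 2 unfolding cmod_power2 by (simp add: power2_eq_square algebra_simps)
  moreover then have "Im z = 0" using 1 by (simp add: cmod_power2)
  ultimately show ?thesis unfolding z_def[symmetric] by (simp add: complex_eq_iff)
qed

text \<open>Polarisation: the real part is determined by the norm, so a norm-preserving isomorphism transports it.\<close>

lemma inner_one_eq: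
  fixes a :: "'f::{real_normed_field, euclidean_space}"
  shows "inner 1 a = (norm (1 + a) ^ 2 - norm a ^ 2 - 1) / 2"
proof -
  have "norm (1 + a) ^ 2 = inner (1::'f) 1 + 2 * inner 1 a + norm a ^ 2"
    by (simp add: power2_norm_eq_inner inner_add_left inner_add_right inner_commute)
  moreover have "inner (1::'f) 1 = norm (1::'f) ^ 2" by (simp only: power2_norm_eq_inner)
  ultimately show ?thesis by simp
qed

text \<open>A uniform description of the real and the complex scalars: \<open>j\<close> is an imaginary unit in the complex case
and \<open>0\<close> in the real case, and \<open>inner 1\<close> is the real part.  With it a scalar is recovered from real
parts by one formula, and so is a scalar-linear functional from its real part.\<close>

lemma rc_field_imaginary_unit:
  obtains j :: "'f::rc_field"
  where "\<And>a. a = of_real (inner 1 a) - of_real (inner 1 (j * a)) * j" "j = 0 \<or> j * j = - 1"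
proof -
  have "(\<exists>\<phi>::'f \<Rightarrow> complex. inj \<phi> \<and> (range \<phi> = UNIV \<or> range \<phi> \<subseteq> range of_real) \<and>
        (\<forall>x y. \<phi> (x + y) = \<phi> x + \<phi> y) \<and> (\<forall>x y. \<phi> (x * y) = \<phi> x * \<phi> y) \<and> (\<forall>x. norm (\<phi> x) = norm x))"
    using real_or_complex[where 'a='f]
  proof (elim disjE exE conjE)
    fix \<phi> :: "'f \<Rightarrow> real"
    assume "bij \<phi>" "\<forall>x y. \<phi> (x + y) = \<phi> x + \<phi> y" "\<forall>x y. \<phi> (x * y) = \<phi> x * \<phi> y" "\<forall>x. norm (\<phi> x) = norm x"
    then show ?thesis
      by (intro exI[of _ "\<lambda>x. complex_of_real (\<phi> x)"]) (auto simp: bij_def inj_def)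
  next
    fix \<phi> :: "'f \<Rightarrow> complex"
    assume "bij \<phi>" "\<forall>x y. \<phi> (x + y) = \<phi> x + \<phi> y" "\<forall>x y. \<phi> (x * y) = \<phi> x * \<phi> y" "\<forall>x. norm (\<phi> x) = norm x"
    then show ?thesis
      by (intro exI[of _ \<phi>]) (auto simp: bij_def)
  qed
  then obtain \<phi> :: "'f \<Rightarrow> complex" where inj: "inj \<phi>" and range: "range \<phi> = UNIV \<or> range \<phi> \<subseteq> range of_real"
    and add: "\<And>x y. \<phi> (x + y) = \<phi> x + \<phi> y" and mult: "\<And>x y. \<phi> (x * y) = \<phi> x * \<phi> y"
    and norm: "\<And>x. norm (\<phi> x) = norm x" by blast
  note real = isometric_ring_hom_of_real[OF add mult norm]
  have one: "\<phi> 1 = 1" using real[of 1] by simp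
  have minus: "\<phi> (x - y) = \<phi> x - \<phi> y" for x y using add[of "x - y" y] by simp
  have inner: "inner 1 a = Re (\<phi> a)" for a
  proof -
    have "norm (1 + a) ^ 2 = norm (1 + \<phi> a) ^ 2" using norm[of "1 + a"] add[of 1 a] one by simp
    then have "inner 1 a = (norm (1 + \<phi> a) ^ 2 - norm (\<phi> a) ^ 2 - 1) / 2"
      by (simp add: inner_one_eq norm)
    also have "\<dots> = Re (\<phi> a)" unfolding cmod_power2 by (simp add: power2_eq_square algebra_simps)
    finally show ?thesis .
  qed
  show ?thesis
  proof (cases "range \<phi> = UNIV")
    case True
    then obtain j where j: "\<phi> j = \<i>" by (metis UNIV_I imageE)
    have "\<phi> a = \<phi> (of_real (inner 1 a) - of_real (inner 1 (j * a)) * j)" for a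
      by (simp add: minus add mult real inner j complex_eq_iff)
    moreover have "\<phi> (j * j) = \<phi> (- 1)"
      using mult[of j j] j minus[of 0 1] minus[of 0 0] one by simp
    ultimately show ?thesis using that[of j] inj by (meson injD)
  next
    case False
    then have "\<phi> a \<in> range of_real" for a using range by auto
    then have "\<phi> a = \<phi> (of_real (inner 1 a))" for a
      by (subst real) (auto simp: inner complex_eq_iff image_iff)
    then have "a = of_real (inner 1 a)" for a :: 'f using inj by (meson injD)
    then show ?thesis using that[of 0] by auto
  qed
qed

text \<open>The real part of \<open>l\<close> is extended by the sandwich theorem to \<open>R\<close>, and
\<open>L x = R x - R (j x) j\<close> is the scalar-linear functional with real part \<open>R\<close>.  Multiplying \<open>x\<close>
by a unimodular scalar makes \<open>L x\<close> real and nonnegative, whence \<open>|L x| \<le> q x\<close>.\<close>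

theorem hahn_banach_seminorm:
  fixes sc :: "'f::rc_field \<Rightarrow> 'v::ab_group_add \<Rightarrow> 'v"
  assumes vs: "vector_space sc" and V: "module.subspace sc V" and F: "module.subspace sc F" and FV: "F \<subseteq> V"
    and q_add: "\<And>x y. x \<in> V \<Longrightarrow> y \<in> V \<Longrightarrow> q (x + y) \<le> q x + q y"
    and q_sc: "\<And>a x. x \<in> V \<Longrightarrow> q (sc a x) = norm a * q x"
    and l_add: "\<And>x y. x \<in> F \<Longrightarrow> y \<in> F \<Longrightarrow> l (x + y) = l x + l y"
    and l_sc: "\<And>a x. x \<in> F \<Longrightarrow> l (sc a x) = a * l x"
    and l_le: "\<And>x. x \<in> F \<Longrightarrow> norm (l x) \<le> q x"
  obtains L where "\<And>x y. x \<in> V \<Longrightarrow> y \<in> V \<Longrightarrow> L (x + y) = L x + L y"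
    "\<And>a x. x \<in> V \<Longrightarrow> L (sc a x) = a * L x"
    "\<And>x. x \<in> V \<Longrightarrow> norm (L x) \<le> q x"
    "\<And>x. x \<in> F \<Longrightarrow> L x = (l x :: 'f)"
proof -
  interpret vector_space sc by (rule vs)
  define rs where "rs = (\<lambda>r x. sc (of_real r) x)"
  interpret R: vector_space rs
    by standard (auto simp: rs_def scale_right_distrib scale_left_distrib)
  interpret R: real_subspace rs V
    by standard (use V in \<open>unfold R.subspace_def subspace_def, auto simp: rs_def\<close>)
  have V_sc: "sc a x \<in> V" if "x \<in> V" for a x using V that by (rule subspace_scale)
  have F_sc: "sc a x \<in> F" if "x \<in> F" for a x using F that by (rule subspace_scale)
  have q: "R.sublinear q"
    unfolding R.sublinear_def using q_add q_sc by (auto simp: rs_def)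
  have Re_le: "inner 1 a \<le> norm a" for a :: 'f
    using norm_cauchy_schwarz[of 1 a] by simp
  have S: "R.superlinear_on F (\<lambda>x. inner 1 (l x))"
    unfolding R.superlinear_on_def using FV subspace_0[OF F] subspace_add[OF F] F_sc l_add l_sc
    by (auto simp: rs_def inner_add_right scaleR_conv_of_real[symmetric])
  have "inner 1 (l x) \<le> q x" if "x \<in> F" for x
    using Re_le[of "l x"] l_le[OF that] by simp
  then obtain R where R: "R.linear_on_V R" "\<And>x. x \<in> V \<Longrightarrow> R x \<le> q x" "\<And>x. x \<in> F \<Longrightarrow> inner 1 (l x) \<le> R x"
    using R.sandwich[OF q S] by blast
  have R_add: "R (x + y) = R x + R y" if "x \<in> V" "y \<in> V" for x y
    using R(1) that unfolding R.linear_on_V_def by auto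
  have R_sc: "R (sc (of_real r) x) = r * R x" if "x \<in> V" for r x
    using R(1) that unfolding R.linear_on_V_def by (auto simp: rs_def)
  have R_minus: "R (- x) = - R x" if "x \<in> V" for x
    using R_sc[OF that, of "- 1"] by simp
  have RF: "R x = inner 1 (l x)" if x: "x \<in> F" for x
  proof -
    have "- x \<in> F" using F x by (rule subspace_neg)
    moreover have "l (- x) = - l x" using l_sc[OF x, of "- 1"] by simp
    ultimately show ?thesis using R(3)[OF x] R(3)[of "- x"] R_minus x FV by auto
  qed
  obtain j :: 'f where j: "\<And>a. a = of_real (inner 1 a) - of_real (inner 1 (j * a)) * j"
    and jj: "j = 0 \<or> j * j = - 1" by (rule rc_field_imaginary_unit) blast
  define L where "L x = of_real (R x) - of_real (R (sc j x)) * j" for x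
  have L_add: "L (x + y) = L x + L y" if "x \<in> V" "y \<in> V" for x y
    using that by (simp add: L_def R_add V_sc scale_right_distrib algebra_simps)
  have L_real: "L (sc (of_real r) x) = of_real r * L x" if "x \<in> V" for r x
  proof -
    have "sc j (sc (of_real r) x) = sc (of_real r) (sc j x)" by (simp add: mult.commute)
    then show ?thesis using that unfolding L_def by (simp add: R_sc V_sc algebra_simps del: scale_scale)
  qed
  have L_j: "L (sc j x) = j * L x" if x: "x \<in> V" for x
    using jj
  proof
    assume jj: "j * j = - 1"
    have jjc: "j * (j * c) = - c" for c using jj by (simp add: mult.assoc[symmetric])
    show ?thesis using x jj
      by (simp add: L_def R_minus jjc algebra_simps)
  next
    assume "j = 0"
    then show ?thesis using R_sc[OF x, of 0] by (simp add: L_def)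
  qed
  have L_sc: "L (sc a x) = a * L x" if x: "x \<in> V" for a x
  proof -
    define s t where "s = inner 1 a" and "t = - inner 1 (j * a)"
    have a: "a = of_real s + of_real t * j" using j[of a] by (simp add: s_def t_def)
    have "sc a x = sc (of_real s) x + sc (of_real t) (sc j x)"
      unfolding a by (simp add: scale_left_distrib)
    then have "L (sc a x) = of_real s * L x + of_real t * (j * L x)"
      using x by (simp only: L_add V_sc L_real L_j)
    then show ?thesis unfolding a by (simp add: algebra_simps)
  qed
  have Re_L: "inner 1 (L x) = R x" if x: "x \<in> V" for x
  proof -
    have "inner 1 j = 0 \<or> j = 0"
      using jj
    proof
      assume "j * j = - 1"
      moreover then have "j \<noteq> 0" by auto
      ultimately have "of_real (inner 1 j) = (0::'f)"
        using j[of j] by (simp add: inner_minus_right dot_square_norm)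
      then show ?thesis by simp
    qed simp
    then have "inner 1 (of_real r * j) = 0" for r
      by (auto simp: scaleR_conv_of_real[symmetric])
    then show ?thesis
      by (simp add: L_def inner_diff_right of_real_def dot_square_norm)
  qed
  have "norm (L x) \<le> q x" if x: "x \<in> V" for x
  proof (cases "L x = 0")
    case True
    have "0 \<le> q x"
      using q_add[OF x V_sc[OF x, of "- 1"]] q_sc[OF x, of "- 1"] q_sc[OF x, of 0] by simp
    then show ?thesis using True by simp
  next
    case False
    \<comment> \<open>The unimodular scalar that rotates \<open>L x\<close> onto the positive real axis.\<close>
    define u where "u = of_real (norm (L x)) / L x"
    have u: "norm u = 1" "u * L x = of_real (norm (L x))" using False by (auto simp: u_def norm_divide)
    have "norm (L x) = inner 1 (L (sc u x))"
      using u x by (simp add: L_sc of_real_def dot_square_norm)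
    also have "\<dots> = R (sc u x)" using x by (simp add: Re_L V_sc)
    also have "\<dots> \<le> q x" using R(2)[OF V_sc[OF x], of u] q_sc[OF x, of u] u by simp
    finally show ?thesis .
  qed
  moreover have "L x = l x" if x: "x \<in> F" for x
    using j[of "l x"] x FV by (simp add: L_def RF F_sc l_sc)
  ultimately show ?thesis using that L_add L_sc by blast
qed

section \<open>Normed spaces of classes and their operators\<close>

text \<open>All normed spaces here arise from a space \<open>V\<close> of functions with a seminorm \<open>N\<close> by passing to classes:
\<open>cl\<close> restricts a function to the index set, or forms its class modulo null sets.  The locale derives
the metric and the continuity criteria from \<open>N\<close> alone, so that the algebra takes place in \<open>V\<close>, where
the group laws come from the type.\<close>

locale normed_quotient = vector_space sc
  for sc :: "'f::rc_field \<Rightarrow> 'v::ab_group_add \<Rightarrow> 'v" +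
  fixes V :: "'v set" and N :: "'v \<Rightarrow> real" and cl :: "'v \<Rightarrow> 'x"
    and add :: "'x \<Rightarrow> 'x \<Rightarrow> 'x" and smul :: "'f \<Rightarrow> 'x \<Rightarrow> 'x" and nrm :: "'x \<Rightarrow> real"
  assumes V: "subspace V"
    and N_add: "\<And>x y. x \<in> V \<Longrightarrow> y \<in> V \<Longrightarrow> N (x + y) \<le> N x + N y"
    and N_sc: "\<And>a x. x \<in> V \<Longrightarrow> N (sc a x) = norm a * N x"
    and cl_eq: "\<And>x y. x \<in> V \<Longrightarrow> y \<in> V \<Longrightarrow> cl x = cl y \<longleftrightarrow> N (x - y) = 0"
    and add_cl: "\<And>x y. x \<in> V \<Longrightarrow> y \<in> V \<Longrightarrow> add (cl x) (cl y) = cl (x + y)"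
    and smul_cl: "\<And>a x. x \<in> V \<Longrightarrow> smul a (cl x) = cl (sc a x)"
    and nrm_cl: "\<And>x. x \<in> V \<Longrightarrow> nrm (cl x) = N x"
begin

abbreviation S where "S \<equiv> cl ` V"
abbreviation X where "X \<equiv> normed_tvs S add smul nrm"
abbreviation d where "d \<equiv> norm_dist S add smul nrm"

lemma V_sc: "x \<in> V \<Longrightarrow> sc a x \<in> V" and V_add: "x \<in> V \<Longrightarrow> y \<in> V \<Longrightarrow> x + y \<in> V"
  and V_diff: "x \<in> V \<Longrightarrow> y \<in> V \<Longrightarrow> x - y \<in> V" and V_0: "0 \<in> V"
  using V by (auto simp: subspace_scale subspace_add subspace_diff subspace_0)

lemma N_0: "N 0 = 0"
  using N_sc[OF V_0, of 0] by simp

lemma N_minus: "x \<in> V \<Longrightarrow> N (- x) = N x"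
  using N_sc[of x "- 1"] by simp

lemma N_nonneg: "x \<in> V \<Longrightarrow> 0 \<le> N x"
  using N_add[of x "- x"] N_minus[of x] V_diff[OF V_0, of x] N_0 by simp

lemma dist_cl: "x \<in> V \<Longrightarrow> y \<in> V \<Longrightarrow> d (cl x) (cl y) = N (x - y)"
  using V_sc[of y "- 1"] V_add[of x "- y"]
  by (simp add: norm_dist_def smul_cl add_cl nrm_cl)

sublocale Metric_space S d
proof
  show "0 \<le> d x y" for x y
    by (cases "x \<in> S \<and> y \<in> S") (auto simp: dist_cl N_nonneg V_diff, auto simp: norm_dist_def)
  show "d x y = d y x" for x y
  proof (cases "x \<in> S \<and> y \<in> S")
    case True
    then obtain u v where "u \<in> V" "v \<in> V" "x = cl u" "y = cl v" by auto
    then show ?thesis using N_minus[of "u - v"] by (simp add: dist_cl V_diff)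
  qed (auto simp: norm_dist_def)
  show "d x y = 0 \<longleftrightarrow> x = y" if "x \<in> S" "y \<in> S" for x y
    using that by (auto simp: dist_cl cl_eq)
  show "d x z \<le> d x y + d y z" if xyz: "x \<in> S" "y \<in> S" "z \<in> S" for x y z
  proof -
    obtain u v w where "u \<in> V" "v \<in> V" "w \<in> V" "x = cl u" "y = cl v" "z = cl w" using xyz by blast
    then show ?thesis using N_add[of "u - v" "v - w"] by (simp add: dist_cl V_diff)
  qed
qed

lemma X_simps [simp]: "Vcarrier X = S" "Vadd X = add" "Vscale X = smul" "Vtop X = mtopology"
  by (simp_all add: normed_tvs_def)

lemma nrm_nonneg: "A \<in> S \<Longrightarrow> 0 \<le> nrm A"
  by (auto simp: nrm_cl N_nonneg)

lemma nrm_smul: "A \<in> S \<Longrightarrow> nrm (smul a A) = norm a * nrm A"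
  by (auto simp: nrm_cl smul_cl V_sc N_sc)

lemma nrm_add: "A \<in> S \<Longrightarrow> B \<in> S \<Longrightarrow> nrm (add A B) \<le> nrm A + nrm B"
  by (auto simp: nrm_cl add_cl V_add N_add)

lemma S_add: "A \<in> S \<Longrightarrow> B \<in> S \<Longrightarrow> add A B \<in> S"
  and S_smul: "A \<in> S \<Longrightarrow> smul a A \<in> S"
  by (auto simp: add_cl smul_cl V_add V_sc)

lemma dist_nrm: "A \<in> S \<Longrightarrow> B \<in> S \<Longrightarrow> d A B = nrm (add A (smul (- 1) B))"
  by (simp add: norm_dist_def)

lemma dist_zero: "A \<in> S \<Longrightarrow> d (cl 0) A = nrm A"
  using V_0 by (auto simp: dist_cl nrm_cl N_minus)

lemma smul_zero: "A \<in> S \<Longrightarrow> smul 0 A = cl 0"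
  by (auto simp: smul_cl)

lemma sub_tvs_carrier: "sub_tvs X S = X"
  by (simp add: sub_tvs_def normed_tvs_def)

text \<open>By additivity and homogeneity, a bound on one neighbourhood of zero is a modulus of continuity at every
point.\<close>

lemma is_operator_intoI:
  fixes sE :: "'f \<Rightarrow> 'e::{topological_ab_group_add, t2_space} \<Rightarrow> 'e"
  assumes E: "locally_convex_space sE" and U: "0 \<in> interior U"
    and h_in: "\<And>x. h x \<in> S" and h_add: "\<And>x y. h (x + y) = add (h x) (h y)"
    and h_sc: "\<And>a x. h (sE a x) = smul a (h x)" and h_le: "\<And>x. x \<in> U \<Longrightarrow> nrm (h x) \<le> 1"
  shows "is_operator (type_tvs sE) X h"
proof -
  interpret E: locally_convex_space sE by (rule E)
  have "continuous_map euclidean mtopology h"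
    unfolding continuous_map_to_metric
  proof (intro ballI allI impI)
    fix x :: 'e and e :: real assume e: "e > 0"
    \<comment> \<open>The factor \<open>2\<close> makes the resulting estimate \<open>e / 2\<close>, hence strictly less than the radius.\<close>
    define W where "W = {y. sE (of_real (2 / e)) (y - x) \<in> interior U}"
    have "continuous_on UNIV (\<lambda>y. (of_real (2 / e) :: 'f, y - x))"
      by (intro continuous_intros)
    then have "continuous_on UNIV (\<lambda>y. sE (of_real (2 / e)) (y - x))"
      using continuous_on_compose2[OF E.continuous_scale, of UNIV "\<lambda>y. (of_real (2 / e) :: 'f, y - x)"] by simp
    then have "open W"
      unfolding W_def using open_vimage[OF open_interior] by (simp add: vimage_def)
    moreover have "x \<in> W" using U by (simp add: W_def)
    moreover have "h y \<in> mball (h x) e" if y: "y \<in> W" for y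
    proof -
      define z where "z = sE (of_real (2 / e)) (y - x)"
      have z: "nrm (h z) \<le> 1" using y interior_subset h_le by (auto simp: W_def z_def)
      have "y - x = sE (of_real (e / 2)) z" using e by (simp add: z_def of_real_mult[symmetric] del: of_real_mult)
      then have "nrm (h (y - x)) = (e / 2) * nrm (h z)" using e by (simp add: h_sc nrm_smul h_in norm_divide)
      also have "\<dots> \<le> (e / 2) * 1" using z e by (intro mult_left_mono) auto
      finally have "nrm (h (y - x)) < e" using e by simp
      moreover have "h (y - x) = add (h y) (smul (- 1) (h x))"
        using h_add[of y "- x"] h_sc[of "- 1" x] by simp
      ultimately have "d (h y) (h x) < e" by (simp add: dist_nrm h_in)
      then show ?thesis using h_in commute by (simp add: in_mball)
    qed
    ultimately show "\<exists>U. openin euclidean U \<and> x \<in> U \<and> (\<forall>y\<in>U. h y \<in> mball (h x) e)"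
      by (intro exI[of _ W]) auto
  qed
  then show ?thesis using h_in h_add h_sc by (auto simp: is_operator_def type_tvs_def)
qed

text \<open>The converse direction, and the source of every neighbourhood \<open>U\<close> produced from an operator.\<close>

lemma is_operator_unit_ball:
  fixes sE :: "'f \<Rightarrow> 'e::{topological_ab_group_add, t2_space} \<Rightarrow> 'e"
  assumes E: "locally_convex_space sE" and h: "is_operator (type_tvs sE) X h"
  shows "{x. nrm (h x) \<le> 1} \<in> closed_ac_nhds0 sE"
proof -
  interpret E: locally_convex_space sE by (rule E)
  have h_in: "h x \<in> S" and h_add: "h (x + y) = add (h x) (h y)" and h_sc: "h (sE a x) = smul a (h x)"
    and cont: "continuous_map euclidean mtopology h" for x y a
    using h by (auto simp: is_operator_def type_tvs_def)
  have h0: "h 0 = cl 0" using h_sc[of 0 0] smul_zero[OF h_in] by simp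
  have d: "d (h 0) (h x) = nrm (h x)" for x using dist_zero h_in h0 by simp
  have "closedin euclidean {x \<in> topspace euclidean. h x \<in> mcball (h 0) 1}"
    by (rule closedin_continuous_map_preimage[OF cont]) simp
  moreover have "{x \<in> topspace euclidean. h x \<in> mcball (h 0) 1} = {x. nrm (h x) \<le> 1}"
    using h_in d by (auto simp: in_mcball)
  ultimately have "closed {x. nrm (h x) \<le> 1}" by simp
  moreover have "0 \<in> interior {x. nrm (h x) \<le> 1}"
  proof (rule interiorI)
    have "openin euclidean {x \<in> topspace euclidean. h x \<in> mball (h 0) 1}"
      by (rule openin_continuous_map_preimage[OF cont]) simp
    then show "open {x \<in> topspace euclidean. h x \<in> mball (h 0) 1}" by simp
    show "0 \<in> {x \<in> topspace euclidean. h x \<in> mball (h 0) 1}" using h_in by (simp add: in_mball)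
    show "{x \<in> topspace euclidean. h x \<in> mball (h 0) 1} \<subseteq> {x. nrm (h x) \<le> 1}"
      using d by (auto simp: in_mball)
  qed
  moreover have "absolutely_convex sE {x. nrm (h x) \<le> 1}"
    unfolding absolutely_convex_def
  proof (intro ballI allI impI, simp)
    fix x y and a b :: 'f
    assume x: "nrm (h x) \<le> 1" and y: "nrm (h y) \<le> 1" and ab: "norm a + norm b \<le> 1"
    have "nrm (h (sE a x + sE b y)) \<le> norm a * nrm (h x) + norm b * nrm (h y)"
      using nrm_add[OF S_smul[OF h_in] S_smul[OF h_in], of a x b y] by (simp add: h_add h_sc nrm_smul h_in)
    also have "\<dots> \<le> norm a * 1 + norm b * 1"
      using x y by (intro add_mono mult_left_mono) auto
    finally show "nrm (h (sE a x + sE b y)) \<le> 1" using ab by simp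
  qed
  ultimately show ?thesis by (simp add: closed_ac_nhds0_def)
qed

end

text \<open>For operators between normed spaces continuity is boundedness.  The domain is a subspace \<open>H\<close>, which
covers \<open>H\<^sub>p\<close> as well as, for \<open>H\<close> the whole carrier, the full space.\<close>

locale two_normed_quotients =
  A: normed_quotient sc V N cl add smul nrm + B: normed_quotient sc' V' N' cl' add' smul' nrm'
  for sc :: "'f::rc_field \<Rightarrow> 'v::ab_group_add \<Rightarrow> 'v" and V N and cl :: "'v \<Rightarrow> 'x" and add smul nrm
    and sc' :: "'f \<Rightarrow> 'w::ab_group_add \<Rightarrow> 'w" and V' N' and cl' :: "'w \<Rightarrow> 'y" and add' smul' nrm'
begin

lemma is_operator_boundedI:
  assumes H: "H \<subseteq> A.S" "\<And>x y. x \<in> H \<Longrightarrow> y \<in> H \<Longrightarrow> add x y \<in> H" "\<And>a x. x \<in> H \<Longrightarrow> smul a x \<in> H"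
    and h_in: "\<And>x. x \<in> H \<Longrightarrow> h x \<in> B.S"
    and h_add: "\<And>x y. x \<in> H \<Longrightarrow> y \<in> H \<Longrightarrow> h (add x y) = add' (h x) (h y)"
    and h_sc: "\<And>a x. x \<in> H \<Longrightarrow> h (smul a x) = smul' a (h x)"
    and h_le: "\<And>x. x \<in> H \<Longrightarrow> nrm' (h x) \<le> C * nrm x"
  shows "is_operator (sub_tvs A.X H) B.X h"
proof -
  interpret Sub: Submetric A.S A.d H using H(1) by unfold_locales
  have "continuous_map Sub.sub.mtopology B.mtopology h"
    unfolding Sub.sub.metric_continuous_map[OF B.Metric_space_axioms]
  proof (intro conjI ballI allI impI)
    show "h ` H \<subseteq> B.S" using h_in by auto
    fix a and e :: real assume a: "a \<in> H" and e: "0 < e"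
    show "\<exists>\<delta>>0. \<forall>x. x \<in> H \<and> A.d a x < \<delta> \<longrightarrow> B.d (h a) (h x) < e"
    proof (intro exI[of _ "e / (\<bar>C\<bar> + 1)"] conjI allI impI)
      show "0 < e / (\<bar>C\<bar> + 1)" using e by simp
      fix x assume x: "x \<in> H \<and> A.d a x < e / (\<bar>C\<bar> + 1)"
      have "B.d (h a) (h x) = nrm' (h (add a (smul (- 1) x)))"
        using a x H by (simp add: B.dist_nrm h_in h_add h_sc)
      also have "\<dots> \<le> C * nrm (add a (smul (- 1) x))" using a x H by (intro h_le) auto
      also have "nrm (add a (smul (- 1) x)) = A.d a x" using a x H by (subst A.dist_nrm) auto
      also have "C * A.d a x \<le> (\<bar>C\<bar> + 1) * A.d a x" by (intro mult_right_mono) auto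
      also have "\<dots> < e" using x by (simp add: field_simps)
      finally show "B.d (h a) (h x) < e" .
    qed
  qed
  then show ?thesis
    using H h_in h_add h_sc by (auto simp: is_operator_def sub_tvs_def Sub.mtopology_submetric)
qed

lemma is_operator_bounded:
  assumes H: "H \<subseteq> A.S" "H \<noteq> {}" "\<And>x y. x \<in> H \<Longrightarrow> y \<in> H \<Longrightarrow> add x y \<in> H" "\<And>a x. x \<in> H \<Longrightarrow> smul a x \<in> H"
    and h: "is_operator (sub_tvs A.X H) B.X h"
  obtains C where "C > 0" "\<And>x. x \<in> H \<Longrightarrow> nrm' (h x) \<le> C * nrm x"
proof -
  interpret Sub: Submetric A.S A.d H using H(1) by unfold_locales
  have h_in: "x \<in> H \<Longrightarrow> h x \<in> B.S" and h_sc: "x \<in> H \<Longrightarrow> h (smul a x) = smul' a (h x)"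
    and cont: "continuous_map Sub.sub.mtopology B.mtopology h" for x a
    using h by (auto simp: is_operator_def sub_tvs_def Sub.mtopology_submetric)
  obtain z where z: "z \<in> H" using H by auto
  have zero: "cl 0 \<in> H" using H(4)[OF z, of 0] A.smul_zero z H(1) by auto
  have h0: "h (cl 0) = cl' 0"
    using h_sc[OF zero, of 0] A.smul_zero[of "cl 0"] B.smul_zero[OF h_in[OF zero]] zero H(1) by auto
  obtain \<delta> where \<delta>: "\<delta> > 0" "\<And>x. x \<in> H \<Longrightarrow> A.d (cl 0) x < \<delta> \<Longrightarrow> B.d (h (cl 0)) (h x) < 1"
    using cont zero unfolding Sub.sub.metric_continuous_map[OF B.Metric_space_axioms]
    by (meson zero_less_one)
  have small: "nrm' (h x) < 1" if "x \<in> H" "nrm x < \<delta>" for x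
    using \<delta>(2)[OF that(1)] that H(1) h_in A.dist_zero[of x] B.dist_zero[of "h x"] h0 by auto
  have "nrm' (h x) \<le> (2 / \<delta>) * nrm x" if x: "x \<in> H" for x
  proof (rule ccontr)
    assume "\<not> ?thesis"
    then have gt: "(2 / \<delta>) * nrm x < nrm' (h x)" by simp
    have n0: "0 \<le> nrm x" using x H(1) A.nrm_nonneg by auto
    have p: "0 < nrm' (h x)" using gt n0 \<delta>(1) by (smt (verit) divide_nonneg_pos mult_nonneg_nonneg)
    define t where "t = 1 / nrm' (h x)"
    have t: "t > 0" using p by (simp add: t_def)
    have "nrm (smul (of_real t) x) = t * nrm x" using x H(1) t by (subst A.nrm_smul) auto
    also have "\<dots> < \<delta>" using gt p \<delta>(1) n0 by (simp add: t_def field_simps)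
    finally have "nrm' (h (smul (of_real t) x)) < 1" using small H(4) x by blast
    moreover have "nrm' (h (smul (of_real t) x)) = t * nrm' (h x)"
      using x t h_in by (simp add: h_sc B.nrm_smul)
    ultimately show False using p by (simp add: t_def)
  qed
  then show ?thesis using that[of "2 / \<delta>"] \<delta>(1) by simp
qed

end

text \<open>A Banach space given by a type fits the same scheme with the identity as class map.\<close>

lemma (in banach_space_over) normed_quotient_type: "normed_quotient smul UNIV norm id (+) smul norm"
  by unfold_locales (auto simp: norm_triangle_ineq norm_scale subspace_UNIV)

lemma (in banach_space_over) type_tvs_eq: "type_tvs smul = normed_tvs (id ` UNIV) (+) smul norm"
proof -
  have "norm_dist UNIV (+) smul norm = dist"
    by (auto simp: norm_dist_def dist_norm fun_eq_iff)
  then show ?thesis by (simp add: type_tvs_def normed_tvs_def)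
qed

section \<open>Spaces of bounded and of continuous functions\<close>

definition fscale :: "'f::rc_field \<Rightarrow> ('s \<Rightarrow> 'f) \<Rightarrow> 's \<Rightarrow> 'f" where
  "fscale a f = (\<lambda>s. a * f s)"

lemma fscale_apply [simp]: "fscale a f s = a * f s"
  by (simp add: fscale_def)

lemma vector_space_fscale: "vector_space fscale"
  by standard (auto simp: fun_eq_iff algebra_simps)

lemma subspace_fscale_iff:
  "module.subspace fscale V \<longleftrightarrow> 0 \<in> V \<and> (\<forall>f\<in>V. \<forall>g\<in>V. f + g \<in> V) \<and> (\<forall>a. \<forall>f\<in>V. fscale a f \<in> V)"
proof -
  interpret vector_space fscale by (rule vector_space_fscale)
  show ?thesis unfolding subspace_def by auto
qed

definition sup_norm :: "'s set \<Rightarrow> ('s \<Rightarrow> 'f::rc_field) \<Rightarrow> real" where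
  "sup_norm S f = (SUP s\<in>S. norm (f s))"

lemma sup_norm_upper:
  assumes "bounded (f ` S)" "s \<in> S"
  shows "norm (f s) \<le> sup_norm S f"
proof -
  have "bdd_above ((\<lambda>s. norm (f s)) ` S)"
    using assms(1) by (auto simp: bounded_iff bdd_above_def)
  then show ?thesis unfolding sup_norm_def using assms(2) by (rule cSUP_upper[rotated])
qed

lemma sup_norm_least: "S \<noteq> {} \<Longrightarrow> (\<And>s. s \<in> S \<Longrightarrow> norm (f s) \<le> c) \<Longrightarrow> sup_norm S f \<le> c"
  unfolding sup_norm_def by (rule cSUP_least)

text \<open>Applied to a scalar and its inverse, the inequality yields the equality; for suprema only the inequality
is immediate.\<close>

lemma seminorm_homogeneousI:
  fixes N :: "'v::ab_group_add \<Rightarrow> real" and sc :: "'f::rc_field \<Rightarrow> 'v \<Rightarrow> 'v"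
  assumes "vector_space sc" and "module.subspace sc V"
    and le: "\<And>a x. x \<in> V \<Longrightarrow> N (sc a x) \<le> norm a * N x" and nonneg: "\<And>x. x \<in> V \<Longrightarrow> 0 \<le> N x"
    and x: "x \<in> V"
  shows "N (sc a x) = norm a * N x"
proof -
  interpret vector_space sc by fact
  show ?thesis
  proof (cases "a = 0")
    case True
    have "0 \<in> V" using assms(2) by (rule subspace_0)
    then show ?thesis using le[OF x, of 0] nonneg[of 0] True by simp
  next
    case False
    have "sc a x \<in> V" using assms(2) x by (rule subspace_scale)
    then have "N (sc (inverse a) (sc a x)) \<le> norm (inverse a) * N (sc a x)" by (rule le)
    then have "norm a * N x \<le> N (sc a x)" using False by (simp add: norm_inverse mult.commute pos_le_divide_eq[symmetric] divide_inverse)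
    then show ?thesis using le[OF x, of a] by simp
  qed
qed

lemma normed_quotient_bounded_functions:
  fixes V :: "('s \<Rightarrow> 'f::rc_field) set"
  assumes ne: "S \<noteq> {}" and bdd: "\<And>f. f \<in> V \<Longrightarrow> bounded (f ` S)" and V: "module.subspace fscale V"
  shows "normed_quotient fscale V (sup_norm S) (\<lambda>f. restrict f S)
    (\<lambda>f g. \<lambda>s\<in>S. f s + g s) (\<lambda>a f. \<lambda>s\<in>S. a * f s) (sup_norm S)"
proof -
  interpret vector_space fscale by (rule vector_space_fscale)
  have nonneg: "0 \<le> sup_norm S f" if "f \<in> V" for f
  proof -
    obtain s where s: "s \<in> S" using ne by auto
    show ?thesis using sup_norm_upper[OF bdd[OF that] s] norm_ge_zero[of "f s"] by linarith
  qed
  show ?thesis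
  proof
    show "subspace V" by (rule V)
    show "sup_norm S (f + g) \<le> sup_norm S f + sup_norm S g" if "f \<in> V" "g \<in> V" for f g
    proof (rule sup_norm_least[OF ne])
      fix s assume s: "s \<in> S"
      show "norm ((f + g) s) \<le> sup_norm S f + sup_norm S g"
        using sup_norm_upper[OF bdd[OF that(1)] s] sup_norm_upper[OF bdd[OF that(2)] s]
          norm_triangle_ineq[of "f s" "g s"] by simp
    qed
    show "sup_norm S (fscale a f) = norm a * sup_norm S f" if "f \<in> V" for a f
      using vector_space_fscale V _ nonneg that
    proof (rule seminorm_homogeneousI)
      fix a f assume f: "f \<in> V"
      show "sup_norm S (fscale a f) \<le> norm a * sup_norm S f"
        using sup_norm_upper[OF bdd[OF f]] ne
        by (intro sup_norm_least) (auto simp: norm_mult intro!: mult_left_mono)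
    qed
    show "restrict f S = restrict g S \<longleftrightarrow> sup_norm S (f - g) = 0" if fg: "f \<in> V" "g \<in> V" for f g
    proof
      assume "restrict f S = restrict g S"
      then have "f s = g s" if "s \<in> S" for s using that by (metis restrict_apply')
      then have "sup_norm S (f - g) \<le> 0" by (intro sup_norm_least[OF ne]) simp
      then show "sup_norm S (f - g) = 0" using nonneg[OF subspace_diff[OF V fg]] by simp
    next
      assume "sup_norm S (f - g) = 0"
      then show "restrict f S = restrict g S"
        using sup_norm_upper[OF bdd[OF subspace_diff[OF V fg]]] by (intro restrict_ext) simp
    qed
    show "sup_norm S (restrict f S) = sup_norm S f" for f :: "'s \<Rightarrow> 'f"
      by (simp add: sup_norm_def)
  qed (auto simp: fun_eq_iff)
qed

definition ell_fun :: "'s set \<Rightarrow> ('s \<Rightarrow> 'f::rc_field) set" where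
  "ell_fun S = {f. bounded (f ` S)}"

lemma subspace_ell_fun: "module.subspace fscale (ell_fun S :: ('s \<Rightarrow> 'f::rc_field) set)"
  unfolding subspace_fscale_iff
proof (intro conjI ballI allI)
  show "(0 :: 's \<Rightarrow> 'f) \<in> ell_fun S" by (auto simp: ell_fun_def bounded_iff)
  fix f g :: "'s \<Rightarrow> 'f" and a :: 'f assume f: "f \<in> ell_fun S"
  then obtain c where c: "\<And>s. s \<in> S \<Longrightarrow> norm (f s) \<le> c" by (auto simp: ell_fun_def bounded_iff)
  show "fscale a f \<in> ell_fun S"
    using c unfolding ell_fun_def bounded_iff
    by (auto simp: norm_mult intro!: exI[of _ "norm a * c"] mult_left_mono)
  assume "g \<in> ell_fun S"
  then show "f + g \<in> ell_fun S"
    using f bounded_plus_comp[of f S g] by (simp add: ell_fun_def plus_fun_def)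
qed

text \<open>Passing from functions that are \<open>undefined\<close> off \<open>S\<close> to arbitrary functions with the same restriction.\<close>

lemma restrict_image_eq:
  assumes "\<And>f g. (\<And>s. s \<in> S \<Longrightarrow> f s = g s) \<Longrightarrow> P f = P g"
  shows "(\<lambda>f. restrict f S) ` {f. P f} = {f \<in> extensional S. P f}"
proof (intro equalityI subsetI)
  fix h assume "h \<in> (\<lambda>f. restrict f S) ` {f. P f}"
  then obtain f where "P f" "h = restrict f S" by auto
  then show "h \<in> {f \<in> extensional S. P f}" using assms[of f h] by simp
next
  fix h assume "h \<in> {f \<in> extensional S. P f}"
  then show "h \<in> (\<lambda>f. restrict f S) ` {f. P f}"
    by (intro image_eqI[of _ _ h]) (auto simp: extensional_restrict)
qed

lemma linf_space_eq:
  "(linf_space S :: ('f::rc_field, 's \<Rightarrow> 'f) tvs) = normed_tvs ((\<lambda>f. restrict f S) ` ell_fun S)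
     (\<lambda>f g. \<lambda>s\<in>S. f s + g s) (\<lambda>a f. \<lambda>s\<in>S. a * f s) (sup_norm S)"
proof -
  have "(\<lambda>f. restrict f S) ` (ell_fun S :: ('s \<Rightarrow> 'f::rc_field) set) = {f \<in> extensional S. bounded (f ` S)}"
    unfolding ell_fun_def by (rule restrict_image_eq) (simp cong: image_cong)
  then show ?thesis by (simp add: linf_space_def sup_norm_def[abs_def])
qed

lemma normed_quotient_linf:
  "S \<noteq> {} \<Longrightarrow> normed_quotient fscale (ell_fun S) (sup_norm S) (\<lambda>f. restrict f S)
    (\<lambda>f g. \<lambda>s\<in>S. f s + g s) (\<lambda>a f. \<lambda>s\<in>S. a * f s) (sup_norm S)"
  using subspace_ell_fun by (rule normed_quotient_bounded_functions[rotated 2]) (auto simp: ell_fun_def)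

definition cont_fun :: "'k topology \<Rightarrow> ('k \<Rightarrow> 'f::rc_field) set" where
  "cont_fun K = {f. continuous_map K euclidean f}"

lemma subspace_cont_fun: "module.subspace fscale (cont_fun K :: ('k \<Rightarrow> 'f::rc_field) set)"
proof -
  have "continuous_map K euclidean (\<lambda>k. a * f k)" if "continuous_map K euclidean f" for f and a :: 'f
    using continuous_map_compose[OF that, of euclidean "(*) a"] by (simp add: o_def continuous_intros)
  then show ?thesis
    unfolding subspace_fscale_iff cont_fun_def
    by (auto simp: plus_fun_def zero_fun_def fscale_def intro!: continuous_intros)
qed

lemma cont_fun_bounded:
  assumes "compact_space K" "f \<in> cont_fun K"
  shows "bounded (f ` topspace K)"
  using image_compactin[of K "topspace K" euclidean f] assms
  by (auto simp: compact_space_def cont_fun_def compact_imp_bounded)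

lemma C_space_eq:
  "(C_space K :: ('f::rc_field, 'k \<Rightarrow> 'f) tvs) = normed_tvs ((\<lambda>f. restrict f (topspace K)) ` cont_fun K)
     (\<lambda>f g. \<lambda>s\<in>topspace K. f s + g s) (\<lambda>a f. \<lambda>s\<in>topspace K. a * f s) (sup_norm (topspace K))"
proof -
  have "(\<lambda>f. restrict f (topspace K)) ` (cont_fun K :: ('k \<Rightarrow> 'f::rc_field) set) = {f \<in> extensional (topspace K). continuous_map K euclidean f}"
    unfolding cont_fun_def by (rule restrict_image_eq) (metis continuous_map_eq)
  then show ?thesis by (simp add: C_space_def sup_norm_def[abs_def])
qed

lemma normed_quotient_C:
  "compact_space K \<Longrightarrow> topspace K \<noteq> {} \<Longrightarrow>
    normed_quotient fscale (cont_fun K) (sup_norm (topspace K)) (\<lambda>f. restrict f (topspace K))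
      (\<lambda>f g. \<lambda>s\<in>topspace K. f s + g s) (\<lambda>a f. \<lambda>s\<in>topspace K. a * f s) (sup_norm (topspace K))"
  by (rule normed_quotient_bounded_functions) (auto simp: cont_fun_bounded subspace_cont_fun)


section \<open>Lebesgue spaces\<close>

lemma mem_ae_class: "f \<in> borel_measurable M \<Longrightarrow> f \<in> ae_class M f"
  by (simp add: ae_class_def)

lemma class_rep_ae:
  assumes "f \<in> borel_measurable M"
  shows "class_rep (ae_class M f) \<in> borel_measurable M" "AE k in M. class_rep (ae_class M f) k = f k"
proof -
  have "class_rep (ae_class M f) \<in> ae_class M f"
    unfolding class_rep_def by (rule someI[where P="\<lambda>g. g \<in> ae_class M f", OF mem_ae_class[OF assms]])
  then show "class_rep (ae_class M f) \<in> borel_measurable M" "AE k in M. class_rep (ae_class M f) k = f k"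
    by (auto simp: ae_class_def)
qed

lemma ae_class_eq_iff:
  assumes "f \<in> borel_measurable M" "g \<in> borel_measurable M"
  shows "ae_class M f = ae_class M g \<longleftrightarrow> (AE k in M. f k = g k)"
proof
  assume "ae_class M f = ae_class M g"
  then show "AE k in M. f k = g k" using mem_ae_class[OF assms(1)] by (auto simp: ae_class_def)
next
  assume fg: "AE k in M. f k = g k"
  have "(AE k in M. h k = f k) \<longleftrightarrow> (AE k in M. h k = g k)" for h
    using fg by (auto elim: eventually_elim2)
  then show "ae_class M f = ae_class M g" by (simp add: ae_class_def)
qed

lemma class_add_ae:
  assumes "f \<in> borel_measurable M" "g \<in> borel_measurable M"
  shows "class_add M (ae_class M f) (ae_class M g) = ae_class M (f + g)"
proof (intro equalityI subsetI)
  fix h assume "h \<in> class_add M (ae_class M f) (ae_class M g)"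
  then obtain f' g' where h: "h \<in> borel_measurable M" "AE k in M. f' k = f k" "AE k in M. g' k = g k"
    "AE k in M. h k = f' k + g' k"
    by (auto simp: class_add_def ae_class_def)
  have "AE k in M. h k = (f + g) k" using h(2-4) by eventually_elim simp
  then show "h \<in> ae_class M (f + g)" using h(1) by (simp add: ae_class_def)
next
  fix h assume "h \<in> ae_class M (f + g)"
  then show "h \<in> class_add M (ae_class M f) (ae_class M g)"
    using mem_ae_class[OF assms(1)] mem_ae_class[OF assms(2)] by (auto simp: class_add_def ae_class_def)
qed

lemma class_scale_ae:
  assumes "f \<in> borel_measurable M"
  shows "class_scale M a (ae_class M f) = ae_class M (fscale a f)"
proof (intro equalityI subsetI)
  fix h assume "h \<in> class_scale M a (ae_class M f)"
  then obtain f' where h: "h \<in> borel_measurable M" "AE k in M. f' k = f k" "AE k in M. h k = a * f' k"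
    by (auto simp: class_scale_def ae_class_def)
  have "AE k in M. h k = fscale a f k" using h(2,3) by eventually_elim simp
  then show "h \<in> ae_class M (fscale a f)" using h(1) by (simp add: ae_class_def)
next
  fix h assume "h \<in> ae_class M (fscale a f)"
  then show "h \<in> class_scale M a (ae_class M f)"
    using mem_ae_class[OF assms(1)] by (auto simp: class_scale_def ae_class_def)
qed

definition Lp_fun :: "real \<Rightarrow> 'k measure \<Rightarrow> ('k \<Rightarrow> 'f::rc_field) set" where
  "Lp_fun p M = {f \<in> borel_measurable M. integrable M (\<lambda>k. norm (f k) powr p)}"

definition Lp_norm :: "real \<Rightarrow> 'k measure \<Rightarrow> ('k \<Rightarrow> 'f::rc_field) \<Rightarrow> real" where
  "Lp_norm p M f = (\<integral>k. norm (f k) powr p \<partial>M) powr (1 / p)"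

lemma Lp_norm_nonneg [simp]: "0 \<le> Lp_norm p M f"
  by (simp add: Lp_norm_def)

lemma Lp_norm_powr: "p \<ge> 1 \<Longrightarrow> Lp_norm p M f powr p = (\<integral>k. norm (f k) powr p \<partial>M)"
  by (simp add: Lp_norm_def powr_powr integral_nonneg)

lemma le_if_powr_le:
  fixes a b p :: real
  assumes "p \<ge> 1" "0 \<le> b" "a powr p \<le> b powr p"
  shows "a \<le> b"
  using assms powr_less_mono2[of p b a] by (meson leD leI less_le_trans zero_less_one)

lemma powr_add_le: "p \<ge> 0 \<Longrightarrow> a \<ge> 0 \<Longrightarrow> b \<ge> 0 \<Longrightarrow> (a + b) powr p \<le> 2 powr p * (a powr p + b powr p)" for a b p :: real
proof -
  assume p: "p \<ge> 0" and ab: "a \<ge> 0" "b \<ge> 0"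
  have "(a + b) powr p \<le> (2 * max a b) powr p" using p ab by (intro powr_mono2) auto
  also have "\<dots> = 2 powr p * max a b powr p" using ab by (simp add: powr_mult)
  also have "\<dots> \<le> 2 powr p * (a powr p + b powr p)" by (intro mult_left_mono) (auto simp: max_def)
  finally show ?thesis .
qed

lemma subspace_Lp_fun:
  assumes "p \<ge> 1"
  shows "module.subspace fscale (Lp_fun p M :: ('k \<Rightarrow> 'f::rc_field) set)"
  unfolding subspace_fscale_iff
proof (intro conjI ballI allI)
  show "(0 :: 'k \<Rightarrow> 'f) \<in> Lp_fun p M" by (simp add: Lp_fun_def zero_fun_def)
  fix f g :: "'k \<Rightarrow> 'f" and a :: 'f assume f: "f \<in> Lp_fun p M"
  show "fscale a f \<in> Lp_fun p M"
    using f by (auto simp: Lp_fun_def fscale_def norm_mult powr_mult)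
  assume g: "g \<in> Lp_fun p M"
  have [measurable]: "f \<in> borel_measurable M" "g \<in> borel_measurable M" using f g by (auto simp: Lp_fun_def)
  have "integrable M (\<lambda>k. 2 powr p * (norm (f k) powr p + norm (g k) powr p))"
    using f g by (auto simp: Lp_fun_def)
  then have "integrable M (\<lambda>k. norm (f k + g k) powr p)"
  proof (rule Bochner_Integration.integrable_bound)
    show "AE k in M. norm (norm (f k + g k) powr p) \<le> norm (2 powr p * (norm (f k) powr p + norm (g k) powr p))"
    proof (rule AE_I2)
      fix k
      have "norm (f k + g k) powr p \<le> (norm (f k) + norm (g k)) powr p"
        using assms by (intro powr_mono2 norm_triangle_ineq) auto
      also have "\<dots> \<le> 2 powr p * (norm (f k) powr p + norm (g k) powr p)"
        using assms by (intro powr_add_le) auto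
      finally show "norm (norm (f k + g k) powr p) \<le> norm (2 powr p * (norm (f k) powr p + norm (g k) powr p))"
        by simp
    qed
  qed measurable
  then show "f + g \<in> Lp_fun p M" by (simp add: Lp_fun_def plus_fun_def)
qed

lemma Lp_norm_eq_0_iff:
  assumes "p \<ge> 1" "f \<in> Lp_fun p M"
  shows "Lp_norm p M f = 0 \<longleftrightarrow> (AE k in M. f k = 0)"
proof -
  have "Lp_norm p M f = 0 \<longleftrightarrow> (\<integral>k. norm (f k) powr p \<partial>M) = 0"
    by (simp add: Lp_norm_def)
  also have "\<dots> \<longleftrightarrow> (AE k in M. norm (f k) powr p = 0)"
    using assms by (intro integral_nonneg_eq_0_iff_AE) (auto simp: Lp_fun_def)
  finally show ?thesis by simp
qed

lemma Lp_norm_cong_AE: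
  "f \<in> borel_measurable M \<Longrightarrow> g \<in> borel_measurable M \<Longrightarrow> AE k in M. f k = g k \<Longrightarrow> Lp_norm p M f = Lp_norm p M g"
  unfolding Lp_norm_def by (subst integral_cong_AE[of _ M "\<lambda>k. norm (g k) powr p"]) auto

text \<open>Convexity on the closed half-line: the endpoint \<open>0\<close> matters because the functions to which this is
applied may vanish.  There it reduces to \<open>t\<^sup>p \<le> t\<close> for \<open>0 \<le> t \<le> 1\<close>.\<close>

lemma convex_powr:
  fixes p x y s :: real
  assumes p: "p \<ge> 1" and xy: "0 \<le> x" "0 \<le> y" and s: "0 \<le> s" "s \<le> 1"
  shows "((1 - s) * x + s * y) powr p \<le> (1 - s) * x powr p + s * y powr p"
proof (cases "x = 0 \<or> y = 0")
  case True
  have "t powr p \<le> t" if "0 \<le> t" "t \<le> 1" for t :: real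
    using powr_mono'[of 1 p t] p that by (cases "t = 0") auto
  then have "s powr p * y powr p \<le> s * y powr p" "(1 - s) powr p * x powr p \<le> (1 - s) * x powr p"
    using s by (auto intro!: mult_right_mono)
  then show ?thesis using True xy s by (auto simp: powr_mult)
next
  case False
  then show ?thesis
    using convex_onD[OF powr_convex[OF p] s, of x y] xy by simp
qed

text \<open>Minkowski's inequality.  With \<open>A\<close> and \<open>B\<close> the norms of \<open>f\<close> and \<open>g\<close>, the function \<open>|f| + |g|\<close> is
\<open>A + B\<close> times the convex combination of \<open>|f| / A\<close> and \<open>|g| / B\<close> with weights \<open>A / (A + B)\<close> and
\<open>B / (A + B)\<close>; convexity of the power and integration give the result, since both normalised functions
have norm one.\<close>

lemma Lp_norm_add:
  assumes p: "p \<ge> 1" and f: "f \<in> Lp_fun p M" and g: "g \<in> Lp_fun p M"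
  shows "Lp_norm p M (f + g) \<le> Lp_norm p M f + Lp_norm p M g"
proof -
  have [measurable]: "f \<in> borel_measurable M" "g \<in> borel_measurable M" using f g by (auto simp: Lp_fun_def)
  define A B where "A = Lp_norm p M f" and "B = Lp_norm p M g"
  consider "A = 0" | "B = 0" | "A > 0" "B > 0"
    using Lp_norm_nonneg[of p M f] Lp_norm_nonneg[of p M g] unfolding A_def B_def by linarith
  then show ?thesis
  proof cases
    case 1
    then have "AE k in M. f k = 0" using Lp_norm_eq_0_iff[OF p f] by (simp add: A_def)
    then have "AE k in M. (f + g) k = g k" by eventually_elim simp
    then have "Lp_norm p M (f + g) = B" unfolding B_def by (intro Lp_norm_cong_AE) (auto simp: plus_fun_def)
    then show ?thesis using 1 by (simp add: A_def B_def)
  next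
    case 2
    then have "AE k in M. g k = 0" using Lp_norm_eq_0_iff[OF p g] by (simp add: B_def)
    then have "AE k in M. (f + g) k = f k" by eventually_elim simp
    then have "Lp_norm p M (f + g) = A" unfolding A_def by (intro Lp_norm_cong_AE) (auto simp: plus_fun_def)
    then show ?thesis using 2 by (simp add: A_def B_def)
  next
    case 3
    have fgL: "f + g \<in> Lp_fun p M" using subspace_Lp_fun[OF p] f g by (auto simp: subspace_fscale_iff)
    define s where "s = B / (A + B)"
    have s: "0 \<le> s" "s \<le> 1" "1 - s = A / (A + B)" using 3 by (auto simp: s_def field_simps)
    let ?F = "\<lambda>k. norm (f k) powr p" and ?G = "\<lambda>k. norm (g k) powr p"
    have int: "integrable M ?F" "integrable M ?G" using f g by (auto simp: Lp_fun_def)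
    have bound: "norm ((f + g) k) powr p \<le> (A + B) powr p * ((1 - s) * (?F k / A powr p) + s * (?G k / B powr p))" for k
    proof -
      have "norm ((f + g) k) powr p \<le> (norm (f k) + norm (g k)) powr p"
        using p norm_triangle_ineq[of "f k" "g k"] by (intro powr_mono2) auto
      also have "norm (f k) + norm (g k) = (A + B) * ((1 - s) * (norm (f k) / A) + s * (norm (g k) / B))"
      proof -
        have "(1 - s) * (norm (f k) / A) = norm (f k) / (A + B)" "s * (norm (g k) / B) = norm (g k) / (A + B)"
          using 3 unfolding s(3) by (simp_all add: s_def)
        then show ?thesis using 3 by (simp add: add_divide_distrib[symmetric])
      qed
      also have "\<dots> powr p = (A + B) powr p * ((1 - s) * (norm (f k) / A) + s * (norm (g k) / B)) powr p"
        using 3 s by (intro powr_mult)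
      also have "\<dots> \<le> (A + B) powr p * ((1 - s) * (norm (f k) / A) powr p + s * (norm (g k) / B) powr p)"
        using 3 s p by (intro mult_left_mono convex_powr) auto
      finally show ?thesis using 3 by (simp add: powr_divide)
    qed
    have "(\<integral>k. norm ((f + g) k) powr p \<partial>M)
        \<le> (\<integral>k. (A + B) powr p * ((1 - s) * (?F k / A powr p) + s * (?G k / B powr p)) \<partial>M)"
      using fgL int bound by (intro integral_mono) (auto simp: Lp_fun_def)
    also have "\<dots> = (A + B) powr p * ((1 - s) * ((\<integral>k. ?F k \<partial>M) / A powr p) + s * ((\<integral>k. ?G k \<partial>M) / B powr p))"
      using int by simp
    also have "\<dots> = (A + B) powr p"
      using 3 by (simp add: A_def B_def Lp_norm_powr[OF p, symmetric])
    finally show ?thesis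
      unfolding Lp_norm_powr[OF p, symmetric] A_def[symmetric] B_def[symmetric]
      by (rule le_if_powr_le[OF p, rotated]) (use 3 in simp)
  qed
qed

lemma normed_quotient_Lp:
  assumes p: "p \<ge> 1"
  shows "normed_quotient fscale (Lp_fun p M) (Lp_norm p M) (ae_class M) (class_add M) (class_scale M)
    (\<lambda>A :: ('k \<Rightarrow> 'f::rc_field) set. Lp_norm p M (class_rep A))"
proof -
  interpret vector_space fscale by (rule vector_space_fscale)
  have meas: "f \<in> borel_measurable M" if "f \<in> Lp_fun p M" for f :: "'k \<Rightarrow> 'f" using that by (simp add: Lp_fun_def)
  show ?thesis
  proof
    show V: "subspace (Lp_fun p M)" by (rule subspace_Lp_fun[OF p])
    show "Lp_norm p M (fscale a f) = norm a * Lp_norm p M f" for a and f :: "'k \<Rightarrow> 'f"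
      using p by (simp add: Lp_norm_def norm_mult powr_mult powr_powr integral_nonneg)
    show "ae_class M f = ae_class M g \<longleftrightarrow> Lp_norm p M (f - g) = 0"
      if "f \<in> Lp_fun p M" "g \<in> Lp_fun p M" for f g :: "'k \<Rightarrow> 'f"
      using Lp_norm_eq_0_iff[OF p subspace_diff[OF V that]] that by (simp add: ae_class_eq_iff meas)
    show "Lp_norm p M (class_rep (ae_class M f)) = Lp_norm p M f" if "f \<in> Lp_fun p M" for f :: "'k \<Rightarrow> 'f"
      using class_rep_ae[OF meas[OF that]] meas[OF that] by (intro Lp_norm_cong_AE)
  qed (auto simp: Lp_norm_add[OF p] class_add_ae class_scale_ae meas)
qed

lemma Lp_space_eq:
  "(Lp_space p M :: ('f::rc_field, ('k \<Rightarrow> 'f) set) tvs) = normed_tvs (ae_class M ` Lp_fun p M) (class_add M) (class_scale M)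
    (\<lambda>A. Lp_norm p M (class_rep A))"
proof -
  have "{ae_class M f | f :: 'k \<Rightarrow> 'f. f \<in> borel_measurable M \<and> integrable M (\<lambda>k. norm (f k) powr p)} = ae_class M ` Lp_fun p M"
    by (auto simp: Lp_fun_def)
  then show ?thesis by (simp add: Lp_space_def Lp_norm_def)
qed

definition Linf_fun :: "'k measure \<Rightarrow> ('k \<Rightarrow> 'f::rc_field) set" where
  "Linf_fun M = {f \<in> borel_measurable M. \<exists>c. AE k in M. norm (f k) \<le> c}"

definition Linf_norm :: "'k measure \<Rightarrow> ('k \<Rightarrow> 'f::rc_field) \<Rightarrow> real" where
  "Linf_norm M f = real_of_ereal (esssup M (\<lambda>k. ereal (norm (f k))))"

context prob_space
begin

text \<open>The essential supremum is taken in the extended reals; that it is finite and nonnegative uses that the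
whole space is not a null set.\<close>

lemma Linf_norm_finite:
  assumes "f \<in> Linf_fun M"
  shows "ereal (Linf_norm M f) = esssup M (\<lambda>k. ereal (norm (f k)))"
proof -
  have [measurable]: "f \<in> borel_measurable M" using assms by (simp add: Linf_fun_def)
  obtain c where "AE k in M. norm (f k) \<le> c" using assms by (auto simp: Linf_fun_def)
  then have "esssup M (\<lambda>k. ereal (norm (f k))) \<le> ereal c" by (intro esssup_I) auto
  moreover have "0 \<le> esssup M (\<lambda>k. ereal (norm (f k)))"
    using esssup_mono[of "\<lambda>k. 0" M "\<lambda>k. ereal (norm (f k))"] esssup_const[of M "0::ereal"] emeasure_space_1 by simp
  ultimately show ?thesis unfolding Linf_norm_def by (intro ereal_real') auto
qed

lemma Linf_norm_AE:
  assumes "f \<in> Linf_fun M"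
  shows "AE k in M. norm (f k) \<le> Linf_norm M f"
  using esssup_AE[of "\<lambda>k. ereal (norm (f k))" M] unfolding Linf_norm_finite[OF assms, symmetric] by simp

lemma Linf_norm_least:
  assumes "f \<in> Linf_fun M" "AE k in M. norm (f k) \<le> c"
  shows "Linf_norm M f \<le> c"
proof -
  have [measurable]: "f \<in> borel_measurable M" using assms by (simp add: Linf_fun_def)
  have "esssup M (\<lambda>k. ereal (norm (f k))) \<le> ereal c" using assms(2) by (intro esssup_I) auto
  then show ?thesis unfolding Linf_norm_finite[OF assms(1), symmetric] by simp
qed

lemma Linf_norm_nonneg: "f \<in> Linf_fun M \<Longrightarrow> 0 \<le> Linf_norm M f"
proof -
  assume "f \<in> Linf_fun M"
  from Linf_norm_AE[OF this] have "AE k in M. 0 \<le> Linf_norm M f"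
    by eventually_elim (rule order_trans[OF norm_ge_zero])
  then show ?thesis by simp
qed

lemma subspace_Linf_fun: "module.subspace fscale (Linf_fun M :: ('a \<Rightarrow> 'f::rc_field) set)"
  unfolding subspace_fscale_iff
proof (intro conjI ballI allI)
  show "(0 :: 'a \<Rightarrow> 'f) \<in> Linf_fun M" by (auto simp: Linf_fun_def zero_fun_def)
  fix f g :: "'a \<Rightarrow> 'f" and a :: 'f assume f: "f \<in> Linf_fun M"
  have [measurable]: "f \<in> borel_measurable M" using f by (simp add: Linf_fun_def)
  have "AE k in M. norm (fscale a f k) \<le> norm a * Linf_norm M f"
    using Linf_norm_AE[OF f] by eventually_elim (simp add: norm_mult mult_left_mono)
  then show "fscale a f \<in> Linf_fun M" unfolding Linf_fun_def by (auto simp: fscale_def)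
  assume g: "g \<in> Linf_fun M"
  have [measurable]: "g \<in> borel_measurable M" using g by (simp add: Linf_fun_def)
  have "AE k in M. norm ((f + g) k) \<le> Linf_norm M f + Linf_norm M g"
    using Linf_norm_AE[OF f] Linf_norm_AE[OF g]
    by eventually_elim (simp add: norm_triangle_le)
  then show "f + g \<in> Linf_fun M" unfolding Linf_fun_def by (auto simp: plus_fun_def)
qed

lemma normed_quotient_Linf:
  "normed_quotient fscale (Linf_fun M) (Linf_norm M) (ae_class M) (class_add M) (class_scale M)
    (\<lambda>A :: ('a \<Rightarrow> 'f::rc_field) set. Linf_norm M (class_rep A))"
proof -
  interpret vector_space fscale by (rule vector_space_fscale)
  have meas: "f \<in> borel_measurable M" if "f \<in> Linf_fun M" for f :: "'a \<Rightarrow> 'f" using that by (simp add: Linf_fun_def)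
  have V: "subspace (Linf_fun M :: ('a \<Rightarrow> 'f) set)" by (rule subspace_Linf_fun)
  show ?thesis
  proof
    show "subspace (Linf_fun M :: ('a \<Rightarrow> 'f) set)" by (rule V)
    show "Linf_norm M (f + g) \<le> Linf_norm M f + Linf_norm M g"
      if fg: "f \<in> Linf_fun M" "g \<in> Linf_fun M" for f g :: "'a \<Rightarrow> 'f"
    proof (rule Linf_norm_least[OF subspace_add[OF V fg]])
      show "AE k in M. norm ((f + g) k) \<le> Linf_norm M f + Linf_norm M g"
        using Linf_norm_AE[OF fg(1)] Linf_norm_AE[OF fg(2)] by eventually_elim (simp add: norm_triangle_le)
    qed
    show "Linf_norm M (fscale a f) = norm a * Linf_norm M f" if "f \<in> Linf_fun M" for a and f :: "'a \<Rightarrow> 'f"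
      using vector_space_fscale V _ Linf_norm_nonneg that
    proof (rule seminorm_homogeneousI)
      fix a and f :: "'a \<Rightarrow> 'f" assume f: "f \<in> Linf_fun M"
      show "Linf_norm M (fscale a f) \<le> norm a * Linf_norm M f"
      proof (rule Linf_norm_least[OF subspace_scale[OF V f]])
        show "AE k in M. norm (fscale a f k) \<le> norm a * Linf_norm M f"
          using Linf_norm_AE[OF f] by eventually_elim (simp add: norm_mult mult_left_mono)
      qed
    qed
    show "ae_class M f = ae_class M g \<longleftrightarrow> Linf_norm M (f - g) = 0"
      if fg: "f \<in> Linf_fun M" "g \<in> Linf_fun M" for f g :: "'a \<Rightarrow> 'f"
    proof -
      have d: "f - g \<in> Linf_fun M" by (rule subspace_diff[OF V fg])
      have "Linf_norm M (f - g) = 0 \<longleftrightarrow> (AE k in M. f k = g k)"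
      proof
        assume "Linf_norm M (f - g) = 0"
        then show "AE k in M. f k = g k" using Linf_norm_AE[OF d] by simp
      next
        assume "AE k in M. f k = g k"
        then have "Linf_norm M (f - g) \<le> 0" by (intro Linf_norm_least[OF d]) simp
        then show "Linf_norm M (f - g) = 0" using Linf_norm_nonneg[OF d] by simp
      qed
      then show ?thesis using fg by (simp add: ae_class_eq_iff meas)
    qed
    show "Linf_norm M (class_rep (ae_class M f)) = Linf_norm M f" if "f \<in> Linf_fun M" for f :: "'a \<Rightarrow> 'f"
      unfolding Linf_norm_def using class_rep_ae[OF meas[OF that]] meas[OF that]
      by (subst esssup_AE_cong[of _ M "\<lambda>k. ereal (norm (f k))"]) auto
  qed (auto simp: class_add_ae class_scale_ae meas)
qed

end

lemma Linf_space_eq: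
  "(Linf_space M :: ('f::rc_field, ('k \<Rightarrow> 'f) set) tvs) = normed_tvs (ae_class M ` Linf_fun M) (class_add M) (class_scale M)
    (\<lambda>A. Linf_norm M (class_rep A))"
proof -
  have "{ae_class M f | f :: 'k \<Rightarrow> 'f. f \<in> borel_measurable M \<and> (\<exists>c. AE k in M. norm (f k) \<le> c)} = ae_class M ` Linf_fun M"
    by (auto simp: Linf_fun_def)
  then show ?thesis by (simp add: Linf_space_def Linf_norm_def)
qed

section \<open>Regular measures dominating a positive functional\<close>

lemma split_closed_subset_of_union:
  assumes "normal_space K" "closedin K C" "openin K U" "openin K W" "C \<subseteq> U \<union> W"
  obtains A B where "closedin K A" "closedin K B" "A \<subseteq> U" "B \<subseteq> W" "C = A \<union> B"
proof -
  have "closedin K (C - U)" "closedin K (C - W)" "disjnt (C - U) (C - W)"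
    using assms by (auto simp: closedin_diff disjnt_def)
  then obtain P Q where PQ: "openin K P" "openin K Q" "C - U \<subseteq> P" "C - W \<subseteq> Q" "disjnt P Q"
    using assms(1) unfolding normal_space_def by meson
  show ?thesis
    by (rule that[of "C - P" "C - Q"])
      (use PQ assms in \<open>auto simp: closedin_diff disjnt_def\<close>)
qed

text \<open>The set function \<open>g W = sup {\<nu> C | C \<subseteq> W closed}\<close> on open sets is countably subadditive: by compactness
only finitely many of the open sets matter, and by normality a closed subset of \<open>U \<union> W\<close> splits into
closed subsets of \<open>U\<close> and \<open>W\<close>.  The outer measure \<open>m A = inf {g W | A \<subseteq> W open}\<close> is outer regular
by construction, and open sets are measurable for it in the sense of Caratheodory, because
\<open>\<nu> C + g (V - C) \<le> g V\<close> for closed \<open>C \<subseteq> V\<close>.  Inner regularity follows by complements.  For closed \<open>C\<close> every open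
\<open>W \<supseteq> C\<close> has \<open>\<nu> C \<le> g W\<close>, hence \<open>\<nu> C \<le> m C\<close>.\<close>

theorem regular_measure_dominating_charge:
  fixes K :: "'k topology" and \<nu> :: "'k set \<Rightarrow> real"
  assumes comp: "compact_space K" and haus: "Hausdorff_space K"
    and nonneg: "\<And>A. A \<subseteq> topspace K \<Longrightarrow> 0 \<le> \<nu> A"
    and additive: "\<And>A B. A \<subseteq> topspace K \<Longrightarrow> B \<subseteq> topspace K \<Longrightarrow> A \<inter> B = {} \<Longrightarrow> \<nu> (A \<union> B) = \<nu> A + \<nu> B"
    and total: "\<nu> (topspace K) = 1"
  obtains \<mu> where "regular_prob_measure K \<mu>" "\<And>C. closedin K C \<Longrightarrow> \<nu> C \<le> measure \<mu> C"
proof -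
  let ?X = "topspace K"
  have normal: "normal_space K"
    using comp haus by (rule compact_Hausdorff_or_regular_imp_normal_space[OF _ disjI1])
  have nu_mono: "\<nu> A \<le> \<nu> B" if "A \<subseteq> B" "B \<subseteq> ?X" for A B
  proof -
    have "\<nu> (A \<union> (B - A)) = \<nu> A + \<nu> (B - A)" using that by (intro additive) auto
    moreover have "A \<union> (B - A) = B" using that by auto
    moreover have "0 \<le> \<nu> (B - A)" using that by (intro nonneg) auto
    ultimately show ?thesis by simp
  qed
  have nu_Un: "\<nu> (A \<union> B) \<le> \<nu> A + \<nu> B" if "A \<subseteq> ?X" "B \<subseteq> ?X" for A B
  proof -
    have "\<nu> (A \<union> (B - A)) = \<nu> A + \<nu> (B - A)" using that by (intro additive) auto
    moreover have "A \<union> (B - A) = A \<union> B" by auto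
    moreover have "\<nu> (B - A) \<le> \<nu> B" using that by (intro nu_mono) auto
    ultimately show ?thesis by simp
  qed
  have nu_empty: "\<nu> {} = 0" using additive[of "{}" "{}"] by simp
  define g where "g W = (SUP C\<in>{C. closedin K C \<and> C \<subseteq> W}. ennreal (\<nu> C))" for W
  have g_upper: "ennreal (\<nu> C) \<le> g W" if "closedin K C" "C \<subseteq> W" for C W
    unfolding g_def using that by (intro SUP_upper) auto
  have g_least: "g W \<le> c" if "\<And>C. closedin K C \<Longrightarrow> C \<subseteq> W \<Longrightarrow> ennreal (\<nu> C) \<le> c" for W c
    unfolding g_def using that by (intro SUP_least) auto
  have g_mono: "g A \<le> g B" if "A \<subseteq> B" for A B
    using that by (intro g_least g_upper) auto
  have g_empty: "g {} = 0"
    using g_least[of "{}" 0] nu_empty by (simp add: ennreal_eq_0_iff)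
  have g_le_1: "g W \<le> 1" for W
  proof (rule g_least)
    fix C assume "closedin K C"
    then show "ennreal (\<nu> C) \<le> 1"
      using nu_mono[of C ?X] closedin_subset[of K C] total by (simp add: ennreal_le_1)
  qed
  have g_Un: "g (A \<union> B) \<le> g A + g B" if A: "openin K A" and B: "openin K B" for A B
  proof (rule g_least)
    fix C assume C: "closedin K C" "C \<subseteq> A \<union> B"
    obtain P Q where PQ: "closedin K P" "closedin K Q" "P \<subseteq> A" "Q \<subseteq> B" "C = P \<union> Q"
      by (rule split_closed_subset_of_union[OF normal C(1) A B C(2)])
    have PX: "P \<subseteq> ?X" "Q \<subseteq> ?X" using PQ closedin_subset by blast+
    have "ennreal (\<nu> C) \<le> ennreal (\<nu> P + \<nu> Q)"
      using nu_Un[OF PX] PQ by (intro ennreal_leI) simp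
    also have "\<dots> = ennreal (\<nu> P) + ennreal (\<nu> Q)"
      using PX by (intro ennreal_plus nonneg)
    also have "\<dots> \<le> g A + g B" using PQ by (intro add_mono g_upper)
    finally show "ennreal (\<nu> C) \<le> g A + g B" .
  qed
  have g_finite: "g (\<Union>i<n. W i) \<le> (\<Sum>i<n. g (W i))" if "\<And>i. openin K (W i)" for W :: "nat \<Rightarrow> 'k set" and n
  proof (induction n)
    case (Suc n)
    have "(\<Union>i<Suc n. W i) = (\<Union>i<n. W i) \<union> W n" by (auto simp: less_Suc_eq)
    then have "g (\<Union>i<Suc n. W i) \<le> g (\<Union>i<n. W i) + g (W n)"
      using that by (simp add: g_Un openin_clauses(3))
    also have "\<dots> \<le> (\<Sum>i<Suc n. g (W i))" using Suc by (simp add: add_right_mono)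
    finally show ?case .
  qed (simp add: g_empty)
  have g_countable: "g (\<Union>i. W i) \<le> (\<Sum>i. g (W i))" if W: "\<And>i. openin K (W i)" for W :: "nat \<Rightarrow> 'k set"
  proof (rule g_least)
    fix C assume C: "closedin K C" "C \<subseteq> (\<Union>i. W i)"
    have "compactin K C" using closedin_compact_space[OF comp C(1)] .
    then obtain F where F: "finite F" "F \<subseteq> range W" "C \<subseteq> \<Union>F"
      using C(2) W unfolding compactin_def by (metis (no_types, lifting) image_iff)
    obtain I where I: "finite I" "F = W ` I"
      using finite_subset_image[OF F(1,2)] by auto
    obtain n where n: "I \<subseteq> {..<n}" using finite_nat_iff_bounded I(1) by auto
    have "ennreal (\<nu> C) \<le> g (\<Union>i<n. W i)"
      using F(3) I(2) n C(1) by (intro g_upper) auto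
    also have "\<dots> \<le> (\<Sum>i<n. g (W i))" by (rule g_finite[OF W])
    also have "\<dots> \<le> (\<Sum>i. g (W i))" by (rule sum_le_suminf) auto
    finally show "ennreal (\<nu> C) \<le> (\<Sum>i. g (W i))" .
  qed
  define m where "m A = (INF W\<in>{W. openin K W \<and> A \<subseteq> W}. g W)" for A
  have m_lower: "m A \<le> g W" if "openin K W" "A \<subseteq> W" for A W
    unfolding m_def using that by (intro INF_lower) auto
  have m_greatest: "c \<le> m A" if "\<And>W. openin K W \<Longrightarrow> A \<subseteq> W \<Longrightarrow> c \<le> g W" for A c
    unfolding m_def using that by (intro INF_greatest) auto
  have m_mono: "m A \<le> m B" if "A \<subseteq> B" for A B
    using that by (intro m_greatest m_lower) auto
  have m_open: "m W = g W" if "openin K W" for W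
    using that by (intro antisym m_greatest m_lower g_mono) auto
  have m_empty: "m {} = 0" using m_open[of "{}"] g_empty by simp
  have m_approx: "\<exists>W. openin K W \<and> A \<subseteq> W \<and> g W \<le> m A + e" if "A \<subseteq> ?X" "e > 0" for A and e :: ennreal
  proof -
    have "m A \<le> 1" using m_lower[of ?X A] that g_le_1[of ?X] by simp
    then have "m A < m A + e"
      using that(2) ennreal_add_left_cancel_less[of "m A" 0 e] by (auto simp: top_unique)
    then show ?thesis unfolding m_def INF_less_iff by (auto intro: less_imp_le)
  qed
  have m_countable: "m (\<Union>i. A i) \<le> (\<Sum>i. m (A i))" if A: "\<And>i. A i \<subseteq> ?X" for A :: "nat \<Rightarrow> 'k set"
  proof (rule ennreal_le_epsilon)
    fix e :: real assume "0 < e"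
    have "\<forall>i. \<exists>W. openin K W \<and> A i \<subseteq> W \<and> g W \<le> m (A i) + ennreal (e * (1/2) ^ Suc i)"
      using \<open>0 < e\<close> by (intro allI m_approx A) (simp add: ennreal_zero_less_mult_iff)
    then obtain W where W: "\<And>i. openin K (W i)" "\<And>i. A i \<subseteq> W i"
      "\<And>i. g (W i) \<le> m (A i) + ennreal (e * (1/2) ^ Suc i)" by metis
    have "m (\<Union>i. A i) \<le> g (\<Union>i. W i)"
      using W by (intro m_lower openin_Union) auto
    also have "\<dots> \<le> (\<Sum>i. g (W i))" by (rule g_countable[OF W(1)])
    also have "\<dots> \<le> (\<Sum>i. m (A i) + ennreal (e * (1/2) ^ Suc i))"
      by (intro suminf_le W(3) summableI)
    also have "\<dots> = (\<Sum>i. m (A i)) + (\<Sum>i. ennreal e * ennreal ((1/2) ^ Suc i))"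
      using \<open>0 < e\<close> by (subst suminf_add[symmetric])
        (auto simp del: ennreal_suminf_cmult simp add: ennreal_mult[symmetric])
    also have "\<dots> = (\<Sum>i. m (A i)) + ennreal e"
      unfolding ennreal_suminf_cmult
      by (subst suminf_ennreal_eq[OF zero_le_power power_half_series]) auto
    finally show "m (\<Union>i. A i) \<le> (\<Sum>i. m (A i)) + ennreal e" .
  qed
  interpret P: sigma_algebra ?X "Pow ?X" by (rule sigma_algebra_Pow)
  have outer: "outer_measure_space (Pow ?X) m"
    unfolding outer_measure_space_def positive_def increasing_def countably_subadditive_def
  proof (intro conjI ballI allI impI)
    fix A :: "nat \<Rightarrow> 'k set" assume "range A \<subseteq> Pow ?X"
    then show "m (\<Union>i. A i) \<le> (\<Sum>i. m (A i))" by (intro m_countable) blast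
  qed (simp_all add: m_empty m_mono)
  have open_measurable: "W \<in> lambda_system ?X (Pow ?X) m" if W: "openin K W" for W
  proof -
    have WX: "W \<subseteq> ?X" using W by (rule openin_subset)
    have "m (W \<inter> A) + m ((?X - W) \<inter> A) = m A" if A: "A \<subseteq> ?X" for A
    proof (rule antisym)
      show "m (W \<inter> A) + m ((?X - W) \<inter> A) \<le> m A"
      proof (rule m_greatest)
        fix V assume V: "openin K V" "A \<subseteq> V"
        \<comment> \<open>A closed subset of \<open>V - C\<close> united with \<open>C\<close> is a closed subset of \<open>V\<close>.\<close>
        have *: "ennreal (\<nu> C) + m ((?X - W) \<inter> A) \<le> g V" if C: "closedin K C" "C \<subseteq> V \<inter> W" for C
        proof -
          have CX: "C \<subseteq> ?X" using C closedin_subset by blast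
          have "m ((?X - W) \<inter> A) \<le> g (V - C)"
            using V C by (intro m_lower openin_diff) auto
          then have "ennreal (\<nu> C) + m ((?X - W) \<inter> A) \<le> ennreal (\<nu> C) + g (V - C)"
            by (rule add_left_mono)
          also have "\<dots> = (SUP D\<in>{D. closedin K D \<and> D \<subseteq> V - C}. ennreal (\<nu> C) + ennreal (\<nu> D))"
            unfolding g_def by (subst ennreal_SUP_add_right) (auto intro!: exI[of _ "{}"])
          also have "\<dots> \<le> g V"
          proof (rule SUP_least, clarify)
            fix D assume D: "closedin K D" "D \<subseteq> V - C"
            have disj: "C \<inter> D = {}" using D by auto
            have DX: "D \<subseteq> ?X" using D closedin_subset by blast
            have "ennreal (\<nu> C) + ennreal (\<nu> D) = ennreal (\<nu> (C \<union> D))"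
              using additive[OF CX DX disj] nonneg[OF CX] nonneg[OF DX] by simp
            also have "\<dots> \<le> g V" using C D by (intro g_upper closedin_Un) auto
            finally show "ennreal (\<nu> C) + ennreal (\<nu> D) \<le> g V" .
          qed
          finally show ?thesis .
        qed
        have "m (W \<inter> A) \<le> g (V \<inter> W)" using V W by (intro m_lower) auto
        then have "m (W \<inter> A) + m ((?X - W) \<inter> A) \<le> g (V \<inter> W) + m ((?X - W) \<inter> A)"
          by (rule add_right_mono)
        also have "\<dots> = (SUP C\<in>{C. closedin K C \<and> C \<subseteq> V \<inter> W}. ennreal (\<nu> C) + m ((?X - W) \<inter> A))"
          unfolding g_def by (subst ennreal_SUP_add_left) (auto intro!: exI[of _ "{}"])
        also have "\<dots> \<le> g V" using * by (intro SUP_least) auto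
        finally show "m (W \<inter> A) + m ((?X - W) \<inter> A) \<le> g V" .
      qed
    next
      have "subadditive (Pow ?X) m"
        using outer P.countably_subadditive_subadditive unfolding outer_measure_space_def by blast
      then have "m ((W \<inter> A) \<union> ((?X - W) \<inter> A)) \<le> m (W \<inter> A) + m ((?X - W) \<inter> A)"
        using A by (intro subadditiveD) auto
      moreover have "(W \<inter> A) \<union> ((?X - W) \<inter> A) = A" using A by auto
      ultimately show "m A \<le> m (W \<inter> A) + m ((?X - W) \<inter> A)" by simp
    qed
    then show ?thesis using WX by (auto simp: lambda_system_def)
  qed
  define B where "B = sigma_sets ?X {W. openin K W}"
  have opens: "{W. openin K W} \<subseteq> Pow ?X" using openin_subset by blast
  have lam: "measure_space ?X (lambda_system ?X (Pow ?X) m) m"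
    by (rule P.caratheodory_lemma[OF outer])
  have BL: "B \<subseteq> lambda_system ?X (Pow ?X) m"
    unfolding B_def using lam open_measurable
    by (intro sigma_algebra.sigma_sets_subset) (auto simp: measure_space_def)
  have Bsig: "sigma_algebra ?X B" unfolding B_def by (rule sigma_algebra_sigma_sets[OF opens])
  have mB: "measure_space ?X B m" by (rule measure_down[OF lam Bsig BL])
  define \<mu> where "\<mu> = measure_of ?X B m"
  have BX: "B \<subseteq> Pow ?X" using Bsig by (simp add: sigma_algebra_iff2)
  have space: "space \<mu> = ?X" unfolding \<mu>_def by (rule space_measure_of[OF BX])
  have sets: "sets \<mu> = B" unfolding \<mu>_def using sigma_algebra.sets_measure_of_eq[OF Bsig] .
  have em: "emeasure \<mu> A = m A" if "A \<in> B" for A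
    unfolding \<mu>_def using mB that by (intro emeasure_measure_of_sigma) (auto simp: measure_space_def)
  have open_B: "W \<in> B" if "openin K W" for W using that by (auto simp: B_def)
  have closed_B: "C \<in> B" if "closedin K C" for C
  proof -
    have "?X - C \<in> B" using that by (intro open_B) auto
    then have "?X - (?X - C) \<in> B"
      by (rule algebra.compl_sets[OF sigma_algebra.axioms(1)[OF Bsig]])
    then show ?thesis using closedin_subset[OF that] by (simp add: double_diff)
  qed
  have gX: "g ?X = 1"
    using g_upper[of ?X ?X] g_le_1[of ?X] total by (intro antisym) auto
  have prob: "prob_space \<mu>"
    by (rule prob_spaceI) (simp add: space em open_B m_open gX)
  then interpret prob_space \<mu> .
  have outer_reg: "emeasure \<mu> A = (INF W\<in>{W. openin K W \<and> A \<subseteq> W}. emeasure \<mu> W)" if "A \<in> B" for A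
  proof -
    have "(INF W\<in>{W. openin K W \<and> A \<subseteq> W}. emeasure \<mu> W) = m A"
      unfolding m_def[of A] by (intro INF_cong refl) (simp add: em open_B m_open)
    then show ?thesis using em[OF that] by simp
  qed
  have inner_reg: "emeasure \<mu> A = (SUP C\<in>{C. compactin K C \<and> C \<subseteq> A}. emeasure \<mu> C)" if A: "A \<in> B" for A
  proof (rule antisym)
    have AX: "A \<subseteq> ?X" using A BX by auto
    show "(SUP C\<in>{C. compactin K C \<and> C \<subseteq> A}. emeasure \<mu> C) \<le> emeasure \<mu> A"
      using A sets by (intro SUP_least emeasure_mono) auto
    show "emeasure \<mu> A \<le> (SUP C\<in>{C. compactin K C \<and> C \<subseteq> A}. emeasure \<mu> C)"
    proof (rule ennreal_le_epsilon)
      fix e :: real assume e: "0 < e"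
      have cA: "?X - A \<in> B" using A Bsig by (simp add: algebra.compl_sets sigma_algebra.axioms(1))
      obtain W where W: "openin K W" "?X - A \<subseteq> W" "g W \<le> m (?X - A) + ennreal e"
        using m_approx[of "?X - A" "ennreal e"] e by auto
      have C: "closedin K (?X - W)" "?X - W \<subseteq> A" using W by auto
      have WB: "W \<in> B" by (rule open_B[OF W(1)])
      have "emeasure \<mu> W \<le> emeasure \<mu> (?X - A) + ennreal e"
        using W by (simp add: em cA open_B m_open)
      then have "measure \<mu> W \<le> measure \<mu> (?X - A) + e"
        using e by (simp add: emeasure_eq_measure ennreal_plus[symmetric] del: ennreal_plus)
      then have "measure \<mu> A \<le> measure \<mu> (?X - W) + e"
        using prob_compl[of A] prob_compl[of W] A WB by (simp add: sets space)
      then have "emeasure \<mu> A \<le> emeasure \<mu> (?X - W) + ennreal e"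
        using e by (simp add: emeasure_eq_measure ennreal_plus[symmetric] del: ennreal_plus)
      also have "emeasure \<mu> (?X - W) \<le> (SUP C\<in>{C. compactin K C \<and> C \<subseteq> A}. emeasure \<mu> C)"
        using C closedin_compact_space[OF comp C(1)] by (intro SUP_upper) auto
      finally show "emeasure \<mu> A \<le> (SUP C\<in>{C. compactin K C \<and> C \<subseteq> A}. emeasure \<mu> C) + ennreal e"
        by (simp add: add_right_mono)
    qed
  qed
  have "regular_prob_measure K \<mu>"
    unfolding regular_prob_measure_def
    using prob space sets inner_reg outer_reg by (auto simp: B_def)
  moreover have "\<nu> C \<le> measure \<mu> C" if C: "closedin K C" for C
  proof -
    have "ennreal (\<nu> C) \<le> m C" using C by (intro m_greatest g_upper)
    then show ?thesis
      using em[OF closed_B[OF C]] by (metis emeasure_eq_measure ennreal_le_iff measure_nonneg)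
  qed
  ultimately show ?thesis using that by blast
qed


lemma continuous_map_borel_measurable:
  fixes f :: "'k \<Rightarrow> 'b::topological_space"
  assumes "regular_prob_measure K \<mu>" "continuous_map K euclidean f"
  shows "f \<in> borel_measurable \<mu>"
proof (rule borel_measurableI)
  fix S :: "'b set" assume "open S"
  then have "openin K {k \<in> topspace K. f k \<in> S}"
    using assms(2) by (simp add: continuous_map_def)
  then have "{k \<in> topspace K. f k \<in> S} \<in> sets \<mu>"
    using assms(1) by (auto simp: regular_prob_measure_def)
  moreover have "f -` S \<inter> space \<mu> = {k \<in> topspace K. f k \<in> S}"
    using assms(1) by (auto simp: regular_prob_measure_def)
  ultimately show "f -` S \<inter> space \<mu> \<in> sets \<mu>" by simp
qed

text \<open>The number of levels \<open>1, \<dots>, N\<close> reached by \<open>t\<close> is its integer part: this turns a function into a sum of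
indicators of superlevel sets up to an error of one level.\<close>

lemma count_levels:
  fixes t :: real
  assumes "0 \<le> t" "t \<le> real N"
  shows "(\<Sum>i\<in>{1..N}. if real i \<le> t then 1 else 0) = real (nat \<lfloor>t\<rfloor>)"
proof -
  have "{i\<in>{1..N}. real i \<le> t} = {1..nat \<lfloor>t\<rfloor>}"
    using assms by (auto simp: le_nat_floor le_floor_iff nat_le_iff) linarith+
  then show ?thesis by (simp add: sum.If_cases Int_def)
qed

text \<open>A continuous \<open>f\<close> with \<open>0 \<le> f \<le> M\<close> lies between \<open>d \<Sum>\<^sub>i 1\<^bsub>F\<^sub>i\<^esub>\<close> and \<open>d + d \<Sum>\<^sub>i 1\<^bsub>F\<^sub>i\<^esub>\<close>,
where \<open>d = M / N\<close> and \<open>F\<^sub>i\<close> is the closed set where \<open>f \<ge> i d\<close>.  The functional is compared with the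
upper, the integral with the lower of these bounds; their difference \<open>d\<close> tends to zero.\<close>

theorem regular_measure_dominating_functional:
  fixes K :: "'k topology" and \<Lambda> :: "('k \<Rightarrow> real) \<Rightarrow> real"
  assumes comp: "compact_space K" and haus: "Hausdorff_space K"
    and add: "\<And>f g. bounded (f ` topspace K) \<Longrightarrow> bounded (g ` topspace K) \<Longrightarrow> \<Lambda> (\<lambda>k. f k + g k) = \<Lambda> f + \<Lambda> g"
    and scale: "\<And>c f. bounded (f ` topspace K) \<Longrightarrow> \<Lambda> (\<lambda>k. c * f k) = c * \<Lambda> f"
    and le: "\<And>c f. bounded (f ` topspace K) \<Longrightarrow> (\<And>k. k \<in> topspace K \<Longrightarrow> f k \<le> c) \<Longrightarrow> \<Lambda> f \<le> c"
  obtains \<mu> where "regular_prob_measure K \<mu>"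
    "\<And>f. continuous_map K euclidean f \<Longrightarrow> (\<And>k. k \<in> topspace K \<Longrightarrow> 0 \<le> f k) \<Longrightarrow> \<Lambda> f \<le> (\<integral>k. f k \<partial>\<mu>)"
proof -
  let ?X = "topspace K"
  have bdd_ind: "bounded ((indicator A :: 'k \<Rightarrow> real) ` ?X)" for A
    by (rule finite_imp_bounded) (rule finite_subset[of _ "{0, 1}"], auto simp: indicator_def)
  have mono: "\<Lambda> f \<le> \<Lambda> g" if f: "bounded (f ` ?X)" and g: "bounded (g ` ?X)"
    and fg: "\<And>k. k \<in> ?X \<Longrightarrow> f k \<le> g k" for f g
  proof -
    have bg: "bounded ((\<lambda>k. (- 1) * g k) ` ?X)"
      using bounded_scaling[OF g, of "- 1"] by (simp add: image_image)
    then have "\<Lambda> (\<lambda>k. f k + (- 1) * g k) \<le> 0"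
      using fg bounded_plus_comp[OF f bg] by (intro le) auto
    then show ?thesis using add[OF f bg] scale[OF g, of "- 1"] by simp
  qed
  have [simp]: "bounded ((\<lambda>k. c) ` ?X)" for c :: real
    by (rule bounded_subset[of "{c}"]) auto
  have one: "\<Lambda> (\<lambda>k. 1) = 1"
  proof -
    have "\<Lambda> (\<lambda>k. 1) \<le> 1" by (rule le) auto
    moreover have "\<Lambda> (\<lambda>k. (- 1) * 1) \<le> - 1" by (rule le) auto
    ultimately show ?thesis using scale[of "\<lambda>k. 1" "- 1"] by simp
  qed
  have zero: "\<Lambda> (\<lambda>k. 0) = 0" using scale[of "\<lambda>k. 0" 0] by simp
  define \<nu> where "\<nu> A = \<Lambda> (indicator A)" for A
  have nonneg: "0 \<le> \<nu> A" for A
    using mono[of "\<lambda>k. 0" "indicator A"] bdd_ind zero by (simp add: \<nu>_def)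
  have additive: "\<nu> (A \<union> B) = \<nu> A + \<nu> B" if "A \<inter> B = {}" for A B
  proof -
    have "(indicator (A \<union> B) :: 'k \<Rightarrow> real) = (\<lambda>k. indicator A k + indicator B k)"
      using that by (auto simp: indicator_def fun_eq_iff)
    then show ?thesis using add[OF bdd_ind bdd_ind, of A B] by (simp add: \<nu>_def)
  qed
  have total: "\<nu> ?X = 1"
    using mono[of "\<lambda>k. 1" "indicator ?X"] mono[of "indicator ?X" "\<lambda>k. 1"] bdd_ind one by (simp add: \<nu>_def)
  obtain \<mu> where \<mu>: "regular_prob_measure K \<mu>" and dom: "\<And>C. closedin K C \<Longrightarrow> \<nu> C \<le> measure \<mu> C"
    using regular_measure_dominating_charge[OF comp haus nonneg additive total] by blast
  interpret prob_space \<mu> using \<mu> by (simp add: regular_prob_measure_def)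
  have space: "space \<mu> = ?X" using \<mu> by (simp add: regular_prob_measure_def)
  have closed_sets: "C \<in> sets \<mu>" if "closedin K C" for C
  proof -
    have "?X - C \<in> sets \<mu>" using that \<mu> by (auto simp: regular_prob_measure_def)
    then have "space \<mu> - (?X - C) \<in> sets \<mu>" by blast
    then show ?thesis using closedin_subset[OF that] by (simp add: space double_diff)
  qed
  have "\<Lambda> f \<le> (\<integral>k. f k \<partial>\<mu>)" if f: "continuous_map K euclidean f" and f0: "\<And>k. k \<in> ?X \<Longrightarrow> 0 \<le> f k" for f
  proof -
    have "compact (f ` ?X)"
      using image_compactin[of K ?X euclidean f] comp f by (simp add: compact_space_def)
    then have bdd: "bounded (f ` ?X)" by (rule compact_imp_bounded)
    then obtain M where M: "M > 0" "\<And>k. k \<in> ?X \<Longrightarrow> f k \<le> M"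
      unfolding bounded_pos by fastforce
    have meas[measurable]: "f \<in> borel_measurable \<mu>" by (rule continuous_map_borel_measurable[OF \<mu> f])
    have int: "integrable \<mu> f"
      using M(2) f0 by (intro integrable_const_bound[where B=M]) (auto simp: space)
    have *: "\<Lambda> f \<le> (\<integral>k. f k \<partial>\<mu>) + M * inverse (real (Suc n))" for n
    proof -
      define N where "N = Suc n"
      define d where "d = M / real N"
      have d: "d > 0" using M by (simp add: d_def N_def)
      define F where "F i = {k \<in> ?X. f k \<in> {real i * d ..}}" for i
      have F: "closedin K (F i)" for i
        unfolding F_def using f by (intro closedin_continuous_map_preimage) auto
      define s where "s k = (\<Sum>i\<in>{1..N}. indicator (F i) k :: real)" for k :: 'k
      have s: "s k = real (nat \<lfloor>f k / d\<rfloor>)" if k: "k \<in> ?X" for k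
      proof -
        have "s k = (\<Sum>i\<in>{1..N}. if real i \<le> f k / d then 1 else 0)"
          unfolding s_def using k d by (intro sum.cong) (auto simp: F_def indicator_def field_simps)
        also have "\<dots> = real (nat \<lfloor>f k / d\<rfloor>)"
        proof (rule count_levels)
          have "f k * real N \<le> M * real N" using M(2)[OF k] by (rule mult_right_mono) simp
          then show "f k / d \<le> real N" using M(1) by (simp add: d_def field_simps)
        qed (use f0[OF k] d in simp)
        finally show ?thesis .
      qed
      have lo: "d * s k \<le> f k" and up: "f k \<le> d + d * s k" if k: "k \<in> ?X" for k
      proof -
        have 0: "0 \<le> f k / d" using f0[OF k] d by simp
        then have "real (nat \<lfloor>f k / d\<rfloor>) \<le> f k / d" "f k / d \<le> 1 + real (nat \<lfloor>f k / d\<rfloor>)" by linarith+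
        then have "s k \<le> f k / d" "f k / d \<le> 1 + s k" by (simp_all add: s[OF k])
        then show "d * s k \<le> f k" "f k \<le> d + d * s k" using d by (simp_all add: field_simps)
      qed
      have sum: "bounded ((\<lambda>k. \<Sum>i\<in>I. indicator (F i) k :: real) ` ?X) \<and>
          \<Lambda> (\<lambda>k. \<Sum>i\<in>I. indicator (F i) k) = (\<Sum>i\<in>I. \<nu> (F i))" if "finite I" for I
        using that
      proof induction
        case empty
        have "(\<lambda>k. 0) ` ?X \<subseteq> {0::real}" by auto
        then show ?case using zero bounded_subset by auto
      next
        case (insert i I)
        then show ?case
          using bounded_plus_comp[OF bdd_ind[of "F i"], of "\<lambda>k. \<Sum>i\<in>I. indicator (F i) k"]
            add[OF bdd_ind[of "F i"], of "\<lambda>k. \<Sum>i\<in>I. indicator (F i) k"]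
          by (simp add: \<nu>_def)
      qed
      have bs: "bounded (s ` ?X)" and \<Lambda>s: "\<Lambda> s = (\<Sum>i\<in>{1..N}. \<nu> (F i))"
        using sum[of "{1..N}"] by (auto simp: s_def[abs_def])
      have bds: "bounded ((\<lambda>k. d * s k) ` ?X)"
        using bounded_scaling[OF bs, of d] by (simp add: image_image)
      have b1: "bounded ((\<lambda>k. d * 1) ` ?X)" by (rule bounded_subset[of "{d}"]) auto
      have "\<Lambda> f \<le> \<Lambda> (\<lambda>k. d * 1 + d * s k)"
        using bdd bounded_plus_comp[OF b1 bds] up by (intro mono) auto
      also have "\<dots> = d + d * (\<Sum>i\<in>{1..N}. \<nu> (F i))"
        unfolding add[OF b1 bds] scale[OF bs] \<Lambda>s using scale[of "\<lambda>k. 1" d] one by simp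
      also have "\<dots> \<le> d + d * (\<Sum>i\<in>{1..N}. measure \<mu> (F i))"
        using d dom[OF F] by (intro add_left_mono mult_left_mono sum_mono) auto
      also have "(\<Sum>i\<in>{1..N}. measure \<mu> (F i)) = (\<integral>k. s k \<partial>\<mu>)"
        using closed_sets[OF F] unfolding s_def
          by (subst Bochner_Integration.integral_sum) (auto simp: emeasure_eq_measure intro!: integrable_real_indicator)
      also have "d * (\<integral>k. s k \<partial>\<mu>) = (\<integral>k. d * s k \<partial>\<mu>)" by simp
      also have "(\<integral>k. d * s k \<partial>\<mu>) \<le> (\<integral>k. f k \<partial>\<mu>)"
        using closed_sets[OF F] lo int
        by (intro integral_mono) (auto simp: s_def space emeasure_eq_measure intro!: integrable_mult_right integrable_real_indicator
            Bochner_Integration.integrable_sum)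
      finally show ?thesis by (simp add: d_def N_def divide_inverse)
    qed
    have "(\<lambda>n. (\<integral>k. f k \<partial>\<mu>) + M * inverse (real (Suc n))) \<longlonglongrightarrow> (\<integral>k. f k \<partial>\<mu>) + M * 0"
      by (intro tendsto_intros LIMSEQ_inverse_real_of_nat)
    then show ?thesis using LIMSEQ_le_const[of _ _ "\<Lambda> f"] * by auto
  qed
  then show ?thesis using that \<mu> by blast
qed

section \<open>Polars\<close>

lemma banach_space_over_self: "banach_space_over ((*) :: 'f::rc_field \<Rightarrow> 'f \<Rightarrow> 'f)"
  by unfold_locales (auto simp: algebra_simps norm_mult scaleR_conv_of_real)

context locally_convex_space
begin

lemma absorbing:
  assumes "0 \<in> interior U"
  obtains t :: real where "t > 0" "smul (of_real t) x \<in> U"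
proof -
  have "continuous_on UNIV (\<lambda>t::real. (of_real t :: 'f, x))"
    by (intro continuous_intros)
  then have "continuous_on UNIV (\<lambda>t::real. smul (of_real t) x)"
    using continuous_on_compose2[OF continuous_scale, of UNIV "\<lambda>t. (of_real t :: 'f, x)"] by simp
  then have "open ((\<lambda>t::real. smul (of_real t) x) -` interior U)"
    by (intro open_vimage) auto
  moreover have "0 \<in> (\<lambda>t::real. smul (of_real t) x) -` interior U" using assms by simp
  ultimately obtain e where e: "e > 0" "ball 0 e \<subseteq> (\<lambda>t::real. smul (of_real t) x) -` interior U"
    unfolding open_contains_ball by blast
  have "e / 2 \<in> ball 0 e" using e by simp
  then have "smul (of_real (e / 2)) x \<in> U" using e(2) interior_subset by blast
  then show ?thesis using that[of "e / 2"] e(1) by simp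
qed

text \<open>Continuity is automatic for a linear functional that is bounded on a neighbourhood of zero, so the polar
is cut out by pointwise conditions; this is what makes it closed in the product.\<close>

lemma polar_iff:
  assumes U: "0 \<in> interior U"
  shows "\<xi> \<in> polar smul U \<longleftrightarrow> (\<forall>x y. \<xi> (x + y) = \<xi> x + \<xi> y) \<and> (\<forall>a x. \<xi> (smul a x) = a * \<xi> x) \<and>
    (\<forall>x\<in>U. norm (\<xi> x) \<le> 1)"
proof
  assume "\<xi> \<in> polar smul U"
  then show "(\<forall>x y. \<xi> (x + y) = \<xi> x + \<xi> y) \<and> (\<forall>a x. \<xi> (smul a x) = a * \<xi> x) \<and> (\<forall>x\<in>U. norm (\<xi> x) \<le> 1)"
    by (auto simp: polar_def top_dual_def is_operator_def type_tvs_def)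
next
  assume \<xi>: "(\<forall>x y. \<xi> (x + y) = \<xi> x + \<xi> y) \<and> (\<forall>a x. \<xi> (smul a x) = a * \<xi> x) \<and> (\<forall>x\<in>U. norm (\<xi> x) \<le> 1)"
  interpret F: banach_space_over "(*) :: 'f \<Rightarrow> 'f \<Rightarrow> 'f" by (rule banach_space_over_self)
  interpret F: normed_quotient "(*) :: 'f \<Rightarrow> 'f \<Rightarrow> 'f" UNIV norm id "(+)" "(*)" norm by (rule F.normed_quotient_type)
  have "is_operator (type_tvs smul) F.X \<xi>"
    using \<xi> by (intro F.is_operator_intoI[OF locally_convex_space_axioms U]) auto
  then show "\<xi> \<in> polar smul U"
    using \<xi> by (simp add: polar_def top_dual_def F.type_tvs_eq)
qed

lemma zero_in_polar: "0 \<in> interior U \<Longrightarrow> (\<lambda>x. 0) \<in> polar smul U"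
  by (simp add: polar_iff)

lemma polar_space_eq: "polar_space smul U = top_of_set (polar smul U)"
proof -
  have "top_dual smul \<inter> polar smul U = polar smul U" by (auto simp: polar_def)
  then show ?thesis by (simp add: polar_space_def weak_star_def subtopology_subtopology)
qed

lemma topspace_polar_space [simp]: "topspace (polar_space smul U) = polar smul U"
  by (simp add: polar_space_eq)

lemma Hausdorff_polar_space: "Hausdorff_space (polar_space smul U)"
proof -
  have "Hausdorff_space (product_topology (\<lambda>_::'e. euclidean :: 'f topology) UNIV)"
    by (simp add: Hausdorff_space_product_topology)
  then show ?thesis
    unfolding polar_space_eq euclidean_product_topology by (rule Hausdorff_space_subtopology)
qed

text \<open>The theorem of Banach and Alaoglu: \<open>U\<close> is absorbing, so the polar is contained in a product of discs,
which is compact by Tychonoff's theorem.\<close>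

lemma compact_polar_space:
  assumes U: "0 \<in> interior U"
  shows "compact_space (polar_space smul U)"
proof -
  have "\<forall>x. \<exists>c. \<forall>\<xi>\<in>polar smul U. norm (\<xi> x) \<le> c"
  proof
    fix x
    obtain t :: real where t: "t > 0" "smul (of_real t) x \<in> U" using absorbing[OF U] by blast
    have "norm (\<xi> x) \<le> 1 / t" if "\<xi> \<in> polar smul U" for \<xi>
    proof -
      have "norm (\<xi> (smul (of_real t) x)) \<le> 1" using that t(2) unfolding polar_iff[OF U] by blast
      then have "t * norm (\<xi> x) \<le> 1" using that t(1) by (simp add: polar_iff[OF U] norm_mult)
      then show ?thesis using t(1) by (simp add: field_simps)
    qed
    then show "\<exists>c. \<forall>\<xi>\<in>polar smul U. norm (\<xi> x) \<le> c" by blast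
  qed
  then obtain c where c: "\<And>x \<xi>. \<xi> \<in> polar smul U \<Longrightarrow> norm (\<xi> x) \<le> c x" by metis
  let ?B = "PiE UNIV (\<lambda>x. cball (0::'f) (c x))"
  have "compactin (product_topology (\<lambda>_::'e. euclidean) UNIV) ?B"
    unfolding compactin_PiE by simp
  then have "compact ?B" by (simp add: euclidean_product_topology)
  have co: "continuous_on UNIV (\<lambda>\<xi>::'e \<Rightarrow> 'f. \<xi> x)" for x by simp
  have "closed {\<xi>::'e \<Rightarrow> 'f. (\<forall>x y. \<xi> (x + y) = \<xi> x + \<xi> y) \<and> (\<forall>a x. \<xi> (smul a x) = a * \<xi> x) \<and>
      (\<forall>x. x \<in> U \<longrightarrow> norm (\<xi> x) \<le> 1)}"
    by (intro closed_Collect_conj closed_Collect_all closed_Collect_eq closed_Collect_le closed_Collect_imp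
        open_Collect_const continuous_intros co)
  then have closed: "closed (polar smul U)"
    by (rule back_subst[of closed]) (auto simp: polar_iff[OF U])
  have "polar smul U = ?B \<inter> polar smul U"
    using c by (auto simp: PiE_iff)
  then have "compact (polar smul U)"
    using compact_Int_closed[OF \<open>compact ?B\<close> closed] by simp
  then show ?thesis by (simp add: polar_space_eq compact_space_subtopology)
qed

text \<open>Evaluation at \<open>x\<close> as a function on the polar, extended by zero.  The extension makes \<open>x \<mapsto> ev U x\<close> linear
as a map into the function type; evaluation of arbitrary functions would be additive only on the
polar.\<close>

definition ev :: "'e set \<Rightarrow> 'e \<Rightarrow> ('e \<Rightarrow> 'f) \<Rightarrow> 'f" where
  "ev U x = (\<lambda>\<xi>. if \<xi> \<in> polar smul U then \<xi> x else 0)"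

lemma ev_add: "0 \<in> interior U \<Longrightarrow> ev U (x + y) = ev U x + ev U y"
  and ev_scale: "0 \<in> interior U \<Longrightarrow> ev U (smul a x) = fscale a (ev U x)"
  by (auto simp: ev_def fun_eq_iff polar_iff)

lemma ev_cont_fun: "ev U x \<in> cont_fun (polar_space smul U)"
proof -
  have "continuous_map (polar_space smul U) euclidean (\<lambda>\<xi>. \<xi> x)"
    unfolding polar_space_eq continuous_map_iff_continuous
    by (rule continuous_on_subset[OF continuous_on_product_coordinates subset_UNIV])
  then have "continuous_map (polar_space smul U) euclidean (ev U x)"
    by (rule continuous_map_eq) (simp add: ev_def)
  then show ?thesis by (simp add: cont_fun_def)
qed

end


section \<open>The dominating measure of a summing operator\<close>

text \<open>The cone consists of the sums \<open>\<Phi> xs\<close> over finite lists, closed under addition by concatenation and under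
scaling by homogeneity of \<open>\<phi>\<^sub>x\<close> of degree \<open>p\<close> in \<open>x\<close>.  The summing inequality speaks only about
points of \<open>U\<close>, but a finite list is moved into \<open>U\<close> by a common factor.\<close>

theorem pietsch_domination:
  fixes sE :: "'f::rc_field \<Rightarrow> 'e \<Rightarrow> 'e::{topological_ab_group_add, t2_space}"
    and sL :: "'f \<Rightarrow> 'l \<Rightarrow> 'l::banach"
  assumes p: "1 \<le> p" and E: "locally_convex_space sE" and L: "banach_space_over sL"
    and T_sc: "\<And>a x. T (sE a x) = sL a (T x)"
    and U: "0 \<in> interior U" and ac: "absolutely_convex sE U" and summing: "p_summing_wrt sE U p T"
  obtains \<mu> C where "regular_prob_measure (polar_space sE U) \<mu>" "C > 0"
    "\<And>x. norm (T x) \<le> C * Lp_norm p \<mu> (locally_convex_space.ev sE U x)"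
proof -
  interpret E: locally_convex_space sE by (rule E)
  interpret L: banach_space_over sL by (rule L)
  let ?P = "polar sE U"
  let ?K = "polar_space sE U"
  have comp: "compact_space ?K" by (rule E.compact_polar_space[OF U])
  have haus: "Hausdorff_space ?K" by (rule E.Hausdorff_polar_space)
  have ne: "?P \<noteq> {}" using E.zero_in_polar[OF U] by blast
  define b where "b n x \<xi> = (\<Sum>i\<le>n. norm (\<xi> (x i)) powr p)" for n and x :: "nat \<Rightarrow> 'e" and \<xi> :: "'e \<Rightarrow> 'f"
  from summing obtain C where C: "C > 0" and "\<forall>n. \<forall>x::nat \<Rightarrow> 'e. (\<forall>i\<le>n. x i \<in> U) \<longrightarrow>
     (\<Sum>i\<le>n. norm (T (x i)) powr p) powr (1 / p) \<le> C * (SUP \<xi>\<in>?P. (\<Sum>i\<le>n. norm (\<xi> (x i)) powr p) powr (1 / p))"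
    unfolding p_summing_wrt_def by (elim exE conjE) rule
  then have summ: "(\<Sum>i\<le>n. norm (T (x i)) powr p) powr (1 / p) \<le> C * (SUP \<xi>\<in>?P. b n x \<xi> powr (1 / p))"
    if "\<And>i. i \<le> n \<Longrightarrow> x i \<in> U" for n x
    using that unfolding b_def by blast
  define h where "h x \<xi> = norm (E.ev U x \<xi>) powr p" for x \<xi>
  define \<psi> where "\<psi> x \<xi> = (if \<xi> \<in> ?P then C powr p * h x \<xi> - norm (T x) powr p else 0)" for x \<xi>
  define \<Phi> where "\<Phi> xs = (\<lambda>\<xi>. \<Sum>x\<leftarrow>xs. \<psi> x \<xi>)" for xs
  have h_cont: "continuous_map ?K euclidean (h x)" for x
  proof -
    have "continuous_map ?K euclidean (\<lambda>\<xi>. norm (E.ev U x \<xi>))"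
      using E.ev_cont_fun[of U x] by (simp add: cont_fun_def continuous_intros)
    moreover have "continuous_map (subtopology euclidean {0..}) euclidean (\<lambda>t::real. t powr p)"
      unfolding continuous_map_iff_continuous using p by (intro continuous_on_powr' continuous_intros) auto
    ultimately show ?thesis
      using continuous_map_compose[of ?K "subtopology euclidean {0..}" "\<lambda>\<xi>. norm (E.ev U x \<xi>)" euclidean "\<lambda>t. t powr p"]
      by (simp add: h_def[abs_def] o_def continuous_map_in_subtopology image_subset_iff)
  qed
  have bdd_cont: "bounded (f ` ?P)" if "continuous_map ?K euclidean f" for f :: "('e \<Rightarrow> 'f) \<Rightarrow> real"
    using cont_fun_bounded[OF comp, of f] that by (simp add: cont_fun_def)
  define V where "V = (ell_fun ?P :: (('e \<Rightarrow> 'f) \<Rightarrow> real) set)"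
  interpret R: real_subspace fscale V
    using vector_space_fscale subspace_ell_fun by (auto simp: real_subspace_def real_subspace_axioms_def V_def)
  define q where "q g = (SUP \<xi>\<in>?P. g \<xi>)" for g :: "('e \<Rightarrow> 'f) \<Rightarrow> real"
  have q_upper: "g \<xi> \<le> q g" if "g \<in> V" "\<xi> \<in> ?P" for g \<xi>
    unfolding q_def using that by (intro cSUP_upper bounded_imp_bdd_above) (auto simp: V_def ell_fun_def)
  have q_least: "q g \<le> c" if "\<And>\<xi>. \<xi> \<in> ?P \<Longrightarrow> g \<xi> \<le> c" for g c
    unfolding q_def using ne that by (rule cSUP_least)
  have q: "R.sublinear q"
    unfolding R.sublinear_def
  proof (intro conjI ballI allI impI)
    show "q (f + g) \<le> q f + q g" if "f \<in> V" "g \<in> V" for f g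
      using q_upper[OF that(1)] q_upper[OF that(2)] by (intro q_least) (simp add: add_mono)
    have le: "q (fscale t f) \<le> t * q f" if "t > 0" "f \<in> V" for t f
      using q_upper[OF that(2)] that(1) by (intro q_least) simp
    show "q (fscale t f) = t * q f" if "t > 0" "f \<in> V" for t f
    proof (rule antisym[OF le[OF that]])
      have "q (fscale (1 / t) (fscale t f)) \<le> 1 / t * q (fscale t f)"
        using that R.V_scale by (intro le) auto
      moreover have "fscale (1 / t) (fscale t f) = f" using that by (simp add: fun_eq_iff)
      ultimately show "t * q f \<le> q (fscale t f)" using that by (simp add: field_simps)
    qed
  qed
  have ind_V: "(\<lambda>\<xi>. if \<xi> \<in> ?P then c else 0) \<in> V" for c
    unfolding V_def ell_fun_def using bounded_subset[of "{c}"] by (auto simp: image_subset_iff)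
  have h_V: "h x \<in> V" for x using bdd_cont[OF h_cont] by (simp add: V_def ell_fun_def)
  have \<psi>_eq: "\<psi> x = fscale (C powr p) (h x) + (\<lambda>\<xi>. if \<xi> \<in> ?P then - (norm (T x) powr p) else 0)" for x
    using p by (auto simp: \<psi>_def fun_eq_iff h_def E.ev_def)
  have \<psi>_V: "\<psi> x \<in> V" for x
    unfolding \<psi>_eq by (intro R.V_add R.V_scale h_V ind_V)
  have \<Phi>_simps: "\<Phi> [] = 0" "\<Phi> (x # xs) = \<psi> x + \<Phi> xs" "\<Phi> (xs @ ys) = \<Phi> xs + \<Phi> ys" for x xs ys
    by (auto simp: \<Phi>_def fun_eq_iff)
  have \<Phi>_V: "\<Phi> xs \<in> V" for xs
    by (induction xs) (simp_all only: \<Phi>_simps R.V_zero R.V_add \<psi>_V)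
  have \<psi>_scale: "\<psi> (sE (of_real t) x) = fscale (t powr p) (\<psi> x)" if "t \<ge> 0" for t x
    using that
    by (auto simp: \<psi>_def h_def fun_eq_iff E.ev_scale[OF U] T_sc L.norm_scale norm_mult powr_mult algebra_simps)
  have \<Phi>_scale: "\<Phi> (map (sE (of_real t)) xs) = fscale (t powr p) (\<Phi> xs)" if "t \<ge> 0" for t xs
    using that by (induction xs) (auto simp: \<Phi>_simps \<psi>_scale fun_eq_iff algebra_simps)
  have \<Phi>_in_U: "0 \<le> q (\<Phi> xs)" if xs: "set xs \<subseteq> U" for xs
  proof (cases "xs = []")
    case True
    then show ?thesis using R.sublinear_zero[OF q] by (simp add: \<Phi>_simps)
  next
    case False
    \<comment> \<open>The summing inequality is indexed by \<open>i \<le> n\<close>, hence excludes the empty family.\<close>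
    define n where "n = length xs - 1"
    have sum_eq: "(\<Sum>x\<leftarrow>xs. f x) = (\<Sum>i\<le>n. f (xs ! i))" for f :: "'e \<Rightarrow> real"
    proof -
      have "{..n} = {0..<length xs}" using False by (auto simp: n_def Suc_le_eq[symmetric] neq_Nil_conv)
      then show ?thesis by (simp add: sum_list_sum_nth)
    qed
    have in_U: "xs ! i \<in> U" if "i \<le> n" for i
      using that False xs nth_mem[of i xs] by (cases xs) (auto simp: n_def)
    define a where "a = (\<Sum>i\<le>n. norm (T (xs ! i)) powr p)"
    define c where "c = b n ((!) xs)"
    have \<Phi>_val: "\<Phi> xs \<xi> = C powr p * c \<xi> - a" if "\<xi> \<in> ?P" for \<xi>
      using that unfolding \<Phi>_def sum_eq
      by (simp add: \<psi>_def h_def E.ev_def a_def b_def c_def sum_subtractf sum_distrib_left)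
    have b0: "0 \<le> c \<xi>" for \<xi> by (auto simp: b_def c_def intro!: sum_nonneg)
    show ?thesis
    proof (rule ccontr)
      assume neg: "\<not> 0 \<le> q (\<Phi> xs)"
      \<comment> \<open>On the polar \<open>C\<^sup>p c \<xi>\<close> stays below \<open>w < a\<close>; taking \<open>p\<close>-th roots contradicts the summing inequality.\<close>
      define w where "w = a + q (\<Phi> xs)"
      have bc: "C powr p * c \<xi> \<le> w" if "\<xi> \<in> ?P" for \<xi>
        using q_upper[OF \<Phi>_V[of xs] that] \<Phi>_val[OF that] by (simp add: w_def)
      have w0: "0 \<le> w"
      proof -
        obtain \<xi> where "\<xi> \<in> ?P" using ne by auto
        then show ?thesis using bc[of \<xi>] b0[of \<xi>] C by (smt (verit) mult_nonneg_nonneg powr_ge_zero)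
      qed
      have "C * c \<xi> powr (1 / p) \<le> w powr (1 / p)" if "\<xi> \<in> ?P" for \<xi>
      proof -
        have "(C powr p * c \<xi>) powr (1 / p) \<le> w powr (1 / p)"
          using bc[OF that] b0[of \<xi>] p by (intro powr_mono2) auto
        then show ?thesis using C p b0[of \<xi>] by (simp add: powr_mult powr_powr)
      qed
      then have "(SUP \<xi>\<in>?P. c \<xi> powr (1 / p)) \<le> w powr (1 / p) / C"
        using ne C by (intro cSUP_least) (auto simp: field_simps)
      then have "C * (SUP \<xi>\<in>?P. c \<xi> powr (1 / p)) \<le> w powr (1 / p)" using C by (simp add: field_simps)
      moreover have "a powr (1 / p) \<le> C * (SUP \<xi>\<in>?P. c \<xi> powr (1 / p))"
        unfolding a_def c_def by (rule summ[OF in_U])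
      moreover have "w powr (1 / p) < a powr (1 / p)"
        using neg w0 p by (intro powr_less_mono2) (auto simp: w_def)
      ultimately show False by simp
    qed
  qed
  have shrink: "\<exists>t>0. \<forall>x\<in>set xs. sE (of_real t) x \<in> U" for xs
  proof (induction xs)
    case (Cons x xs)
    then obtain s where s: "s > 0" "\<forall>x\<in>set xs. sE (of_real s) x \<in> U" by auto
    obtain r :: real where r: "r > 0" "sE (of_real r) x \<in> U" using E.absorbing[OF U] by blast
    have smaller: "sE (of_real t) y \<in> U" if "sE (of_real r) y \<in> U" "0 < t" "t \<le> r" for t r :: real and y
    proof -
      have "norm (of_real (t / r) :: 'f) + norm (0 :: 'f) \<le> 1" using that by (simp add: norm_divide)
      then have "sE (of_real (t / r)) (sE (of_real r) y) + sE 0 (sE (of_real r) y) \<in> U"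
        using ac that(1) unfolding absolutely_convex_def by blast
      then show ?thesis using that by (simp add: of_real_mult[symmetric] del: of_real_mult of_real_divide)
    qed
    show ?case
      using s r smaller[OF r(2), of "min s r"] smaller[of s _ "min s r"]
      by (intro exI[of _ "min s r"]) auto
  qed (auto intro: exI[of _ 1])
  have \<Phi>_nonneg: "0 \<le> q (\<Phi> xs)" for xs
  proof -
    obtain t :: real where t: "t > 0" "\<forall>x\<in>set xs. sE (of_real t) x \<in> U" using shrink by blast
    have "0 \<le> q (\<Phi> (map (sE (of_real t)) xs))" using t by (intro \<Phi>_in_U) auto
    also have "\<dots> = t powr p * q (\<Phi> xs)"
      using t q \<Phi>_V[of xs] by (simp add: \<Phi>_scale R.sublinear_def)
    finally show ?thesis using t by (simp add: zero_le_mult_iff)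
  qed
  have S: "R.superlinear_on (range \<Phi>) (\<lambda>_. 0)"
    unfolding R.superlinear_on_def
  proof (intro conjI ballI allI impI)
    show "range \<Phi> \<subseteq> V" using \<Phi>_V by auto
    show "0 \<in> range \<Phi>" unfolding \<Phi>_simps(1)[symmetric] by (rule rangeI)
    show "f + g \<in> range \<Phi>" if fg: "f \<in> range \<Phi>" "g \<in> range \<Phi>" for f g
    proof -
      obtain xs ys where "f = \<Phi> xs" "g = \<Phi> ys" using fg by blast
      then have "f + g = \<Phi> (xs @ ys)" by (simp only: \<Phi>_simps)
      then show ?thesis by simp
    qed
    show "fscale t f \<in> range \<Phi>" if t: "t > 0" and f: "f \<in> range \<Phi>" for t f
    proof -
      obtain xs where "f = \<Phi> xs" using f by auto
      then have "fscale t f = \<Phi> (map (sE (of_real (t powr (1 / p)))) xs)"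
        using t p by (simp add: \<Phi>_scale powr_powr)
      then show ?thesis by simp
    qed
  qed auto
  obtain \<Lambda> where \<Lambda>: "R.linear_on_V \<Lambda>" "\<And>f. f \<in> V \<Longrightarrow> \<Lambda> f \<le> q f" "\<And>f. f \<in> range \<Phi> \<Longrightarrow> 0 \<le> \<Lambda> f"
    using R.sandwich[OF q S] \<Phi>_nonneg by blast
  have \<Lambda>_add: "\<Lambda> (f + g) = \<Lambda> f + \<Lambda> g" if "f \<in> V" "g \<in> V" for f g
    using \<Lambda>(1) that unfolding R.linear_on_V_def by blast
  have \<Lambda>_scale: "\<Lambda> (fscale c f) = c * \<Lambda> f" if "f \<in> V" for f c
    using \<Lambda>(1) that unfolding R.linear_on_V_def by blast
  have \<Lambda>_le: "\<Lambda> f \<le> c" if "f \<in> V" "\<And>\<xi>. \<xi> \<in> ?P \<Longrightarrow> f \<xi> \<le> c" for f c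
    using \<Lambda>(2)[OF that(1)] q_least[of f c] that(2) by force
  obtain \<mu> where \<mu>: "regular_prob_measure ?K \<mu>"
    and dom: "\<And>f. continuous_map ?K euclidean f \<Longrightarrow> (\<And>\<xi>. \<xi> \<in> ?P \<Longrightarrow> 0 \<le> f \<xi>) \<Longrightarrow> \<Lambda> f \<le> (\<integral>\<xi>. f \<xi> \<partial>\<mu>)"
    using regular_measure_dominating_functional[OF comp haus, of \<Lambda>] \<Lambda>_add \<Lambda>_scale \<Lambda>_le
    by (auto simp: V_def ell_fun_def plus_fun_def fscale_def)
  have "norm (T x) \<le> C * Lp_norm p \<mu> (E.ev U x)" for x
  proof -
    have "\<Phi> [x] = \<psi> x" by (simp add: \<Phi>_simps)
    then have "0 \<le> \<Lambda> (\<psi> x)" using \<Lambda>(3)[OF rangeI, of "[x]"] by simp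
    also have "\<Lambda> (\<psi> x) = C powr p * \<Lambda> (h x) + \<Lambda> (\<lambda>\<xi>. if \<xi> \<in> ?P then - (norm (T x) powr p) else 0)"
      unfolding \<psi>_eq by (simp add: \<Lambda>_add \<Lambda>_scale R.V_scale h_V ind_V)
    also have "\<dots> \<le> C powr p * (\<integral>\<xi>. h x \<xi> \<partial>\<mu>) + - (norm (T x) powr p)"
      by (intro add_mono mult_left_mono dom h_cont \<Lambda>_le ind_V) (auto simp: h_def)
    also have "(\<integral>\<xi>. h x \<xi> \<partial>\<mu>) = Lp_norm p \<mu> (E.ev U x) powr p"
      by (simp add: Lp_norm_powr[OF p] h_def)
    finally have *: "norm (T x) powr p \<le> (C * Lp_norm p \<mu> (E.ev U x)) powr p"
      using C by (simp add: powr_mult)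
    show ?thesis by (rule le_if_powr_le[OF p _ *]) (use C in simp)
  qed
  then show ?thesis using that[OF \<mu> C] by blast
qed

section \<open>The dual ball and the canonical embedding\<close>

context banach_space_over
begin

text \<open>On a functional that is known to be continuous, \<open>onorm \<xi> \<le> 1\<close> means \<open>|\<xi> y| \<le> \<parallel>y\<parallel>\<close>; without continuity
the operator norm would be a meaningless supremum, which is why boundedness is established first.\<close>

lemma dual_ball_iff:
  "\<xi> \<in> dual_ball smul \<longleftrightarrow> (\<forall>x y. \<xi> (x + y) = \<xi> x + \<xi> y) \<and> (\<forall>a x. \<xi> (smul a x) = a * \<xi> x) \<and>
    (\<forall>x. norm (\<xi> x) \<le> norm x)"
proof -
  interpret F: banach_space_over "(*) :: 'f \<Rightarrow> 'f \<Rightarrow> 'f" by (rule banach_space_over_self)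
  interpret LF: two_normed_quotients smul UNIV norm id "(+)" smul norm "(*) :: 'f \<Rightarrow> 'f \<Rightarrow> 'f" UNIV norm id "(+)" "(*)" norm
    using normed_quotient_type F.normed_quotient_type by (simp add: two_normed_quotients_def)
  have dual: "\<xi> \<in> top_dual smul \<longleftrightarrow> is_operator (sub_tvs LF.A.X UNIV) LF.B.X \<xi>"
    using LF.A.sub_tvs_carrier by (simp add: top_dual_def type_tvs_eq F.type_tvs_eq)
  show ?thesis
  proof
    assume \<xi>: "\<xi> \<in> dual_ball smul"
    then have op: "is_operator (sub_tvs LF.A.X UNIV) LF.B.X \<xi>" by (simp add: dual_ball_def dual)
    have add: "\<xi> (x + y) = \<xi> x + \<xi> y" and sc: "\<xi> (smul a x) = a * \<xi> x" for x y a
      using op by (auto simp: is_operator_def sub_tvs_def normed_tvs_def)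
    obtain C where C: "\<And>x. norm (\<xi> x) \<le> C * norm x"
      using LF.is_operator_bounded[OF _ _ _ _ op] by auto
    have "bounded_linear \<xi>"
    proof (rule bounded_linear_intro)
      show "\<xi> (r *\<^sub>R x) = r *\<^sub>R \<xi> x" for r x
        using sc[of "of_real r" x] by (simp add: scale_of_real scaleR_conv_of_real)
      show "norm (\<xi> x) \<le> norm x * C" for x using C[of x] by (simp add: mult.commute)
    qed (rule add)
    then have "norm (\<xi> x) \<le> onorm \<xi> * norm x" for x by (rule onorm)
    moreover have "onorm \<xi> * norm x \<le> 1 * norm x" for x
      using \<xi> by (intro mult_right_mono) (auto simp: dual_ball_def)
    ultimately have "norm (\<xi> x) \<le> norm x" for x by (metis mult_1 order_trans)
    then show "(\<forall>x y. \<xi> (x + y) = \<xi> x + \<xi> y) \<and> (\<forall>a x. \<xi> (smul a x) = a * \<xi> x) \<and> (\<forall>x. norm (\<xi> x) \<le> norm x)"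
      using add sc by blast
  next
    assume \<xi>: "(\<forall>x y. \<xi> (x + y) = \<xi> x + \<xi> y) \<and> (\<forall>a x. \<xi> (smul a x) = a * \<xi> x) \<and> (\<forall>x. norm (\<xi> x) \<le> norm x)"
    then have "is_operator (sub_tvs LF.A.X UNIV) LF.B.X \<xi>"
      by (intro LF.is_operator_boundedI[where C=1]) auto
    moreover have "onorm \<xi> \<le> 1" using \<xi> by (intro onorm_bound) auto
    ultimately show "\<xi> \<in> dual_ball smul" by (simp add: dual_ball_def dual)
  qed
qed

lemma zero_in_dual_ball: "(\<lambda>y. 0) \<in> dual_ball smul"
  by (simp add: dual_ball_iff)

text \<open>Extension of \<open>a y \<mapsto> a \<parallel>y\<parallel>\<close> from the line through \<open>y\<close>; this makes the canonical embedding isometric.\<close>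

lemma norming_functional:
  obtains \<xi> where "\<xi> \<in> dual_ball smul" "norm (\<xi> y) = norm y"
proof (cases "y = 0")
  case True
  then show ?thesis using that[OF zero_in_dual_ball] by simp
next
  case False
  define l where "l x = (THE a. x = smul a y) * of_real (norm y)" for x
  have the: "(THE b. smul a y = smul b y) = a" for a
  proof (rule the_equality)
    show "b = a" if "smul a y = smul b y" for b using that False scale_cancel_right by metis
  qed (rule refl)
  have l: "l (smul a y) = a * of_real (norm y)" for a unfolding l_def the by (rule refl)
  have F: "subspace (range (\<lambda>a. smul a y))"
    unfolding subspace_def
    by (auto simp: scale_left_distrib[symmetric] intro: range_eqI[of _ _ 0])
  obtain \<xi> where "\<And>x z. \<xi> (x + z) = \<xi> x + \<xi> z" "\<And>a x. \<xi> (smul a x) = a * \<xi> x"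
    "\<And>x. norm (\<xi> x) \<le> norm x" and ext: "\<And>x. x \<in> range (\<lambda>a. smul a y) \<Longrightarrow> \<xi> x = l x"
  proof (rule hahn_banach_seminorm[OF vector_space_axioms subspace_UNIV F, of norm l])
    show "l (x + z) = l x + l z" if "x \<in> range (\<lambda>a. smul a y)" "z \<in> range (\<lambda>a. smul a y)" for x z
      using that by (auto simp: scale_left_distrib[symmetric] l distrib_right)
    show "l (smul a x) = a * l x" if "x \<in> range (\<lambda>a. smul a y)" for a x
      using that by (auto simp: l)
    show "norm (l x) \<le> norm x" if "x \<in> range (\<lambda>a. smul a y)" for x
      using that by (auto simp: l norm_mult norm_scale)
  qed (auto simp: norm_triangle_ineq norm_scale)
  then have "\<xi> \<in> dual_ball smul" by (simp add: dual_ball_iff)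
  moreover have "\<xi> y = of_real (norm y)"
    using ext[OF rangeI, of 1] l[of 1] by simp
  ultimately show ?thesis using that by simp
qed

lemma canonical_embedding_simps:
  "canonical_embedding smul (x + y) = (\<lambda>\<xi>\<in>dual_ball smul. canonical_embedding smul x \<xi> + canonical_embedding smul y \<xi>)"
  "canonical_embedding smul (smul a x) = (\<lambda>\<xi>\<in>dual_ball smul. a * canonical_embedding smul x \<xi>)"
  by (auto simp: canonical_embedding_def fun_eq_iff dual_ball_iff)

lemma canonical_embedding_diff:
  "canonical_embedding smul (x - y) =
    (\<lambda>\<xi>\<in>dual_ball smul. canonical_embedding smul x \<xi> + (\<lambda>\<xi>\<in>dual_ball smul. (- 1) * canonical_embedding smul y \<xi>) \<xi>)"
  using canonical_embedding_simps(1)[of x "- y"] canonical_embedding_simps(2)[of "- 1" y] by simp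

lemma canonical_embedding_in: "canonical_embedding smul y \<in> (\<lambda>f. restrict f (dual_ball smul)) ` ell_fun (dual_ball smul)"
proof -
  have "(\<lambda>\<xi>. \<xi> y) \<in> ell_fun (dual_ball smul)"
    unfolding ell_fun_def bounded_iff by (auto simp: dual_ball_iff intro!: exI[of _ "norm y"])
  then show ?thesis unfolding canonical_embedding_def by blast
qed

lemma norm_canonical_embedding: "sup_norm (dual_ball smul) (canonical_embedding smul y) = norm y"
proof (rule antisym)
  show "sup_norm (dual_ball smul) (canonical_embedding smul y) \<le> norm y"
  proof (rule sup_norm_least)
    show "dual_ball smul \<noteq> {}" using zero_in_dual_ball by blast
  qed (auto simp: canonical_embedding_def dual_ball_iff)
  obtain \<xi> where \<xi>: "\<xi> \<in> dual_ball smul" "norm (\<xi> y) = norm y" by (rule norming_functional)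
  have "bounded (canonical_embedding smul y ` dual_ball smul)"
    unfolding bounded_iff canonical_embedding_def by (auto simp: dual_ball_iff intro!: exI[of _ "norm y"])
  from sup_norm_upper[OF this \<xi>(1)] show "norm y \<le> sup_norm (dual_ball smul) (canonical_embedding smul y)"
    using \<xi> by (simp add: canonical_embedding_def)
qed

lemma canonical_embedding_inj:
  assumes "canonical_embedding smul x = canonical_embedding smul y"
  shows "x = y"
proof -
  have "sup_norm (dual_ball smul) (canonical_embedding smul (x - y)) \<le> 0"
    using assms zero_in_dual_ball by (intro sup_norm_least) (auto simp: canonical_embedding_diff)
  then show ?thesis by (simp add: norm_canonical_embedding)
qed

end


section \<open>Operators dominated through essentially bounded functions\<close>

text \<open>A separable space is covered by countably many balls of radius \<open>\<delta>\<close>, so one of the preimages meets a given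
set of positive measure in a set of positive measure; treat the functions one after the other.\<close>

lemma (in prob_space) small_oscillation:
  fixes f :: "nat \<Rightarrow> 'a \<Rightarrow> 'b::{real_normed_vector, second_countable_topology}"
  assumes meas: "\<And>i. i < n \<Longrightarrow> f i \<in> borel_measurable M" and "\<delta> > 0"
    and B: "B \<in> events" "prob B > 0"
  shows "\<exists>A\<in>events. A \<subseteq> B \<and> prob A > 0 \<and> (\<forall>i<n. \<exists>z. \<forall>k\<in>A. norm (f i k - z) \<le> \<delta>)"
  using meas
proof (induction n)
  case 0
  then show ?case using B by auto
next
  case (Suc n)
  then obtain A where A: "A \<in> events" "A \<subseteq> B" "prob A > 0" "\<forall>i<n. \<exists>z. \<forall>k\<in>A. norm (f i k - z) \<le> \<delta>"
    by auto
  have [measurable]: "f n \<in> borel_measurable M" "A \<in> events" using Suc.prems A by auto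
  obtain D :: "'b set" where D: "countable D" "\<And>X. open X \<Longrightarrow> X \<noteq> {} \<Longrightarrow> \<exists>d\<in>D. d \<in> X"
    using countable_dense_exists by blast
  define G where "G z = {k \<in> space M. k \<in> A \<and> norm (f n k - z) \<le> \<delta>}" for z
  have G: "G z \<in> events" for z unfolding G_def by measurable
  have cover: "A \<subseteq> (\<Union>z\<in>D. G z)"
  proof
    fix k assume k: "k \<in> A"
    obtain z where "z \<in> D" "z \<in> ball (f n k) \<delta>" using D(2)[of "ball (f n k) \<delta>"] \<open>\<delta> > 0\<close> by auto
    then show "k \<in> (\<Union>z\<in>D. G z)"
      using k sets.sets_into_space[OF A(1)] by (auto simp: G_def dist_norm intro!: bexI[of _ z])
  qed
  have "\<exists>z\<in>D. prob (G z) > 0"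
  proof (rule ccontr)
    assume "\<not> ?thesis"
    then have "prob (G z) = 0" if "z \<in> D" for z
      using that measure_nonneg[of M "G z"] by (meson linorder_not_le order_antisym)
    then have "G z \<in> null_sets M" if "z \<in> D" for z
      using that G by (auto simp: null_sets_def emeasure_eq_measure)
    then have "(\<Union>z\<in>D. G z) \<in> null_sets M" using D(1) by (intro null_sets_UN') auto
    then have "A \<in> null_sets M" using cover A(1) null_sets_subset by blast
    then show False using A(3) by (auto simp: null_sets_def emeasure_eq_measure)
  qed
  then obtain z where z: "prob (G z) > 0" by blast
  show ?case
  proof (rule bexI[OF _ G[of z]], intro conjI allI impI)
    show "G z \<subseteq> B" using A(2) by (auto simp: G_def)
    show "\<exists>w. \<forall>k\<in>G z. norm (f i k - w) \<le> \<delta>" if i: "i < Suc n" for i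
    proof (cases "i = n")
      case True
      then show ?thesis by (auto simp: G_def)
    next
      case False
      then have "i < n" using i by simp
      then obtain w where "\<forall>k\<in>A. norm (f i k - w) \<le> \<delta>" using A(4) by blast
      then show ?thesis by (auto simp: G_def)
    qed
  qed (rule z)
qed

definition (in prob_space) average :: "'a set \<Rightarrow> ('a \<Rightarrow> 'f::rc_field) \<Rightarrow> 'f" where
  "average B f = (1 / prob B) *\<^sub>R (\<integral>k. indicator B k *\<^sub>R f k \<partial>M)"

text \<open>The average over \<open>B\<close> lies in every disc that contains almost all values on \<open>B\<close>.  Used with centre zero to see that
averaging is a functional in the polar, and with small discs to see that it nearly evaluates.\<close>

lemma (in prob_space) average_near:
  fixes f :: "'a \<Rightarrow> 'f::rc_field"
  assumes B: "B \<in> events" "prob B > 0" and f: "integrable M f"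
    and near: "AE k in M. k \<in> B \<longrightarrow> norm (f k - z) \<le> \<delta>"
  shows "norm (average B f - z) \<le> \<delta>"
proof -
  have [measurable]: "B \<in> events" by (rule B)
  have int: "integrable M (\<lambda>k. indicator B k *\<^sub>R f k)" by (rule integrable_mult_indicator[OF B(1) f])
  have intz: "integrable M (\<lambda>k. indicator B k *\<^sub>R z)" using B by (simp add: emeasure_eq_measure)
  have "(\<integral>k. indicator B k *\<^sub>R (f k - z) \<partial>M) = (\<integral>k. indicator B k *\<^sub>R f k \<partial>M) - (\<integral>k. indicator B k *\<^sub>R z \<partial>M)"
    using int intz by (simp add: scaleR_diff_right)
  also have "(\<integral>k. indicator B k *\<^sub>R z \<partial>M) = prob B *\<^sub>R z" using B by (simp add: emeasure_eq_measure)
  finally have eq: "average B f - z = (1 / prob B) *\<^sub>R (\<integral>k. indicator B k *\<^sub>R (f k - z) \<partial>M)"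
    using B(2) by (simp add: average_def scaleR_diff_right)
  have "norm (\<integral>k. indicator B k *\<^sub>R (f k - z) \<partial>M) \<le> (\<integral>k. indicator B k *\<^sub>R \<delta> \<partial>M)"
  proof (rule order_trans[OF integral_norm_bound integral_mono_AE])
    show "integrable M (\<lambda>k. norm (indicator B k *\<^sub>R (f k - z)))"
      using int intz by (simp add: scaleR_diff_right del: norm_scaleR)
    show "integrable M (\<lambda>k. indicator B k *\<^sub>R \<delta>)" using B by (simp add: emeasure_eq_measure)
    show "AE k in M. norm (indicator B k *\<^sub>R (f k - z)) \<le> indicator B k *\<^sub>R \<delta>"
      using near by eventually_elim (auto simp: indicator_def)
  qed
  also have "(\<integral>k. indicator B k *\<^sub>R \<delta> \<partial>M) = prob B * \<delta>" using B by (simp add: emeasure_eq_measure)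
  finally show ?thesis unfolding eq using B(2) by (simp add: field_simps)
qed

text \<open>Point evaluations are not available on \<open>L\<^sub>\<infinity>(\<mu>)\<close>; averages over sets of small oscillation take their
place.  If the sum of the \<open>|A x\<^sub>i|\<^sup>p\<close> exceeded the supremum over the polar by \<open>\<epsilon>\<close> on a set of positive
measure, the average over a suitable subset would be an element of the polar that contradicts the
definition of the supremum.\<close>

theorem p_summing_if_dominated_through_Linf:
  fixes sE :: "'f::rc_field \<Rightarrow> 'e \<Rightarrow> 'e::{topological_ab_group_add, t2_space}"
    and T :: "'e \<Rightarrow> 'l::real_normed_vector" and \<mu> :: "'k measure"
  assumes p: "1 \<le> p" and E: "locally_convex_space sE" and prob: "prob_space \<mu>"
    and A: "is_operator (type_tvs sE) (Linf_space \<mu> :: ('f, ('k \<Rightarrow> 'f) set) tvs) A"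
    and C: "C > 0" and dom: "\<And>x. norm (T x) \<le> C * Lp_norm p \<mu> (class_rep (A x))"
  shows "\<exists>U\<in>closed_ac_nhds0 sE. p_summing_wrt sE U p T"
proof -
  interpret E: locally_convex_space sE by (rule E)
  interpret prob_space \<mu> by (rule prob)
  interpret N: normed_quotient fscale "Linf_fun \<mu>" "Linf_norm \<mu>" "ae_class \<mu>" "class_add \<mu>" "class_scale \<mu>"
    "\<lambda>A :: ('k \<Rightarrow> 'f) set. Linf_norm \<mu> (class_rep A)"
    by (rule normed_quotient_Linf)
  define F where "F x = class_rep (A x)" for x
  define U where "U = {x. Linf_norm \<mu> (F x) \<le> 1}"
  have U: "U \<in> closed_ac_nhds0 sE"
    using N.is_operator_unit_ball[OF E] A by (simp add: U_def F_def Linf_space_eq)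
  then have U0: "0 \<in> interior U" by (simp add: closed_ac_nhds0_def)
  have A_in: "A x \<in> N.S" and A_add: "A (x + y) = class_add \<mu> (A x) (A y)" and A_sc: "A (sE a x) = class_scale \<mu> a (A x)" for x y a
    using A by (auto simp: is_operator_def type_tvs_def Linf_space_eq)
  have F: "F x \<in> Linf_fun \<mu> \<and> A x = ae_class \<mu> (F x)" for x
  proof -
    obtain f where f: "f \<in> Linf_fun \<mu>" "A x = ae_class \<mu> f" using A_in by blast
    have fm: "f \<in> borel_measurable \<mu>" using f by (simp add: Linf_fun_def)
    note rep = class_rep_ae[OF fm]
    obtain c where "AE k in \<mu>. norm (f k) \<le> c" using f by (auto simp: Linf_fun_def)
    then have "AE k in \<mu>. norm (F x k) \<le> c" using rep(2) unfolding F_def f(2) by eventually_elim simp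
    then show ?thesis
      using rep fm f(2) ae_class_eq_iff[OF fm rep(1)] unfolding Linf_fun_def F_def
      by (auto simp: eq_commute[of "f _"])
  qed
  then have F_Linf: "F x \<in> Linf_fun \<mu>" and A_eq: "A x = ae_class \<mu> (F x)" for x by blast+
  have F_meas[measurable]: "F x \<in> borel_measurable \<mu>" for x using F_Linf[of x] by (simp add: Linf_fun_def)
  have F_int: "integrable \<mu> (F x)" for x
    using Linf_norm_AE[OF F_Linf[of x]] by (rule integrable_const_bound) simp
  have F_add: "AE k in \<mu>. F (x + y) k = F x k + F y k" for x y
  proof -
    have "ae_class \<mu> (F (x + y)) = ae_class \<mu> (F x + F y)"
      using A_add[of x y] unfolding A_eq by (simp add: class_add_ae)
    then show ?thesis by (subst (asm) ae_class_eq_iff) (auto simp: plus_fun_def)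
  qed
  have F_sc: "AE k in \<mu>. F (sE a x) k = a * F x k" for a x
  proof -
    have "ae_class \<mu> (F (sE a x)) = ae_class \<mu> (fscale a (F x))"
      using A_sc[of a x] unfolding A_eq by (simp add: class_scale_ae)
    then show ?thesis by (subst (asm) ae_class_eq_iff) (auto simp: fscale_def)
  qed
  have F_le_1: "AE k in \<mu>. norm (F x k) \<le> 1" if "x \<in> U" for x
    using Linf_norm_AE[OF F_Linf[of x]] that unfolding U_def by (auto elim: eventually_mono)
  have average_polar: "(\<lambda>x. average B (F x)) \<in> polar sE U" if B: "B \<in> events" "prob B > 0" for B
    unfolding E.polar_iff[OF U0]
  proof (intro conjI allI ballI)
    have [measurable]: "B \<in> events" by (rule B)
    fix x y and a :: 'f
    have int: "integrable \<mu> (\<lambda>k. indicator B k *\<^sub>R F x k)" for x by (rule integrable_mult_indicator[OF B(1) F_int])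
    have "(\<integral>k. indicator B k *\<^sub>R F (x + y) k \<partial>\<mu>) = (\<integral>k. indicator B k *\<^sub>R F x k + indicator B k *\<^sub>R F y k \<partial>\<mu>)"
      using F_add[of x y] by (intro integral_cong_AE) (auto simp: scaleR_add_right)
    then show "average B (F (x + y)) = average B (F x) + average B (F y)"
      using int by (simp add: average_def scaleR_add_right)
    have "(\<integral>k. indicator B k *\<^sub>R F (sE a x) k \<partial>\<mu>) = (\<integral>k. a * (indicator B k *\<^sub>R F x k) \<partial>\<mu>)"
      using F_sc[of a x] by (intro integral_cong_AE) auto
    also have "\<dots> = a * (\<integral>k. indicator B k *\<^sub>R F x k \<partial>\<mu>)" by (rule integral_mult_right_zero)
    finally show "average B (F (sE a x)) = a * average B (F x)"
      by (simp only: average_def mult_scaleR_right)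
  next
    fix x assume "x \<in> U"
    then have "AE k in \<mu>. k \<in> B \<longrightarrow> norm (F x k - 0) \<le> 1"
      using F_le_1[of x] by (auto elim: eventually_mono)
    from average_near[OF B F_int this] show "norm (average B (F x)) \<le> 1" by simp
  qed
  have "p_summing_wrt sE U p T"
    unfolding p_summing_wrt_def
  proof (intro exI[of _ C] conjI C allI impI)
    fix n and x :: "nat \<Rightarrow> 'e" assume x: "\<forall>i\<le>n. x i \<in> U"
    define b where "b \<xi> = (\<Sum>i\<le>n. norm (\<xi> (x i)) powr p)" for \<xi> :: "'e \<Rightarrow> 'f"
    define S where "S = (SUP \<xi>\<in>polar sE U. b \<xi> powr (1 / p))"
    have b0: "0 \<le> b \<xi>" for \<xi> by (auto simp: b_def intro!: sum_nonneg)
    have b_le: "b \<xi> \<le> real (n + 1)" if "\<xi> \<in> polar sE U" for \<xi>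
    proof -
      have "norm (\<xi> (x i)) powr p \<le> 1" if "i \<le> n" for i
        using powr_mono2[of p "norm (\<xi> (x i))" 1] \<open>\<xi> \<in> polar sE U\<close> x that p by (simp add: polar_def)
      then have "b \<xi> \<le> (\<Sum>i\<le>n. 1)" unfolding b_def by (intro sum_mono) auto
      then show ?thesis by simp
    qed
    have S_upper: "b \<xi> powr (1 / p) \<le> S" if "\<xi> \<in> polar sE U" for \<xi>
      unfolding S_def using that
    proof (rule cSUP_upper)
      show "bdd_above ((\<lambda>\<xi>. b \<xi> powr (1 / p)) ` polar sE U)"
        using b_le b0 p by (intro bdd_aboveI2[of _ _ "real (n + 1) powr (1 / p)"] powr_mono2) auto
    qed
    have S0: "0 \<le> S" using S_upper[OF E.zero_in_polar[OF U0]] by (rule order_trans[OF powr_ge_zero])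
    have b_S: "b \<xi> \<le> S powr p" if "\<xi> \<in> polar sE U" for \<xi>
    proof -
      have "(b \<xi> powr (1 / p)) powr p \<le> S powr p" using S_upper[OF that] p by (intro powr_mono2) auto
      then show ?thesis using p b0[of \<xi>] by (simp add: powr_powr)
    qed
    define s where "s k = (\<Sum>i\<le>n. norm (F (x i) k) powr p)" for k
    have s_meas[measurable]: "s \<in> borel_measurable \<mu>" unfolding s_def by measurable
    have int_p: "integrable \<mu> (\<lambda>k. norm (F (x i) k) powr p)" if "i \<le> n" for i
    proof (rule integrable_const_bound[where B=1])
      show "AE k in \<mu>. norm (norm (F (x i) k) powr p) \<le> 1"
        using F_le_1[of "x i"] x that p
        by (auto elim!: eventually_mono intro: powr_mono2[of p _ 1, simplified])
    qed measurable
    have AE_s: "AE k in \<mu>. s k \<le> S powr p + \<epsilon>" if \<epsilon>: "\<epsilon> > 0" for \<epsilon>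
    proof -
      define B where "B = {k \<in> space \<mu>. S powr p + \<epsilon> < s k \<and> (\<forall>i\<in>{..n}. norm (F (x i) k) \<le> 1)}"
      have B: "B \<in> events" unfolding B_def by measurable
      have "prob B = 0"
      proof (rule ccontr)
        assume "prob B \<noteq> 0"
        then have B_pos: "prob B > 0" using measure_nonneg[of \<mu> B] by linarith
        \<comment> \<open>The error \<open>\<epsilon>\<close> is shared among the \<open>n + 1\<close> summands.\<close>
        define \<eta> where "\<eta> = \<epsilon> / real (n + 1)"
        have \<eta>: "\<eta> > 0" using \<epsilon> by (simp add: \<eta>_def)
        have "uniformly_continuous_on {0..1} (\<lambda>t::real. t powr p)"
          using p by (intro compact_uniformly_continuous continuous_on_powr' continuous_intros) auto
        then obtain \<delta> where \<delta>: "\<delta> > 0" "\<And>s t. s \<in> {0..1} \<Longrightarrow> t \<in> {0..1} \<Longrightarrow> dist s t < \<delta> \<Longrightarrow> dist (s powr p) (t powr p) < \<eta>"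
          using \<eta> unfolding uniformly_continuous_on_def by metis
        have "\<delta> / 3 > 0" using \<delta>(1) by simp
        from small_oscillation[where f="\<lambda>i. F (x i)" and n="Suc n", OF F_meas this B B_pos]
        obtain D where D: "D \<in> events" "D \<subseteq> B" "prob D > 0" 
          and osc: "\<And>i. i \<le> n \<Longrightarrow> \<exists>z. \<forall>k\<in>D. norm (F (x i) k - z) \<le> \<delta> / 3"
          by (auto simp: less_Suc_eq_le)
        define \<xi> where "\<xi> = (\<lambda>x. average D (F x))"
        have \<xi>: "\<xi> \<in> polar sE U" unfolding \<xi>_def by (rule average_polar[OF D(1,3)])
        have "D \<noteq> {}" using D(3) by auto
        then obtain k where k: "k \<in> D" by blast
        have near: "norm (F (x i) k) powr p \<le> norm (\<xi> (x i)) powr p + \<eta>" if i: "i \<le> n" for i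
        proof -
          obtain z where z: "\<forall>k\<in>D. norm (F (x i) k - z) \<le> \<delta> / 3" using osc[OF i] by blast
          have "norm (\<xi> (x i) - z) \<le> \<delta> / 3"
            unfolding \<xi>_def using z by (intro average_near[OF D(1,3) F_int]) auto
          moreover have "norm (F (x i) k - z) \<le> \<delta> / 3" using z k by blast
          moreover have "norm (F (x i) k - \<xi> (x i)) \<le> norm (F (x i) k - z) + norm (\<xi> (x i) - z)"
            using norm_triangle_ineq4[of "F (x i) k - z" "\<xi> (x i) - z"] by simp
          moreover have "\<bar>norm (F (x i) k) - norm (\<xi> (x i))\<bar> \<le> norm (F (x i) k - \<xi> (x i))"
            by (rule norm_triangle_ineq3)
          ultimately have "dist (norm (F (x i) k)) (norm (\<xi> (x i))) < \<delta>"
            using \<delta>(1) by (simp add: dist_real_def)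
          moreover have "norm (F (x i) k) \<le> 1" using k D(2) i by (auto simp: B_def)
          moreover have "norm (\<xi> (x i)) \<le> 1" using \<xi> x i by (simp add: polar_def)
          ultimately have "dist (norm (F (x i) k) powr p) (norm (\<xi> (x i)) powr p) < \<eta>"
            by (intro \<delta>(2)) auto
          then show ?thesis by (simp add: dist_real_def)
        qed
        have "s k \<le> (\<Sum>i\<le>n. norm (\<xi> (x i)) powr p + \<eta>)"
          unfolding s_def using near by (intro sum_mono) auto
        also have "\<dots> = b \<xi> + \<epsilon>" by (simp add: b_def sum.distrib \<eta>_def)
        also have "\<dots> \<le> S powr p + \<epsilon>" using b_S[OF \<xi>] by simp
        finally show False using k D(2) by (auto simp: B_def)
      qed
      then have "AE k in \<mu>. k \<notin> B" using B by (intro AE_not_in) (auto simp: null_sets_def emeasure_eq_measure)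
      moreover have "AE k in \<mu>. \<forall>i\<in>{..n}. norm (F (x i) k) \<le> 1"
        using x F_le_1 by (intro AE_finite_allI) auto
      ultimately show ?thesis using AE_space by eventually_elim (auto simp: B_def not_less)
    qed
    have s_int: "integrable \<mu> s" unfolding s_def using int_p by (intro Bochner_Integration.integrable_sum) auto
    have "(\<integral>k. s k \<partial>\<mu>) \<le> S powr p"
    proof (rule field_le_epsilon)
      fix \<epsilon> :: real assume "\<epsilon> > 0"
      have "(\<integral>k. s k \<partial>\<mu>) \<le> (\<integral>k. S powr p + \<epsilon> \<partial>\<mu>)"
        using s_int AE_s[OF \<open>\<epsilon> > 0\<close>] by (intro integral_mono_AE) auto
      then show "(\<integral>k. s k \<partial>\<mu>) \<le> S powr p + \<epsilon>" by (simp add: prob_space)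
    qed
    then have int_sum: "(\<Sum>i\<le>n. (\<integral>k. norm (F (x i) k) powr p \<partial>\<mu>)) \<le> S powr p"
      unfolding s_def using int_p by (subst (asm) Bochner_Integration.integral_sum) auto
    have "norm (T (x i)) powr p \<le> C powr p * (\<integral>k. norm (F (x i) k) powr p \<partial>\<mu>)" for i
    proof -
      have "norm (T (x i)) powr p \<le> (C * Lp_norm p \<mu> (F (x i))) powr p"
        using dom[of "x i"] p by (intro powr_mono2) (auto simp: F_def)
      then show ?thesis using C by (simp add: powr_mult Lp_norm_powr[OF p])
    qed
    then have "(\<Sum>i\<le>n. norm (T (x i)) powr p) \<le> C powr p * (\<Sum>i\<le>n. (\<integral>k. norm (F (x i) k) powr p \<partial>\<mu>))"
      unfolding sum_distrib_left by (intro sum_mono)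
    also have "\<dots> \<le> C powr p * S powr p"
      using int_sum by (intro mult_left_mono) auto
    also have "\<dots> = (C * S) powr p" using C S0 by (simp add: powr_mult)
    finally have "(\<Sum>i\<le>n. norm (T (x i)) powr p) powr (1 / p) \<le> ((C * S) powr p) powr (1 / p)"
      using p by (intro powr_mono2) (auto intro!: sum_nonneg)
    also have "\<dots> = C * S" using C S0 p by (simp add: powr_powr)
    finally show "(\<Sum>i\<le>n. norm (T (x i)) powr p) powr (1 / p)
        \<le> C * (SUP \<xi>\<in>polar sE U. (\<Sum>i\<le>n. norm (\<xi> (x i)) powr p) powr (1 / p))"
      by (simp add: S_def b_def)
  qed
  then show ?thesis using U by blast
qed

section \<open>Factorizations of a dominated operator\<close>

lemma (in prob_space) Linf_subset_Lp:
  assumes "p \<ge> 1"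
  shows "Linf_fun M \<subseteq> (Lp_fun p M :: ('a \<Rightarrow> 'f::rc_field) set)"
proof
  fix f :: "'a \<Rightarrow> 'f" assume f: "f \<in> Linf_fun M"
  then have [measurable]: "f \<in> borel_measurable M" by (simp add: Linf_fun_def)
  have "integrable M (\<lambda>k. norm (f k) powr p)"
  proof (rule integrable_const_bound)
    show "AE k in M. norm (norm (f k) powr p) \<le> Linf_norm M f powr p"
      using Linf_norm_AE[OF f] assms by (auto elim!: eventually_mono intro: powr_mono2)
  qed measurable
  then show "f \<in> Lp_fun p M" by (simp add: Lp_fun_def)
qed

lemma regular_prob_measure_prob_space: "regular_prob_measure K \<mu> \<Longrightarrow> prob_space \<mu>"
  by (simp add: regular_prob_measure_def)

lemma continuous_in_Linf:
  assumes "compact_space K" "regular_prob_measure K \<mu>" "f \<in> cont_fun K"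
  shows "f \<in> Linf_fun \<mu>" "Linf_norm \<mu> f \<le> sup_norm (topspace K) f"
proof -
  interpret prob_space \<mu> using assms(2) by (rule regular_prob_measure_prob_space)
  have "f \<in> borel_measurable \<mu>"
    using assms(2,3) by (auto simp: cont_fun_def intro: continuous_map_borel_measurable)
  moreover have AE: "AE k in \<mu>. norm (f k) \<le> sup_norm (topspace K) f"
    using assms(2) sup_norm_upper[OF cont_fun_bounded[OF assms(1,3)]]
    by (intro AE_I2) (auto simp: regular_prob_measure_def)
  ultimately show Linf: "f \<in> Linf_fun \<mu>" by (auto simp: Linf_fun_def)
  show "Linf_norm \<mu> f \<le> sup_norm (topspace K) f" by (rule Linf_norm_least[OF Linf AE])
qed

lemma ae_class_restrict:
  assumes "regular_prob_measure K \<mu>" "f \<in> borel_measurable \<mu>"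
  shows "ae_class \<mu> (restrict f (topspace K)) = ae_class \<mu> f"
proof -
  have space: "space \<mu> = topspace K" using assms(1) by (simp add: regular_prob_measure_def)
  have "restrict f (topspace K) \<in> borel_measurable \<mu>"
    using assms(2) by (subst measurable_cong[of _ _ f]) (auto simp: space)
  then show ?thesis using assms(2) by (subst ae_class_eq_iff) (auto simp: space intro!: AE_I2)
qed

text \<open>Composition with the contraction \<open>C(K) \<rightarrow> L\<^sub>\<infinity>(\<mu>)\<close>; it reduces factorizations through \<open>C(K)\<close> to
factorizations through \<open>L\<^sub>\<infinity>(\<mu>)\<close>.\<close>

lemma is_operator_C_to_Linf:
  fixes sE :: "'f::rc_field \<Rightarrow> 'e \<Rightarrow> 'e::{topological_ab_group_add, t2_space}"
  assumes E: "locally_convex_space sE" and K: "compact_space K" "topspace K \<noteq> {}"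
    and \<mu>: "regular_prob_measure K \<mu>"
    and I: "is_operator (type_tvs sE) (C_space K :: ('f, 'k \<Rightarrow> 'f) tvs) I"
  shows "is_operator (type_tvs sE) (Linf_space \<mu>) (J \<mu> \<circ> I)"
    and "\<And>x. I x \<in> cont_fun K"
proof -
  interpret prob_space \<mu> using \<mu> by (rule regular_prob_measure_prob_space)
  interpret C: normed_quotient fscale "cont_fun K :: ('k \<Rightarrow> 'f) set" "sup_norm (topspace K)" "\<lambda>f. restrict f (topspace K)"
    "\<lambda>f g. \<lambda>s\<in>topspace K. f s + g s" "\<lambda>a f. \<lambda>s\<in>topspace K. a * f s" "sup_norm (topspace K)"
    by (rule normed_quotient_C[OF K])
  interpret N: normed_quotient fscale "Linf_fun \<mu>" "Linf_norm \<mu>" "ae_class \<mu>" "class_add \<mu>" "class_scale \<mu>"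
    "\<lambda>A :: ('k \<Rightarrow> 'f) set. Linf_norm \<mu> (class_rep A)"
    by (rule normed_quotient_Linf)
  have I_in: "I x \<in> C.S" and I_add: "I (x + y) = (\<lambda>s\<in>topspace K. I x s + I y s)"
    and I_sc: "I (sE a x) = (\<lambda>s\<in>topspace K. a * I x s)" for x y a
    using I by (auto simp: is_operator_def type_tvs_def C_space_eq)
  have Ic: "I x \<in> cont_fun K" for x
  proof -
    obtain f where f: "f \<in> cont_fun K" "I x = restrict f (topspace K)" using I_in[of x] by blast
    then show ?thesis unfolding cont_fun_def f(2) by (auto intro: continuous_map_eq)
  qed
  then show "\<And>x. I x \<in> cont_fun K" .
  note Iinf = continuous_in_Linf[OF K(1) \<mu> Ic]
  have meas: "I x \<in> borel_measurable \<mu>" for x using Iinf(1)[of x] by (simp add: Linf_fun_def)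
  define U where "U = {x. sup_norm (topspace K) (I x) \<le> 1}"
  have "U \<in> closed_ac_nhds0 sE"
    using C.is_operator_unit_ball[OF E] I by (simp add: U_def C_space_eq)
  then have U: "0 \<in> interior U" by (simp add: closed_ac_nhds0_def)
  show "is_operator (type_tvs sE) (Linf_space \<mu>) (J \<mu> \<circ> I)"
    unfolding Linf_space_eq
  proof (rule N.is_operator_intoI[OF E U])
    show "(J \<mu> \<circ> I) x \<in> N.S" for x using Iinf(1) by (simp add: J_def)
    have "ae_class \<mu> (I (x + y)) = ae_class \<mu> (I x + I y)" for x y
      unfolding I_add using meas by (simp add: plus_fun_def ae_class_restrict[OF \<mu>])
    then show "(J \<mu> \<circ> I) (x + y) = class_add \<mu> ((J \<mu> \<circ> I) x) ((J \<mu> \<circ> I) y)" for x y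
      using meas by (simp add: J_def class_add_ae)
    have "ae_class \<mu> (I (sE a x)) = ae_class \<mu> (fscale a (I x))" for a x
      unfolding I_sc using meas by (simp add: fscale_def ae_class_restrict[OF \<mu>])
    then show "(J \<mu> \<circ> I) (sE a x) = class_scale \<mu> a ((J \<mu> \<circ> I) x)" for a x
      using meas by (simp add: J_def class_scale_ae)
    show "Linf_norm \<mu> (class_rep ((J \<mu> \<circ> I) x)) \<le> 1" if "x \<in> U" for x
      using that Iinf(2)[of x] N.nrm_cl[OF Iinf(1), of x] by (simp add: U_def J_def)
  qed
qed

text \<open>The setting shared by the factorizations: operators from \<open>L\<^sub>p(\<mu>)\<close> to \<open>\<ell>\<^sub>\<infinity>\<close> over the dual ball, and
operators from subspaces of \<open>L\<^sub>p(\<mu>)\<close> to \<open>L\<close>.\<close>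

locale Lp_to_linf = banach_space_over sL
  for sL :: "'f::rc_field \<Rightarrow> 'l \<Rightarrow> 'l::banach" +
  fixes p :: real and \<mu> :: "'k measure"
  assumes p: "1 \<le> p"
begin

sublocale N: two_normed_quotients fscale "Lp_fun p \<mu> :: ('k \<Rightarrow> 'f) set" "Lp_norm p \<mu>" "ae_class \<mu>" "class_add \<mu>" "class_scale \<mu>"
  "\<lambda>A. Lp_norm p \<mu> (class_rep A)"
  fscale "ell_fun (dual_ball sL)" "sup_norm (dual_ball sL)" "\<lambda>f. restrict f (dual_ball sL)"
  "\<lambda>f g. \<lambda>s\<in>dual_ball sL. f s + g s" "\<lambda>a f. \<lambda>s\<in>dual_ball sL. a * f s" "sup_norm (dual_ball sL)"
  using normed_quotient_Lp[OF p] normed_quotient_linf[of "dual_ball sL"] zero_in_dual_ball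
  unfolding two_normed_quotients_def by blast

sublocale NL: two_normed_quotients fscale "Lp_fun p \<mu> :: ('k \<Rightarrow> 'f) set" "Lp_norm p \<mu>" "ae_class \<mu>" "class_add \<mu>" "class_scale \<mu>"
  "\<lambda>A. Lp_norm p \<mu> (class_rep A)" sL UNIV norm id "(+)" sL norm
  using normed_quotient_type normed_quotient_Lp[OF p] by (simp add: two_normed_quotients_def)

end

lemma operator_Lp_linf_bound:
  fixes \<mu> :: "'k measure" and sL :: "'f::rc_field \<Rightarrow> 'l \<Rightarrow> 'l::banach"
  assumes p: "1 \<le> p" and L: "banach_space_over sL"
    and T': "is_operator (Lp_space p \<mu> :: ('f, ('k \<Rightarrow> 'f) set) tvs) (linf_space (dual_ball sL)) T'"
  obtains C where "C > 0" "\<And>A. A \<in> ae_class \<mu> ` Lp_fun p \<mu> \<Longrightarrow> sup_norm (dual_ball sL) (T' A) \<le> C * Lp_norm p \<mu> (class_rep A)"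
proof -
  interpret Lp_to_linf sL p \<mu> using L p by (simp add: Lp_to_linf_def Lp_to_linf_axioms_def)
  have op: "is_operator (sub_tvs N.A.X N.A.S) N.B.X T'"
    using T' by (simp add: N.A.sub_tvs_carrier Lp_space_eq linf_space_eq)
  show ?thesis
    by (rule N.is_operator_bounded[OF order_refl _ N.A.S_add N.A.S_smul op]) (use N.A.V_0 that in auto)
qed

text \<open>The domination makes \<open>ev U x \<mapsto> \<xi> (T x)\<close> well defined and bounded for the \<open>L\<^sub>p\<close> seminorm.  Extending
it for each \<open>\<xi>\<close> separately is enough, because the norm of \<open>\<ell>\<^sub>\<infinity>\<close> is a supremum over coordinates: the
space \<open>\<ell>\<^sub>\<infinity>\<close> is injective.\<close>

lemma dominated_imp_factorization_through_Lp:
  fixes sE :: "'f::rc_field \<Rightarrow> 'e \<Rightarrow> 'e::{topological_ab_group_add, t2_space}"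
    and sL :: "'f \<Rightarrow> 'l \<Rightarrow> 'l::banach"
  assumes p: "1 \<le> p" and E: "locally_convex_space sE" and L: "banach_space_over sL"
    and T: "is_operator (type_tvs sE) (type_tvs sL) T"
    and U: "0 \<in> interior U" and \<mu>: "regular_prob_measure (polar_space sE U) \<mu>"
    and C: "C > 0" and dom: "\<And>x. norm (T x) \<le> C * Lp_norm p \<mu> (locally_convex_space.ev sE U x)"
  obtains I T' where "is_operator (type_tvs sE) (C_space (polar_space sE U)) I"
    "is_operator (Lp_space p \<mu>) (linf_space (dual_ball sL)) T'"
    "canonical_embedding sL \<circ> T = T' \<circ> J \<mu> \<circ> I"
proof -
  interpret E: locally_convex_space sE by (rule E)
  interpret L: banach_space_over sL by (rule L)
  interpret prob_space \<mu> using \<mu> by (rule regular_prob_measure_prob_space)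
  let ?K = "polar_space sE U" and ?P = "polar sE U" and ?B = "dual_ball sL"
  have K: "compact_space ?K" "topspace ?K \<noteq> {}"
    using E.compact_polar_space[OF U] E.zero_in_polar[OF U] by auto
  have T_add: "T (x + y) = T x + T y" and T_sc: "T (sE a x) = sL a (T x)" for x y a
    using T by (auto simp: is_operator_def type_tvs_def)
  define e where "e = E.ev U"
  have e_Linf: "e x \<in> Linf_fun \<mu>" for x
    unfolding e_def by (rule continuous_in_Linf[OF K(1) \<mu> E.ev_cont_fun])
  then have e_Lp: "e x \<in> Lp_fun p \<mu>" for x using Linf_subset_Lp[OF p] by blast
  have e_meas: "e x \<in> borel_measurable \<mu>" for x using e_Lp[of x] by (simp add: Lp_fun_def)
  define I where "I x = restrict (e x) ?P" for x
  have I_op: "is_operator (type_tvs sE) (C_space ?K) I"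
  proof -
    interpret N: normed_quotient fscale "cont_fun ?K :: (('e \<Rightarrow> 'f) \<Rightarrow> 'f) set" "sup_norm (topspace ?K)" "\<lambda>f. restrict f (topspace ?K)"
      "\<lambda>f g. \<lambda>s\<in>topspace ?K. f s + g s" "\<lambda>a f. \<lambda>s\<in>topspace ?K. a * f s" "sup_norm (topspace ?K)"
      by (rule normed_quotient_C[OF K])
    show ?thesis
      unfolding C_space_eq
    proof (rule N.is_operator_intoI[OF E U])
      show "I x \<in> N.S" for x using E.ev_cont_fun[of U x] by (simp add: I_def e_def)
      show "sup_norm (topspace ?K) (I x) \<le> 1" if "x \<in> U" for x
        using that K(2) by (intro sup_norm_least) (auto simp: I_def e_def E.ev_def polar_def)
    qed (auto simp: I_def e_def E.ev_add[OF U] E.ev_scale[OF U])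
  qed
  have JI: "J \<mu> (I x) = ae_class \<mu> (e x)" for x
    using ae_class_restrict[OF \<mu> e_meas[of x]] by (simp add: J_def I_def)
  \<comment> \<open>\<open>T\<close> does not depend on the choice of the representative \<open>r f\<close>, by the domination.\<close>
  define r where "r f = (SOME x. e x = f)" for f
  have e_r: "e (r f) = f" if "f \<in> range e" for f
    unfolding r_def using that by (intro someI_ex[of "\<lambda>x. e x = f"]) auto
  have e_inj: "T x = T y" if "e x = e y" for x y
  proof -
    have "e (x - y) = e x - e y"
      using E.ev_add[OF U, of "x - y" y] by (simp add: e_def)
    then have "Lp_norm p \<mu> (e (x - y)) = 0" using that by (simp add: Lp_norm_def)
    then have "T (x - y) = 0" using dom[of "x - y"] by (simp add: e_def)
    then show ?thesis using T_add[of "x - y" y] by simp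
  qed
  have F: "module.subspace fscale (range e)"
    unfolding subspace_fscale_iff
  proof (intro conjI ballI allI)
    have "e 0 = 0" using E.ev_scale[OF U, of 0 0] by (simp add: e_def fun_eq_iff)
    then show "0 \<in> range e" by (metis rangeI)
    show "f + g \<in> range e" if "f \<in> range e" "g \<in> range e" for f g
      using that by (auto simp: e_def E.ev_add[OF U, symmetric])
    show "fscale a f \<in> range e" if "f \<in> range e" for a f
      using that by (auto simp: e_def E.ev_scale[OF U, symmetric])
  qed
  interpret Lp_to_linf sL p \<mu> using L p by (simp add: Lp_to_linf_def Lp_to_linf_axioms_def)
  let ?Q = "\<lambda>\<xi> \<Lambda>. (\<forall>f\<in>Lp_fun p \<mu>. \<forall>g\<in>Lp_fun p \<mu>. \<Lambda> (f + g) = \<Lambda> f + \<Lambda> g) \<and>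
      (\<forall>a. \<forall>f\<in>Lp_fun p \<mu>. \<Lambda> (fscale a f) = a * \<Lambda> f) \<and>
      (\<forall>f\<in>Lp_fun p \<mu>. norm (\<Lambda> f) \<le> C * Lp_norm p \<mu> f) \<and> (\<forall>x. \<Lambda> (e x) = \<xi> (T x))"
  have "\<forall>\<xi>\<in>?B. \<exists>\<Lambda>. ?Q \<xi> \<Lambda>"
  proof
    fix \<xi> assume "\<xi> \<in> ?B"
    then have \<xi>: "\<xi> (y + z) = \<xi> y + \<xi> z" "\<xi> (sL a y) = a * \<xi> y" "norm (\<xi> y) \<le> norm y" for y z a
      by (auto simp: L.dual_ball_iff)
    have Tr: "T (r (e x)) = T x" for x by (rule e_inj[OF e_r[OF rangeI]])
    obtain \<Lambda> where \<Lambda>: "\<And>f g. f \<in> Lp_fun p \<mu> \<Longrightarrow> g \<in> Lp_fun p \<mu> \<Longrightarrow> \<Lambda> (f + g) = \<Lambda> f + \<Lambda> g"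
      "\<And>a f. f \<in> Lp_fun p \<mu> \<Longrightarrow> \<Lambda> (fscale a f) = a * \<Lambda> f"
      "\<And>f. f \<in> Lp_fun p \<mu> \<Longrightarrow> norm (\<Lambda> f) \<le> C * Lp_norm p \<mu> f"
      "\<And>f. f \<in> range e \<Longrightarrow> \<Lambda> f = \<xi> (T (r f))"
    proof (rule hahn_banach_seminorm[OF vector_space_fscale N.A.V F, of "\<lambda>f. C * Lp_norm p \<mu> f" "\<lambda>f. \<xi> (T (r f))"])
      show "range e \<subseteq> Lp_fun p \<mu>" using e_Lp by auto
      show "C * Lp_norm p \<mu> (f + g) \<le> C * Lp_norm p \<mu> f + C * Lp_norm p \<mu> g"
        if "f \<in> Lp_fun p \<mu>" "g \<in> Lp_fun p \<mu>" for f g :: "('e \<Rightarrow> 'f) \<Rightarrow> 'f"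
        using C N.A.N_add[OF that] by (simp add: distrib_left[symmetric])
      show "C * Lp_norm p \<mu> (fscale a f) = norm a * (C * Lp_norm p \<mu> f)"
        if "f \<in> Lp_fun p \<mu>" for a and f :: "('e \<Rightarrow> 'f) \<Rightarrow> 'f"
        using N.A.N_sc[OF that] by simp
      show "\<xi> (T (r (f + g))) = \<xi> (T (r f)) + \<xi> (T (r g))" if "f \<in> range e" "g \<in> range e" for f g
      proof -
        obtain x y where xy: "f = e x" "g = e y" using \<open>f \<in> range e\<close> \<open>g \<in> range e\<close> by blast
        have "f + g = e (x + y)" by (simp add: xy e_def E.ev_add[OF U])
        then show ?thesis unfolding xy by (simp add: Tr T_add \<xi>)
      qed
      show "\<xi> (T (r (fscale a f))) = a * \<xi> (T (r f))" if "f \<in> range e" for a f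
      proof -
        obtain x where x: "f = e x" using \<open>f \<in> range e\<close> by blast
        have "fscale a f = e (sE a x)" by (simp add: x e_def E.ev_scale[OF U])
        then show ?thesis unfolding x by (simp add: Tr T_sc \<xi>)
      qed
      show "norm (\<xi> (T (r f))) \<le> C * Lp_norm p \<mu> f" if "f \<in> range e" for f
        using order_trans[OF \<xi>(3) dom[of "r f"]] e_r[OF that] by (simp add: e_def)
    qed blast
    have "\<Lambda> (e x) = \<xi> (T x)" for x using \<Lambda>(4)[OF rangeI, of x] Tr[of x] by simp
    then show "\<exists>\<Lambda>. ?Q \<xi> \<Lambda>"
      using \<Lambda>(1-3) by blast
  qed
  then obtain \<Lambda> where \<Lambda>: "\<forall>\<xi>\<in>?B. ?Q \<xi> (\<Lambda> \<xi>)"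
    by (rule bchoice[THEN exE])
  then have \<Lambda>_add: "\<Lambda> \<xi> (f + g) = \<Lambda> \<xi> f + \<Lambda> \<xi> g" and \<Lambda>_sc: "\<Lambda> \<xi> (fscale a f) = a * \<Lambda> \<xi> f"
    and \<Lambda>_le: "norm (\<Lambda> \<xi> f) \<le> C * Lp_norm p \<mu> f" and \<Lambda>_e: "\<Lambda> \<xi> (e x) = \<xi> (T x)"
    if "\<xi> \<in> ?B" "f \<in> Lp_fun p \<mu>" "g \<in> Lp_fun p \<mu>" for \<xi> f g a x
    using that by blast+
  define T' where "T' A = (\<lambda>\<xi>\<in>?B. \<Lambda> \<xi> (class_rep A))" for A
  have T'_cl: "T' (ae_class \<mu> f) = (\<lambda>\<xi>\<in>?B. \<Lambda> \<xi> f)" if f: "f \<in> Lp_fun p \<mu>" for f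
  proof -
    define g where "g = class_rep (ae_class \<mu> f)"
    have fm: "f \<in> borel_measurable \<mu>" using f by (simp add: Lp_fun_def)
    note g = class_rep_ae[OF fm, folded g_def]
    have fp: "integrable \<mu> (\<lambda>k. norm (f k) powr p)" using f by (simp add: Lp_fun_def)
    have "integrable \<mu> (\<lambda>k. norm (g k) powr p)"
      using g fm by (intro integrable_cong_AE_imp[OF fp]) (auto elim: eventually_mono)
    then have gL: "g \<in> Lp_fun p \<mu>" using g by (simp add: Lp_fun_def)
    have d: "g - f \<in> Lp_fun p \<mu>" by (rule N.A.V_diff[OF gL f])
    have "AE k in \<mu>. (g - f) k = 0" using g(2) by eventually_elim simp
    then have "Lp_norm p \<mu> (g - f) = 0" using Lp_norm_eq_0_iff[OF p d] by simp
    then have "\<Lambda> \<xi> (g - f) = 0" if "\<xi> \<in> ?B" for \<xi> using \<Lambda>_le[OF that d d] by simp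
    then have "\<Lambda> \<xi> g = \<Lambda> \<xi> f" if "\<xi> \<in> ?B" for \<xi> using \<Lambda>_add[OF that d f] that by simp
    then show ?thesis by (simp add: T'_def g_def[symmetric] cong: restrict_cong)
  qed
  have "is_operator (sub_tvs N.A.X N.A.S) N.B.X T'"
  proof (rule N.is_operator_boundedI[OF order_refl N.A.S_add N.A.S_smul, where C=C])
    fix A B :: "(('e \<Rightarrow> 'f) \<Rightarrow> 'f) set" and a :: 'f assume "A \<in> N.A.S"
    then obtain f where f: "f \<in> Lp_fun p \<mu>" "A = ae_class \<mu> f" by blast
    have "(\<lambda>\<xi>. \<Lambda> \<xi> f) \<in> ell_fun ?B"
      unfolding ell_fun_def bounded_iff using \<Lambda>_le[OF _ f(1) f(1)] by (auto intro!: exI[of _ "C * Lp_norm p \<mu> f"])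
    then show "T' A \<in> N.B.S" unfolding f(2) T'_cl[OF f(1)] by blast
    show "T' (class_scale \<mu> a A) = (\<lambda>s\<in>?B. a * T' A s)"
      unfolding f(2) N.A.smul_cl[OF f(1)] T'_cl[OF f(1)] T'_cl[OF N.A.V_sc[OF f(1)]]
      using \<Lambda>_sc[OF _ f(1) f(1)] by (simp cong: restrict_cong)
    show "sup_norm ?B (T' A) \<le> C * Lp_norm p \<mu> (class_rep A)"
      unfolding f(2) N.A.nrm_cl[OF f(1)] T'_cl[OF f(1)]
      using \<Lambda>_le[OF _ f(1) f(1)] L.zero_in_dual_ball by (intro sup_norm_least) auto
    assume "B \<in> N.A.S"
    then obtain g where g: "g \<in> Lp_fun p \<mu>" "B = ae_class \<mu> g" by blast
    show "T' (class_add \<mu> A B) = (\<lambda>s\<in>?B. T' A s + T' B s)"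
      unfolding f(2) g(2) N.A.add_cl[OF f(1) g(1)] T'_cl[OF f(1)] T'_cl[OF g(1)] T'_cl[OF N.A.V_add[OF f(1) g(1)]]
      using \<Lambda>_add[OF _ f(1) g(1)] by (simp cong: restrict_cong)
  qed
  then have T'_op: "is_operator (Lp_space p \<mu>) (linf_space ?B) T'"
    by (simp add: N.A.sub_tvs_carrier Lp_space_eq linf_space_eq)
  have "canonical_embedding sL \<circ> T = T' \<circ> J \<mu> \<circ> I"
    using \<Lambda>_e[OF _ e_Lp e_Lp]
    by (auto simp: fun_eq_iff JI T'_cl[OF e_Lp] canonical_embedding_def)
  then show ?thesis using that I_op T'_op by blast
qed

text \<open>A sequence in the range that converges is Cauchy, hence comes from a Cauchy sequence in \<open>L\<close>, because the
embedding is isometric.\<close>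

lemma closed_range_canonical_embedding:
  fixes sL :: "'f::rc_field \<Rightarrow> 'l \<Rightarrow> 'l::banach"
  assumes L: "banach_space_over sL"
  shows "closedin (Vtop (linf_space (dual_ball sL))) (range (canonical_embedding sL))"
proof -
  interpret L: banach_space_over sL by (rule L)
  let ?B = "dual_ball sL" and ?i = "canonical_embedding sL"
  have ne: "?B \<noteq> {}" using L.zero_in_dual_ball by blast
  interpret N: normed_quotient fscale "ell_fun ?B" "sup_norm ?B" "\<lambda>f. restrict f ?B"
    "\<lambda>f g. \<lambda>s\<in>?B. f s + g s" "\<lambda>a f. \<lambda>s\<in>?B. a * f s" "sup_norm ?B"
    by (rule normed_quotient_linf[OF ne])
  have i_in: "?i y \<in> N.S" for y by (rule L.canonical_embedding_in)
  have dist: "N.d (?i x) (?i y) = norm (x - y)" for x y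
  proof -
    have "N.d (?i x) (?i y) = sup_norm ?B (?i (x - y))"
      using i_in by (simp add: N.dist_nrm L.canonical_embedding_diff)
    then show ?thesis by (simp add: L.norm_canonical_embedding)
  qed
  have "closedin N.mtopology (range ?i)"
    unfolding N.metric_closedin_iff_sequentially_closed
  proof (intro conjI allI impI)
    show "range ?i \<subseteq> N.S" using i_in by blast
    fix \<sigma> l assume "range \<sigma> \<subseteq> range ?i \<and> limitin N.mtopology \<sigma> l sequentially"
    then have \<sigma>: "range \<sigma> \<subseteq> range ?i" and lim: "limitin N.mtopology \<sigma> l sequentially" by auto
    have "\<forall>n. \<exists>y. \<sigma> n = ?i y" using \<sigma> by blast
    then obtain y where y: "\<And>n. \<sigma> n = ?i (y n)" by metis
    have l: "l \<in> N.S" using lim by (rule N.limitin_mspace)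
    have "Cauchy y"
    proof (rule metric_CauchyI)
      fix e :: real assume "e > 0"
      then obtain M where M: "\<And>n. n \<ge> M \<Longrightarrow> N.d (\<sigma> n) l < e / 2"
        using lim unfolding N.limit_metric_sequentially by (meson half_gt_zero)
      have "dist (y m) (y n) < e" if "m \<ge> M" "n \<ge> M" for m n
      proof -
        have "N.d (\<sigma> m) (\<sigma> n) \<le> N.d (\<sigma> m) l + N.d l (\<sigma> n)" using i_in l by (intro N.triangle) (auto simp: y)
        also have "\<dots> < e" using M[OF that(1)] M[OF that(2)] by (simp add: N.commute)
        finally show ?thesis by (simp add: y dist dist_norm)
      qed
      then show "\<exists>M. \<forall>m\<ge>M. \<forall>n\<ge>M. dist (y m) (y n) < e" by blast
    qed
    then obtain z where z: "y \<longlonglongrightarrow> z" using Cauchy_convergent convergent_def by blast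
    have "limitin N.mtopology \<sigma> (?i z) sequentially"
      unfolding N.limitin_metric_dist_null
    proof (intro conjI)
      have "(\<lambda>n. norm (y n - z)) \<longlonglongrightarrow> 0" using z by (intro tendsto_norm_zero LIM_zero)
      then show "(\<lambda>n. N.d (\<sigma> n) (?i z)) \<longlonglongrightarrow> 0" by (simp only: y dist)
      show "\<forall>\<^sub>F n in sequentially. \<sigma> n \<in> N.S" using i_in by (simp only: y eventually_True)
    qed (rule i_in)
    then have "l = ?i z" by (rule N.limitin_metric_unique[OF lim _ sequentially_bot])
    then show "l \<in> range ?i" by blast
  qed
  then show ?thesis by (simp add: linf_space_eq)
qed

text \<open>Taking for \<open>H\<close> the whole preimage of the embedded copy of \<open>L\<close>, and not just the closure of the image of
\<open>E\<close>, makes the operator \<open>H \<rightarrow> L\<close> available without extending anything: it is \<open>T'\<close> followed by the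
inverse of the embedding.\<close>

lemma factorization_through_closed_subspace:
  fixes sL :: "'f::rc_field \<Rightarrow> 'l \<Rightarrow> 'l::banach" and \<mu> :: "'k measure"
  assumes p: "1 \<le> p" and L: "banach_space_over sL"
    and T': "is_operator (Lp_space p \<mu> :: ('f, ('k \<Rightarrow> 'f) set) tvs) (linf_space (dual_ball sL)) T'"
    and A: "\<And>x. A x \<in> ae_class \<mu> ` Lp_fun p \<mu>" and eq: "\<And>x. canonical_embedding sL (T x) = T' (A x)"
  obtains H T'' where "closed_subspace (Lp_space p \<mu>) H" "range A \<subseteq> H"
    "is_operator (sub_tvs (Lp_space p \<mu>) H) (type_tvs sL) T''" "\<And>x. T x = T'' (A x)"
proof -
  interpret L: banach_space_over sL by (rule L)
  let ?B = "dual_ball sL" and ?i = "canonical_embedding sL"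
  interpret Lp_to_linf sL p \<mu> using L p by (simp add: Lp_to_linf_def Lp_to_linf_axioms_def)
  have op: "is_operator N.A.X N.B.X T'" using T' by (simp add: Lp_space_eq linf_space_eq)
  have T'_add: "T' (class_add \<mu> P Q) = (\<lambda>s\<in>?B. T' P s + T' Q s)"
    and T'_sc: "T' (class_scale \<mu> a P) = (\<lambda>s\<in>?B. a * T' P s)" if "P \<in> N.A.S" "Q \<in> N.A.S" for P Q a
    using op that by (auto simp: is_operator_def)
  define H where "H = {P \<in> N.A.S. T' P \<in> range ?i}"
  define T'' where "T'' P = (THE y. ?i y = T' P)" for P
  have i_T'': "?i (T'' P) = T' P" if P: "P \<in> H" for P
  proof -
    obtain y where y: "?i y = T' P" using P by (auto simp: H_def)
    then have "T'' P = y" unfolding T''_def by (intro the_equality L.canonical_embedding_inj) auto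
    then show ?thesis using y by simp
  qed
  have H_S: "H \<subseteq> N.A.S" by (auto simp: H_def)
  have add_eq: "T' (class_add \<mu> P Q) = ?i (T'' P + T'' Q)" if "P \<in> H" "Q \<in> H" for P Q
    using that H_S by (subst T'_add) (auto simp: i_T'' L.canonical_embedding_simps)
  have sc_eq: "T' (class_scale \<mu> a P) = ?i (sL a (T'' P))" if "P \<in> H" for a P
    using that H_S by (subst T'_sc) (auto simp: i_T'' L.canonical_embedding_simps)
  have H_add: "class_add \<mu> P Q \<in> H" if "P \<in> H" "Q \<in> H" for P Q
    using add_eq[OF that] N.A.S_add that H_S by (auto simp: H_def)
  have H_sc: "class_scale \<mu> a P \<in> H" if "P \<in> H" for a P
    using sc_eq[OF that] N.A.S_smul that H_S by (auto simp: H_def)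
  have A_H: "range A \<subseteq> H" using A eq by (auto simp: H_def) (metis rangeI)
  have "closedin N.A.mtopology {P \<in> topspace N.A.mtopology. T' P \<in> range ?i}"
  proof (rule closedin_continuous_map_preimage)
    show "continuous_map N.A.mtopology N.B.mtopology T'" using op by (simp add: is_operator_def)
    show "closedin N.B.mtopology (range ?i)"
      using closed_range_canonical_embedding[OF L] by (simp add: linf_space_eq)
  qed
  then have "closedin N.A.mtopology H" by (simp add: H_def)
  then have closed: "closed_subspace (Lp_space p \<mu>) H"
    unfolding closed_subspace_def Lp_space_eq using H_S H_add H_sc A_H by auto
  obtain C where C: "C > 0" "\<And>P. P \<in> N.A.S \<Longrightarrow> sup_norm ?B (T' P) \<le> C * Lp_norm p \<mu> (class_rep P)"
    using operator_Lp_linf_bound[OF p L T'] by blast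
  have "is_operator (sub_tvs N.A.X H) NL.B.X T''"
  proof (rule NL.is_operator_boundedI[OF H_S H_add H_sc, where C=C])
    show "T'' P \<in> NL.B.S" for P by simp
    show "T'' (class_add \<mu> P Q) = T'' P + T'' Q" if "P \<in> H" "Q \<in> H" for P Q
      using add_eq[OF that] i_T''[OF H_add[OF that]] by (intro L.canonical_embedding_inj) simp
    show "T'' (class_scale \<mu> a P) = sL a (T'' P)" if "P \<in> H" for a P
      using sc_eq[OF that] i_T''[OF H_sc[OF that]] by (intro L.canonical_embedding_inj) simp
    show "norm (T'' P) \<le> C * Lp_norm p \<mu> (class_rep P)" if "P \<in> H" for P
      using C(2)[of P] that H_S L.norm_canonical_embedding[of "T'' P"] i_T''[OF that] by auto
  qed
  then have "is_operator (sub_tvs (Lp_space p \<mu>) H) (type_tvs sL) T''"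
    by (simp add: Lp_space_eq L.type_tvs_eq)
  moreover have "T x = T'' (A x)" for x
  proof (rule L.canonical_embedding_inj)
    have "A x \<in> H" using A_H by blast
    then show "?i (T x) = ?i (T'' (A x))" by (simp only: i_T'' eq)
  qed
  ultimately show ?thesis using that[OF closed A_H] by blast
qed


section \<open>The factorization theorem\<close>

theorem theorem17p15:
  fixes sE :: "'f::rc_field \<Rightarrow> 'e \<Rightarrow> 'e::{topological_ab_group_add, t2_space}"
    and sL :: "'f \<Rightarrow> 'l \<Rightarrow> 'l::banach"
    and T :: "'e \<Rightarrow> 'l"
    and p :: real
  assumes "1 \<le> p"
    and "locally_convex_space sE"
    and "banach_space_over sL"
    and "is_operator (type_tvs sE) (type_tvs sL) T"
  shows "((\<exists>U\<in>closed_ac_nhds0 sE. p_summing_wrt sE U p T) \<longleftrightarrow>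
      (\<exists>U\<in>closed_ac_nhds0 sE. \<exists>\<mu> I\<^sub>U H T'.
             regular_prob_measure (polar_space sE U) \<mu> \<and>
             is_operator (type_tvs sE) (C_space (polar_space sE U)) I\<^sub>U \<and>
             closed_subspace (Lp_space p \<mu>) H \<and>
             J \<mu> ` range I\<^sub>U \<subseteq> H \<and>
             is_operator (sub_tvs (Lp_space p \<mu>) H) (type_tvs sL) T' \<and>
             T = T' \<circ> J \<mu> \<circ> I\<^sub>U)) \<and>
    ((\<exists>U\<in>closed_ac_nhds0 sE. p_summing_wrt sE U p T) \<longleftrightarrow>
      (\<exists>U\<in>closed_ac_nhds0 sE. \<exists>\<mu> I\<^sub>U T'.
             regular_prob_measure (polar_space sE U) \<mu> \<and>
             is_operator (type_tvs sE) (C_space (polar_space sE U)) I\<^sub>U \<and>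
             is_operator (Lp_space p \<mu>) (linf_space (dual_ball sL)) T' \<and>
             canonical_embedding sL \<circ> T = T' \<circ> J \<mu> \<circ> I\<^sub>U)) \<and>
    ((\<exists>U\<in>closed_ac_nhds0 sE. p_summing_wrt sE U p T) \<longleftrightarrow>
      (\<exists>U\<in>closed_ac_nhds0 sE. \<exists>\<mu> I\<^sub>U T'.
             regular_prob_measure (polar_space sE U) \<mu> \<and>
             is_operator (type_tvs sE) (Linf_space \<mu>) I\<^sub>U \<and>
             is_operator (Lp_space p \<mu>) (linf_space (dual_ball sL)) T' \<and>
             canonical_embedding sL \<circ> T = T' \<circ> Jinf \<circ> I\<^sub>U))"
  (is "(?i \<longleftrightarrow> ?ii) \<and> (?i \<longleftrightarrow> ?iii) \<and> (?i \<longleftrightarrow> ?iv)")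
proof -
  note p = assms(1) and E = assms(2) and L = assms(3) and T = assms(4)
  interpret E: locally_convex_space sE by (rule E)
  interpret L: banach_space_over sL by (rule L)
  have K: "compact_space (polar_space sE U)" "topspace (polar_space sE U) \<noteq> {}" if "U \<in> closed_ac_nhds0 sE" for U
  proof -
    have "0 \<in> interior U" using that by (simp add: closed_ac_nhds0_def)
    then show "compact_space (polar_space sE U)" "topspace (polar_space sE U) \<noteq> {}"
      using E.compact_polar_space E.zero_in_polar by auto
  qed
  have JI_Lp: "J \<mu> (I x) \<in> ae_class \<mu> ` Lp_fun p \<mu>"
    if "U \<in> closed_ac_nhds0 sE" "regular_prob_measure (polar_space sE U) \<mu>"
      "is_operator (type_tvs sE) (C_space (polar_space sE U)) I" for U \<mu> I x
  proof -
    interpret prob_space \<mu> using that(2) by (rule regular_prob_measure_prob_space)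
    have "I x \<in> Linf_fun \<mu>"
      using continuous_in_Linf[OF K(1) that(2) is_operator_C_to_Linf(2)[OF E K that(2,3)]] that(1) by blast
    then show ?thesis using Linf_subset_Lp[OF p] by (auto simp: J_def)
  qed
  have i_iii: "?iii" if "?i"
  proof -
    from that obtain U where U: "U \<in> closed_ac_nhds0 sE" and summing: "p_summing_wrt sE U p T" by blast
    have U0: "0 \<in> interior U" and ac: "absolutely_convex sE U" using U by (auto simp: closed_ac_nhds0_def)
    have T_sc: "T (sE a x) = sL a (T x)" for a x using T by (simp add: is_operator_def type_tvs_def)
    obtain \<mu> C where \<mu>: "regular_prob_measure (polar_space sE U) \<mu>" "C > 0"
      "\<And>x. norm (T x) \<le> C * Lp_norm p \<mu> (E.ev U x)"
      using pietsch_domination[OF p E L T_sc U0 ac summing] by blast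
    obtain I T' where "is_operator (type_tvs sE) (C_space (polar_space sE U)) I"
      "is_operator (Lp_space p \<mu>) (linf_space (dual_ball sL)) T'"
      "canonical_embedding sL \<circ> T = T' \<circ> J \<mu> \<circ> I"
      using dominated_imp_factorization_through_Lp[OF p E L T U0 \<mu>] by blast
    then show ?thesis using U \<mu>(1) by blast
  qed
  have iii_ii: "?ii" if "?iii"
  proof -
    from that obtain U \<mu> I T' where U: "U \<in> closed_ac_nhds0 sE" and \<mu>: "regular_prob_measure (polar_space sE U) \<mu>"
      and I: "is_operator (type_tvs sE) (C_space (polar_space sE U)) I"
      and T': "is_operator (Lp_space p \<mu>) (linf_space (dual_ball sL)) T'"
      and eq: "canonical_embedding sL \<circ> T = T' \<circ> J \<mu> \<circ> I" by blast
    have eq': "canonical_embedding sL (T x) = T' ((J \<mu> \<circ> I) x)" for x using fun_cong[OF eq, of x] by simp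
    have in_Lp: "(J \<mu> \<circ> I) x \<in> ae_class \<mu> ` Lp_fun p \<mu>" for x using JI_Lp[OF U \<mu> I, of x] by simp
    obtain H T'' where H: "closed_subspace (Lp_space p \<mu>) H" "range (J \<mu> \<circ> I) \<subseteq> H"
      "is_operator (sub_tvs (Lp_space p \<mu>) H) (type_tvs sL) T''" "\<And>x. T x = T'' ((J \<mu> \<circ> I) x)"
      by (rule factorization_through_closed_subspace[where A="J \<mu> \<circ> I", OF p L T' in_Lp eq'])
        (rule that)
    have "J \<mu> ` range I \<subseteq> H" using H(2) by auto
    moreover have "T = T'' \<circ> J \<mu> \<circ> I" using H(4) by (simp add: fun_eq_iff)
    ultimately show ?thesis using U \<mu> I H(1,3) by blast
  qed
  have iii_iv: "?iv" if "?iii"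
  proof -
    from that obtain U \<mu> I T' where U: "U \<in> closed_ac_nhds0 sE" and \<mu>: "regular_prob_measure (polar_space sE U) \<mu>"
      and I: "is_operator (type_tvs sE) (C_space (polar_space sE U)) I"
      and T': "is_operator (Lp_space p \<mu>) (linf_space (dual_ball sL)) T'"
      and eq: "canonical_embedding sL \<circ> T = T' \<circ> J \<mu> \<circ> I" by blast
    have "is_operator (type_tvs sE) (Linf_space \<mu>) (J \<mu> \<circ> I)"
      by (rule is_operator_C_to_Linf(1)[OF E K[OF U] \<mu> I])
    moreover have "canonical_embedding sL \<circ> T = T' \<circ> Jinf \<circ> (J \<mu> \<circ> I)"
      using eq by (simp add: fun_eq_iff Jinf_def)
    ultimately show ?thesis using U \<mu> T' by blast
  qed
  have ii_i: "?i" if "?ii"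
  proof -
    from that obtain U \<mu> I H T' where U: "U \<in> closed_ac_nhds0 sE" and \<mu>: "regular_prob_measure (polar_space sE U) \<mu>"
      and I: "is_operator (type_tvs sE) (C_space (polar_space sE U)) I"
      and H: "closed_subspace (Lp_space p \<mu>) H" "J \<mu> ` range I \<subseteq> H"
      and T': "is_operator (sub_tvs (Lp_space p \<mu>) H) (type_tvs sL) T'"
      and eq: "T = T' \<circ> J \<mu> \<circ> I" by blast
    interpret Lp_to_linf sL p \<mu> using L p by (simp add: Lp_to_linf_def Lp_to_linf_axioms_def)
    have op: "is_operator (sub_tvs N.A.X H) NL.B.X T'"
      using T' by (simp add: Lp_space_eq L.type_tvs_eq)
    obtain C where C: "C > 0" "\<And>A. A \<in> H \<Longrightarrow> norm (T' A) \<le> C * Lp_norm p \<mu> (class_rep A)"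
      using H(1) NL.is_operator_bounded[OF _ _ _ _ op] by (auto simp: closed_subspace_def Lp_space_eq)
    have "norm (T x) \<le> C * Lp_norm p \<mu> (class_rep ((J \<mu> \<circ> I) x))" for x
      using C(2)[of "J \<mu> (I x)"] H(2) fun_cong[OF eq, of x] by auto
    then show ?thesis
      by (rule p_summing_if_dominated_through_Linf[OF p E regular_prob_measure_prob_space[OF \<mu>]
            is_operator_C_to_Linf(1)[OF E K[OF U] \<mu> I] C(1)])
  qed
  have iv_i: "?i" if "?iv"
  proof -
    from that obtain U \<mu> A T' where U: "U \<in> closed_ac_nhds0 sE" and \<mu>: "regular_prob_measure (polar_space sE U) \<mu>"
      and A: "is_operator (type_tvs sE) (Linf_space \<mu>) A"
      and T': "is_operator (Lp_space p \<mu>) (linf_space (dual_ball sL)) T'"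
      and eq: "canonical_embedding sL \<circ> T = T' \<circ> Jinf \<circ> A" by blast
    interpret prob_space \<mu> using \<mu> by (rule regular_prob_measure_prob_space)
    interpret N: normed_quotient fscale "Linf_fun \<mu>" "Linf_norm \<mu>" "ae_class \<mu>" "class_add \<mu>" "class_scale \<mu>"
      "\<lambda>A :: (('e \<Rightarrow> 'f) \<Rightarrow> 'f) set. Linf_norm \<mu> (class_rep A)"
      by (rule normed_quotient_Linf)
    obtain C where C: "C > 0" "\<And>P. P \<in> ae_class \<mu> ` Lp_fun p \<mu> \<Longrightarrow>
        sup_norm (dual_ball sL) (T' P) \<le> C * Lp_norm p \<mu> (class_rep P)"
      using operator_Lp_linf_bound[OF p L T'] by blast
    have "norm (T x) \<le> C * Lp_norm p \<mu> (class_rep (A x))" for x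
    proof -
      have "A x \<in> N.S" using A by (auto simp: is_operator_def type_tvs_def Linf_space_eq)
      then have "A x \<in> ae_class \<mu> ` Lp_fun p \<mu>" using Linf_subset_Lp[OF p] by blast
      moreover have "canonical_embedding sL (T x) = T' (A x)" using fun_cong[OF eq, of x] by (simp add: Jinf_def)
      ultimately show ?thesis using C(2)[of "A x"] L.norm_canonical_embedding[of "T x"] by simp
    qed
    then show ?thesis
      by (rule p_summing_if_dominated_through_Linf[OF p E prob_space_axioms A C(1)])
  qed
  show ?thesis
  proof (intro conjI)
    show "?i \<longleftrightarrow> ?ii" by (rule iffI[OF iii_ii[OF i_iii] ii_i])
    show "?i \<longleftrightarrow> ?iii" by (rule iffI[OF i_iii ii_i[OF iii_ii]])
    show "?i \<longleftrightarrow> ?iv" by (rule iffI[OF iii_iv[OF i_iii] iv_i])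
  qed
qed

end
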